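(* Let $n\ge 1$ and let $\{(\Gamma_k\backslash H_n, dist_k)\}_{k\in\mathbb{N}}$ be a sequence of compact Heisenberg manifolds, where each $\Gamma_k$ is a lattice in the Heisenberg Lie group $H_n$ of dimension $2n+1$ and each $dist_k$ is the distance on $\Gamma_k\backslash H_n$ induced by a left invariant (bracket generating) sub-Riemannian metric of rank $2n$. Assume that this sequence converges in the Gromov--Hausdorff topology, that the diameters of $(\Gamma_k\backslash H_n,dist_k)$ are uniformly bounded above by some $D>0$, and that the total measure of $\Gamma_k\backslash H_n$ with respect to the Popp's volume of the $k$-th metric converges to zero as $k\to\infty$. Then the limit space is isometric to a flat torus of lower dimension (that is, of dimension less than $2n+1$).
   Context: $H_n$ is the simply connected Lie group with Lie algebra $\mathfrak{h}_n$ having a basis $X_1,\dots,X_{2n},Z$ with $[X_i,X_{i+n}]=Z$ for $i=1,\dots,n$ and all other brackets of basis elements zero. A compact Heisenberg manifold is a quotient $\Gamma\backslash H_n$ by a lattice $\Gamma<H_n$. Left invariant sub-Riemannian metrics of rank $2n$: let $\mathfrak{v}\subset\mathfrak{h}_n$ be a $2n$-dimensional subspace which is bracket generating (here: $\mathfrak{v}+[\mathfrak{v},\mathfrak{v}]=\mathfrak{h}_n$) and $\langle\cdot,\cdot\rangle$ an inner product on $\mathfrak{v}$. Left translation gives a distribution $\mathcal{D}$ on $H_n$ with a metric $g$ on it. The distance between two points is the infimum of $\int_0^1\sqrt{g(\dot c,\dot c)}\,dt$ over absolutely continuous paths $c$ joining them with $\dot c(t)\in\mathcal{D}_{c(t)}$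 for a.e. $t$. It is invariant under left translations, and the quotient distance on $\Gamma\backslash H_n$ is also called left invariant. Popp's volume: take an orthonormal basis $e_1,\dots,e_{2n}$ of $\mathfrak{v}$, complete it by $e_{2n+1}$ to a basis of $\mathfrak{h}_n$, write $[e_i,e_j]=\sum_l c_{ij}^l e_l$ and let $\nu^1,\dots,\nu^{2n+1}$ be the dual basis; the Popp's volume is the left invariant form $\big(\sum_{i,j=1}^{2n}(c_{ij}^{2n+1})^2\big)^{-1/2}\nu^1\wedge\cdots\wedge\nu^{2n+1}$ (well defined up to sign, independent of the choices). It descends to $\Gamma\backslash H_n$, and the total measure is the absolute value of its integral over $\Gamma\backslash H_n$. A flat torus is a torus $\mathbb{T}^m$ with a flat Riemannian metric, with $m=0$ (a point) allowed. *)

theory Defs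
  imports "HOL-Analysis.Analysis" "HOL-Algebra.Coset"
begin

section \<open>The Heisenberg algebra and the Heisenberg group\<close>

text \<open>
  With \<open>n = CARD('n)\<close>, the basis \<open>X\<^sub>1, \<dots>, X\<^sub>2\<^sub>n, Z\<close> is indexed by \<open>('n + 'n) option\<close>:
  \<open>Some (Inl i)\<close> stands for \<open>X\<^sub>i\<close>, \<open>Some (Inr i)\<close> for \<open>X\<^sub>i\<^sub>+\<^sub>n\<close>, and \<open>None\<close> for \<open>Z\<close>.
\<close>

type_synonym 'n heis = "(real, ('n + 'n) option) vec"

definition heis_bracket :: "'n::finite heis \<Rightarrow> 'n heis \<Rightarrow> 'n heis" where
  "heis_bracket x y =
     axis None (\<Sum>i\<in>UNIV. x $ Some (Inl i) * y $ Some (Inr i) - x $ Some (Inr i) * y $ Some (Inl i))"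

text \<open>
  The simply connected group is realised in exponential coordinates: its points are the elements of
  the Lie algebra, the exponential map is the identity, and the multiplication is the
  Baker-Campbell-Hausdorff series, which stops after the bracket term because the algebra is 2-step
  nilpotent.
\<close>

definition heis_mult :: "'n::finite heis \<Rightarrow> 'n heis \<Rightarrow> 'n heis" where
  "heis_mult p q = p + q + (1/2) *\<^sub>R heis_bracket p q"

definition heisenberg :: "'n::finite heis monoid" where
  "heisenberg = \<lparr>carrier = UNIV, mult = heis_mult, one = 0\<rparr>"

lemma heis_bracket_basis:
  fixes i j :: "'n::finite"
  shows "heis_bracket (axis (Some (Inl i)) 1) (axis (Some (Inr j)) 1)
           = (if i = j then axis None 1 else 0 :: 'n heis)"
    and "heis_bracket (axis (Some (Inl i)) 1) (axis (Some (Inl j)) 1) = (0 :: 'n heis)"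
    and "heis_bracket (axis (Some (Inr i)) 1) (axis (Some (Inr j)) 1) = (0 :: 'n heis)"
    and "heis_bracket (axis None 1) y = (0 :: 'n heis)"
proof -
  have "(\<Sum>k\<in>UNIV. (if k = i then 1 else 0) * (if k = j then 1 else 0)) = (if i = j then 1 else (0::real))"
    by (subst sum.cong[OF refl, of _ _ "\<lambda>k. if k = i then if i = j then 1 else 0 else 0"]) simp_all
  then show "heis_bracket (axis (Some (Inl i)) 1) (axis (Some (Inr j)) 1)
           = (if i = j then axis None 1 else 0 :: 'n heis)"
    by (simp add: heis_bracket_def axis_def vec_eq_iff)
qed (simp_all add: heis_bracket_def axis_def vec_eq_iff)

lemma heis_bracket_anticommute: "heis_bracket y x = - heis_bracket x y"
  by (simp add: heis_bracket_def vec_eq_iff axis_def sum_subtractf mult.commute)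

lemma bilinear_heis_bracket: "bilinear (heis_bracket :: 'n::finite heis \<Rightarrow> _)"
  unfolding bilinear_def heis_bracket_def
  by (auto intro!: linearI simp: vec_eq_iff axis_def algebra_simps sum.distrib sum_subtractf sum_distrib_left)

lemma heis_bracket_nilpotent [simp]:
  "heis_bracket (heis_bracket x y) z = 0" "heis_bracket z (heis_bracket x y) = 0"
  by (simp_all add: heis_bracket_def vec_eq_iff axis_def)

lemma heis_bracket_self [simp]: "heis_bracket x x = 0"
  by (simp add: heis_bracket_def vec_eq_iff axis_def mult.commute)

lemma heis_bracket_add [simp]:
  "heis_bracket (x + y) z = heis_bracket x z + heis_bracket y z"
  "heis_bracket z (x + y) = heis_bracket z x + heis_bracket z y"
  by (simp_all add: bilinear_ladd[OF bilinear_heis_bracket] bilinear_radd[OF bilinear_heis_bracket])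

lemma heis_bracket_scale [simp]:
  "heis_bracket (c *\<^sub>R x) z = c *\<^sub>R heis_bracket x z"
  "heis_bracket z (c *\<^sub>R x) = c *\<^sub>R heis_bracket z x"
  by (simp_all add: bilinear_lmul[OF bilinear_heis_bracket] bilinear_rmul[OF bilinear_heis_bracket])

lemma heis_bracket_neg [simp]:
  "heis_bracket (- x) z = - heis_bracket x z" "heis_bracket z (- x) = - heis_bracket z x"
  by (simp_all add: bilinear_lneg[OF bilinear_heis_bracket] bilinear_rneg[OF bilinear_heis_bracket])

lemma heis_bracket_zero [simp]: "heis_bracket 0 z = 0" "heis_bracket z 0 = 0"
  by (simp_all add: bilinear_lzero[OF bilinear_heis_bracket] bilinear_rzero[OF bilinear_heis_bracket])

lemma heis_bracket_diff [simp]: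
  "heis_bracket (x - y) z = heis_bracket x z - heis_bracket y z"
  "heis_bracket z (x - y) = heis_bracket z x - heis_bracket z y"
  by (simp_all add: bilinear_lsub[OF bilinear_heis_bracket] bilinear_rsub[OF bilinear_heis_bracket])

lemma group_heisenberg: "group (heisenberg :: 'n::finite heis monoid)"
proof (rule groupI)
  fix x :: "'n heis"
  show "\<exists>y\<in>carrier heisenberg. y \<otimes>\<^bsub>heisenberg\<^esub> x = \<one>\<^bsub>heisenberg\<^esub>"
    by (rule bexI[of _ "- x"]) (auto simp: heisenberg_def heis_mult_def)
  fix y z :: "'n heis"
  show "x \<otimes>\<^bsub>heisenberg\<^esub> y \<otimes>\<^bsub>heisenberg\<^esub> z = x \<otimes>\<^bsub>heisenberg\<^esub> (y \<otimes>\<^bsub>heisenberg\<^esub> z)"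
    by (simp add: heisenberg_def heis_mult_def scaleR_add_right)
qed (simp_all add: heisenberg_def heis_mult_def)

text \<open>
  The group commutator is the exponential of the bracket, and the one-parameter subgroups are the
  lines through 0.
\<close>

lemma heis_commutator:
  "heis_mult (heis_mult p q) (heis_mult (- p) (- q)) = heis_bracket p q"
proof -
  have "heis_mult p q = (p + q) + (1/2) *\<^sub>R heis_bracket p q"
    and "heis_mult (- p) (- q) = - (p + q) + (1/2) *\<^sub>R heis_bracket p q"
    by (simp_all add: heis_mult_def)
  moreover have "heis_mult (a + (1/2) *\<^sub>R heis_bracket p q) (- a + (1/2) *\<^sub>R heis_bracket p q)
      = heis_bracket p q" for a
    by (simp add: heis_mult_def flip: scaleR_left.add)
  ultimately show ?thesis
    by metis
qed

lemma heis_one_parameter: "heis_mult (s *\<^sub>R x) (t *\<^sub>R x) = (s + t) *\<^sub>R x"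
  by (simp add: heis_mult_def algebra_simps)

definition left_diff :: "'n::finite heis \<Rightarrow> 'n heis \<Rightarrow> 'n heis" where
  "left_diff p = frechet_derivative (heis_mult p) (at 0)"

lemma left_diff_eq: "left_diff p w = w + (1/2) *\<^sub>R heis_bracket p w"
proof -
  have "linear (\<lambda>w. w + (1/2) *\<^sub>R heis_bracket p w)"
    by (auto intro!: linearI simp: scaleR_add_right)
  then have "bounded_linear (\<lambda>w. w + (1/2) *\<^sub>R heis_bracket p w)"
    by (simp add: linear_conv_bounded_linear)
  from has_derivative_add[OF has_derivative_const bounded_linear_imp_has_derivative[OF this], of p "at 0"]
  have "((\<lambda>q. p + (q + (1/2) *\<^sub>R heis_bracket p q)) has_derivative
          (\<lambda>w. w + (1/2) *\<^sub>R heis_bracket p w)) (at 0)"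
    by simp
  then have "(heis_mult p has_derivative (\<lambda>w. w + (1/2) *\<^sub>R heis_bracket p w)) (at 0)"
    by (simp add: heis_mult_def[abs_def] add.assoc)
  from frechet_derivative_at[OF this] show ?thesis
    by (simp add: left_diff_def fun_eq_iff)
qed

lemma bij_left_diff: "bij (left_diff p)"
  by (rule o_bij[of "left_diff (- p)"]) (auto simp: fun_eq_iff left_diff_eq)


section \<open>Left invariant sub-Riemannian metrics of rank \<open>2n\<close>\<close>

definition inner_product_on :: "'a::real_vector set \<Rightarrow> ('a \<Rightarrow> 'a \<Rightarrow> real) \<Rightarrow> bool" where
  "inner_product_on V g \<longleftrightarrow>
     (\<forall>x\<in>V. \<forall>y\<in>V. g x y = g y x) \<and>
     (\<forall>x\<in>V. \<forall>y\<in>V. \<forall>z\<in>V. g (x + y) z = g x z + g y z) \<and>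
     (\<forall>x\<in>V. \<forall>y\<in>V. \<forall>a. g (a *\<^sub>R x) y = a * g x y) \<and>
     (\<forall>x\<in>V. x \<noteq> 0 \<longrightarrow> g x x > 0)"

definition bracket_generating :: "'n::finite heis set \<Rightarrow> bool" where
  "bracket_generating V \<longleftrightarrow>
     {x + y | x y. x \<in> V \<and> y \<in> span {heis_bracket u w | u w. u \<in> V \<and> w \<in> V}} = UNIV"

definition sub_riemannian :: "'n::finite heis set \<Rightarrow> ('n heis \<Rightarrow> 'n heis \<Rightarrow> real) \<Rightarrow> bool" where
  "sub_riemannian V g \<longleftrightarrow>
     subspace V \<and> dim V = 2 * CARD('n) \<and> bracket_generating V \<and> inner_product_on V g"

definition distribution_at :: "'n::finite heis set \<Rightarrow> 'n heis \<Rightarrow> 'n heis set" where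
  "distribution_at V p = left_diff p ` V"

definition metric_at ::
    "('n::finite heis \<Rightarrow> 'n heis \<Rightarrow> real) \<Rightarrow> 'n heis \<Rightarrow> 'n heis \<Rightarrow> 'n heis \<Rightarrow> real" where
  "metric_at g p a b = g (inv_into UNIV (left_diff p) a) (inv_into UNIV (left_diff p) b)"

definition abs_continuous_on :: "real \<Rightarrow> real \<Rightarrow> (real \<Rightarrow> 'a::metric_space) \<Rightarrow> bool" where
  "abs_continuous_on s t c \<longleftrightarrow>
     (\<forall>\<epsilon>>0. \<exists>\<delta>>0. \<forall>(N::nat) a b.
        (\<forall>i<N. s \<le> a i \<and> a i \<le> b i \<and> b i \<le> t) \<and>
        disjoint_family_on (\<lambda>i. {a i<..<b i}) {..<N} \<and>
        (\<Sum>i<N. b i - a i) < \<delta>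
        \<longrightarrow> (\<Sum>i<N. dist (c (a i)) (c (b i))) < \<epsilon>)"

definition horizontal_path :: "'n::finite heis set \<Rightarrow> (real \<Rightarrow> 'n heis) \<Rightarrow> bool" where
  "horizontal_path V c \<longleftrightarrow>
     abs_continuous_on 0 1 c \<and>
     (AE t in lebesgue_on {0..1}.
        \<exists>w. (c has_vector_derivative w) (at t) \<and> w \<in> distribution_at V (c t))"

definition path_length ::
    "('n::finite heis \<Rightarrow> 'n heis \<Rightarrow> real) \<Rightarrow> (real \<Rightarrow> 'n heis) \<Rightarrow> ennreal" where
  "path_length g c =
     (\<integral>\<^sup>+ t. ennreal (sqrt (metric_at g (c t) (vector_derivative c (at t))
                                           (vector_derivative c (at t)))) \<partial>lebesgue_on {0..1})"

text \<open>
  The infimum below is finite when \<open>V\<close> is bracket generating (Chow's theorem), so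
  that \<^const>\<open>enn2real\<close> does not collapse an infinite value to 0.
\<close>

definition cc_dist ::
    "'n::finite heis set \<Rightarrow> ('n heis \<Rightarrow> 'n heis \<Rightarrow> real) \<Rightarrow> 'n heis \<Rightarrow> 'n heis \<Rightarrow> real" where
  "cc_dist V g p q =
     enn2real (INF c \<in> {c. horizontal_path V c \<and> c 0 = p \<and> c 1 = q}. path_length g c)"


section \<open>Quotients of the Heisenberg group\<close>

definition quotient_dist :: "('a \<Rightarrow> 'a \<Rightarrow> real) \<Rightarrow> 'a set \<Rightarrow> 'a set \<Rightarrow> real" where
  "quotient_dist d A B = (INF (a, b) \<in> A \<times> B. d a b)"

text \<open>
  The points of \<open>\<Gamma>\<setminus>H\<^sub>n\<close> are the cosets \<open>\<Gamma>p\<close>, which the library calls right cosets.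
\<close>

definition heis_quotient :: "'n::finite heis set \<Rightarrow> 'n heis set set" where
  "heis_quotient \<Gamma> = rcosets\<^bsub>heisenberg\<^esub> \<Gamma>"

text \<open>
  The measure which a left invariant measure \<open>\<mu>\<close> on \<open>H\<^sub>n\<close> induces on \<open>\<Gamma>\<setminus>H\<^sub>n\<close>, for a discrete subgroup
  \<open>\<Gamma>\<close>: the unique Borel measure for which the projection preserves the measure of every Borel set on
  which it is injective. If \<open>\<mu>\<close> is the measure of a left invariant volume form, this is the measure
  of the form to which it descends.
\<close>

definition quotient_measure ::
    "'n::finite heis set \<Rightarrow> 'n heis measure \<Rightarrow> 'n heis set measure" where
  "quotient_measure \<Gamma> \<mu> =
     (THE \<nu>. space \<nu> = heis_quotient \<Gamma> \<and>
          sets \<nu> = {B. B \<subseteq> heis_quotient \<Gamma> \<and> {p. \<Gamma> #>\<^bsub>heisenberg\<^esub> p \<in> B} \<in> sets borel} \<and>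
          (\<forall>A \<in> sets borel. inj_on (\<lambda>p. \<Gamma> #>\<^bsub>heisenberg\<^esub> p) A \<longrightarrow>
             emeasure \<nu> ((\<lambda>p. \<Gamma> #>\<^bsub>heisenberg\<^esub> p) ` A) = emeasure \<mu> A))"

definition quotient_total :: "'n::finite heis set \<Rightarrow> 'n heis measure \<Rightarrow> ennreal" where
  "quotient_total \<Gamma> \<mu> = emeasure (quotient_measure \<Gamma> \<mu>) (heis_quotient \<Gamma>)"

text \<open>
  A lattice is a discrete subgroup of finite covolume. Lebesgue measure in exponential coordinates is
  a Haar measure.
\<close>

definition heis_lattice :: "'n::finite heis set \<Rightarrow> bool" where
  "heis_lattice \<Gamma> \<longleftrightarrow> subgroup \<Gamma> heisenberg \<and> discrete \<Gamma> \<and> quotient_total \<Gamma> lborel < \<infinity>"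


section \<open>Popp's volume\<close>

text \<open>
  A frame \<open>e\<close> of the Lie algebra is adapted if \<open>e \<circ> Some\<close> is an orthonormal basis of \<open>V\<close>; the additional
  vector is \<open>e None\<close>.
\<close>

definition adapted_frame ::
    "'n::finite heis set \<Rightarrow> ('n heis \<Rightarrow> 'n heis \<Rightarrow> real) \<Rightarrow> (('n + 'n) option \<Rightarrow> 'n heis) \<Rightarrow> bool" where
  "adapted_frame V g e \<longleftrightarrow>
     span (range (e \<circ> Some)) = V \<and>
     (\<forall>i j. g (e (Some i)) (e (Some j)) = (if i = j then 1 else 0)) \<and>
     inj e \<and> independent (range e) \<and> span (range e) = UNIV"

definition dual_basis ::
    "(('n::finite + 'n) option \<Rightarrow> 'n heis) \<Rightarrow> ('n + 'n) option \<Rightarrow> 'n heis \<Rightarrow> real" where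
  "dual_basis e l x = representation (range e) x (e l)"

definition structure_const ::
    "(('n::finite + 'n) option \<Rightarrow> 'n heis) \<Rightarrow>
       ('n + 'n) option \<Rightarrow> ('n + 'n) option \<Rightarrow> ('n + 'n) option \<Rightarrow> real" where
  "structure_const e i j l = dual_basis e l (heis_bracket (e i) (e j))"

definition frame_popp ::
    "(('n::finite + 'n) option \<Rightarrow> 'n heis) \<Rightarrow> (('n + 'n) option \<Rightarrow> 'n heis) \<Rightarrow> real" where
  "frame_popp e w =
     inverse (sqrt (\<Sum>i\<in>UNIV. \<Sum>j\<in>UNIV. (structure_const e (Some i) (Some j) None)\<^sup>2)) *
     det (\<chi> i j. dual_basis e i (w j))"

text \<open>
  The value at \<open>p\<close> of the left invariant form on the tangent vectors \<open>w\<close>. Up to sign it does not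
  depend on the adapted frame.
\<close>

definition popp_form ::
    "'n::finite heis set \<Rightarrow> ('n heis \<Rightarrow> 'n heis \<Rightarrow> real) \<Rightarrow>
       'n heis \<Rightarrow> (('n + 'n) option \<Rightarrow> 'n heis) \<Rightarrow> real" where
  "popp_form V g p w =
     frame_popp (SOME e. adapted_frame V g e) (\<lambda>i. inv_into UNIV (left_diff p) (w i))"

definition popp_measure ::
    "'n::finite heis set \<Rightarrow> ('n heis \<Rightarrow> 'n heis \<Rightarrow> real) \<Rightarrow> 'n heis measure" where
  "popp_measure V g = density lborel (\<lambda>p. ennreal \<bar>popp_form V g p (\<lambda>i. axis i 1)\<bar>)"


section \<open>Metric spaces\<close>

definition metric_diameter :: "'a set \<Rightarrow> ('a \<Rightarrow> 'a \<Rightarrow> real) \<Rightarrow> ereal" where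
  "metric_diameter M d = (SUP (x, y) \<in> M \<times> M. ereal (d x y))"

definition isometric_embedding ::
    "'a set \<Rightarrow> ('a \<Rightarrow> 'a \<Rightarrow> real) \<Rightarrow> 'b set \<Rightarrow> ('b \<Rightarrow> 'b \<Rightarrow> real) \<Rightarrow> ('a \<Rightarrow> 'b) \<Rightarrow> bool" where
  "isometric_embedding M d N d' f \<longleftrightarrow>
     f \<in> M \<rightarrow> N \<and> (\<forall>x\<in>M. \<forall>y\<in>M. d' (f x) (f y) = d x y)"

definition isometric_spaces ::
    "'a set \<Rightarrow> ('a \<Rightarrow> 'a \<Rightarrow> real) \<Rightarrow> 'b set \<Rightarrow> ('b \<Rightarrow> 'b \<Rightarrow> real) \<Rightarrow> bool" where
  "isometric_spaces M d N d' \<longleftrightarrow> (\<exists>f. bij_betw f M N \<and> isometric_embedding M d N d' f)"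

definition hausdorff_dist :: "('a \<Rightarrow> 'a \<Rightarrow> real) \<Rightarrow> 'a set \<Rightarrow> 'a set \<Rightarrow> ennreal" where
  "hausdorff_dist d A B =
     (INF r \<in> {r. 0 \<le> r \<and> (\<forall>a\<in>A. \<exists>b\<in>B. d a b \<le> r) \<and> (\<forall>b\<in>B. \<exists>a\<in>A. d a b \<le> r)}. ennreal r)"

text \<open>
  The infimum of the Hausdorff distances of the images over all isometric embeddings of the two
  spaces into a common metric space. Only the union of the two images matters, and it is in bijection
  with a subset of the sum type, so nothing is lost by taking the ambient spaces there.
\<close>

definition gh_dist ::
    "'a set \<Rightarrow> ('a \<Rightarrow> 'a \<Rightarrow> real) \<Rightarrow> 'b set \<Rightarrow> ('b \<Rightarrow> 'b \<Rightarrow> real) \<Rightarrow> ennreal" where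
  "gh_dist M d N d' =
     Inf {hausdorff_dist \<delta> (f ` M) (h ` N) | (Z :: ('a + 'b) set) \<delta> f h.
            Metric_space Z \<delta> \<and> isometric_embedding M d Z \<delta> f \<and> isometric_embedding N d' Z \<delta> h}"

text \<open>
  Flat tori are the quotients \<open>\<real>\<^sup>m/\<Lambda>\<close> by a lattice \<open>\<Lambda>\<close>, the integer span of a basis \<open>b\<close>. As \<open>m\<close> varies,
  \<open>\<real>\<^sup>m\<close> is the set of sequences of reals vanishing from index \<open>m\<close> on, as in
  \<^const>\<open>Euclidean_space\<close>.
\<close>

definition euclidean_basis :: "nat \<Rightarrow> (nat \<Rightarrow> nat \<Rightarrow> real) \<Rightarrow> bool" where
  "euclidean_basis m b \<longleftrightarrow>
     (\<forall>i<m. b i \<in> topspace (Euclidean_space m)) \<and>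
     (\<forall>a. (\<forall>j<m. (\<Sum>i<m. a i * b i j) = 0) \<longrightarrow> (\<forall>i<m. a i = 0))"

definition integer_span :: "nat \<Rightarrow> (nat \<Rightarrow> nat \<Rightarrow> real) \<Rightarrow> (nat \<Rightarrow> real) set" where
  "integer_span m b = range (\<lambda>(k :: nat \<Rightarrow> int) j. \<Sum>i<m. of_int (k i) * b i j)"

definition flat_torus :: "nat \<Rightarrow> (nat \<Rightarrow> nat \<Rightarrow> real) \<Rightarrow> (nat \<Rightarrow> real) set set" where
  "flat_torus m b =
     (\<lambda>x. (\<lambda>l j. x j + l j) ` integer_span m b) ` topspace (Euclidean_space m)"

definition flat_torus_dist :: "nat \<Rightarrow> (nat \<Rightarrow> real) set \<Rightarrow> (nat \<Rightarrow> real) set \<Rightarrow> real" where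
  "flat_torus_dist m = quotient_dist (\<lambda>x y. L2_set (\<lambda>j. x j - y j) {..<m})"

end

theory Submission
  imports Defs
begin

text \<open>
  In coordinates adapted to the \<open>k\<close>-th metric, \<open>H\<^sub>n\<close> projects along its centre onto Euclidean space
  \<open>E = \<real>\<^sup>2\<^sup>n\<close>; the bracket is a skew form of norm 1, and Popp's volume is Lebesgue measure. The lattice
  projects to a subgroup \<open>\<Lambda>\<close> of \<open>E\<close> with covering radius at most \<open>D\<close> and meets the centre in multiples of
  some \<open>l > 0\<close>. A nonzero \<open>x \<in> \<Lambda>\<close> fails to commute with some \<open>y \<in> \<Lambda>\<close> of length at most \<open>4D\<close>, and their
  commutator is a nonzero multiple of \<open>l\<close>; hence \<open>\<bar>x\<bar> \<ge> l / 4D\<close>, and the total volume is at least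
  \<open>c l\<^sup>2\<^sup>n\<^sup>+\<^sup>1\<close> with \<open>c\<close> depending only on \<open>n\<close> and \<open>D\<close>. So collapse forces \<open>l \<rightarrow> 0\<close>. Since a central element of height \<open>h\<close>
  has distance \<open>O(\<surd>h)\<close> from the identity, the quotients are then asymptotically isometric to \<open>E / \<Lambda>\<close>.
  Along an ultrafilter the subgroups \<open>\<Lambda>\<close> converge to a closed cocompact subgroup of \<open>E\<close>, which is the
  sum of a subspace and a lattice in the orthogonal complement. The quotient of \<open>E\<close> by it is a flat torus
  of dimension at most \<open>2n\<close>, isometric to the limit space.
\<close>

section \<open>Ultrafilters\<close>

text \<open>Every constant must be uniform in \<open>k\<close>, while the bracket form may
  degenerate along the sequence: Popp's normalisation fixes only the sum of the squares of its
  entries. This bounds the form above and leaves one entry of size at least \<open>1 / (2n)\<close>,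
  enough to move along the centre at a controlled cost. It gives no lower bound in a prescribed
  direction; so for given \<open>x\<close> only the direction of the vector representing
  \<open>\<Omega> x\<close> is used, and \<open>y\<close> is sought near a multiple of it.

  Distances are compared from two sides. Projecting does not lengthen horizontal paths; as these are
  merely absolutely continuous, this rests on the fundamental theorem of calculus for such
  functions. Conversely, an explicit polynomial path realises a prescribed displacement.

  The ultrafilter provides limits for all points of the limit space and for all distance functions
  at once, without diagonal subsequences. The diameter bound makes this possible: modulo the
  projected lattice every vector has a representative in a fixed ball.\<close>

definition ultra :: "'a filter \<Rightarrow> bool" where
  "ultra U \<longleftrightarrow> U \<noteq> bot \<and> (\<forall>P. eventually P U \<or> eventually (\<lambda>x. \<not> P x) U)"

lemma ultra_neq_bot: "ultra U \<Longrightarrow> U \<noteq> bot"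
  by (simp add: ultra_def)

lemma ultra_filtermap: "ultra U \<Longrightarrow> ultra (filtermap f U)"
  by (simp add: ultra_def eventually_filtermap filtermap_bot_iff)

text \<open>Zorn's lemma for the proper filters below \<open>F\<close>, looking for a minimal one. A
  nonempty chain is bounded by its infimum, which stays proper: since the members are comparable,
  whatever holds eventually for the infimum already does so for some member.\<close>

lemma ultra_le_exists:
  fixes F :: "'a filter"
  assumes "F \<noteq> bot"
  obtains U where "ultra U" "U \<le> F"
proof -
  define A where "A = {G. G \<noteq> bot \<and> G \<le> F}"
  define r where "r = relation_of (\<ge>) A"
  have po: "partial_order_on A r"
    unfolding r_def by (rule partial_order_on_relation_ofI) auto
  have "\<exists>m\<in>A. \<forall>a\<in>A. m \<ge> a \<longrightarrow> a = m"
  proof (rule predicate_Zorn[OF po[unfolded r_def]])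
    fix C assume C: "C \<in> Chains (relation_of (\<ge>) A)"
    then have CA: "C \<subseteq> A" and tot: "\<And>G H. G \<in> C \<Longrightarrow> H \<in> C \<Longrightarrow> G \<le> H \<or> H \<le> G"
      by (auto simp: Chains_def relation_of_def)
    show "\<exists>u\<in>A. \<forall>a\<in>C. a \<ge> u"
    proof (cases "C = {}")
      case True
      with assms show ?thesis
        by (auto simp: A_def)
    next
      case False
      have "Inf C \<noteq> bot"
      proof
        assume "Inf C = bot"
        then have "eventually (\<lambda>_. False) (Inf C)"
          by simp
        also have "eventually (\<lambda>_. False) (Inf C) \<longleftrightarrow> (\<exists>b\<in>C. eventually (\<lambda>_. False) b)"
          using False tot by (intro eventually_Inf_base) (metis inf.absorb1 inf.absorb2 order_refl)+
        finally show False
          using CA by (auto simp: A_def eventually_False)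
      qed
      moreover have "Inf C \<le> F"
        using False CA by (auto simp: A_def intro: Inf_lower2)
      ultimately show ?thesis
        by (intro bexI[of _ "Inf C"]) (auto simp: A_def intro: Inf_lower)
    qed
  qed
  from this[unfolded A_def] obtain U where U: "U \<noteq> bot" "U \<le> F" and min: "\<And>G. G \<noteq> bot \<Longrightarrow> G \<le> U \<Longrightarrow> G = U"
    by (smt (verit) mem_Collect_eq order_trans)
  \<comment> \<open>The restriction of \<open>U\<close> to \<open>P\<close> is either improper, and
    then the complement of \<open>P\<close> is eventual, or proper, and then it equals
    \<open>U\<close> by minimality.\<close>
  have "eventually P U \<or> eventually (\<lambda>x. \<not> P x) U" for P
  proof (cases "inf U (principal {x. P x}) = bot")
    case True
    then have "eventually (\<lambda>x. \<not> P x) U"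
      by (simp add: eventually_inf_principal flip: eventually_False)
    then show ?thesis ..
  next
    case False
    then have "inf U (principal {x. P x}) = U"
      by (intro min) auto
    then have "U \<le> principal {x. P x}"
      by (simp only: inf.order_iff)
    then show ?thesis
      by (simp add: le_principal)
  qed
  with U show ?thesis
    by (intro that[of U]) (auto simp: ultra_def)
qed

text \<open>Compactness gives a cluster point, and a cluster point of an ultrafilter is a limit: a
  neighbourhood that is not eventual has an eventual complement.\<close>

lemma ultra_tendsto_compact:
  fixes f :: "'b \<Rightarrow> 'a::topological_space"
  assumes U: "ultra U" and S: "compact S" and ev: "eventually (\<lambda>k. f k \<in> S) U"
  obtains l where "l \<in> S" "(f \<longlongrightarrow> l) U"
proof -
  let ?F = "filtermap f U"
  have "?F \<noteq> bot" "eventually (\<lambda>x. x \<in> S) ?F"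
    using ultra_neq_bot[OF ultra_filtermap[OF U]] ev by (auto simp: eventually_filtermap)
  with S obtain l where l: "l \<in> S" "inf (nhds l) ?F \<noteq> bot"
    unfolding compact_filter by blast
  have "(f \<longlongrightarrow> l) U"
  proof (rule topological_tendstoI, rule ccontr)
    fix T assume T: "open T" "l \<in> T" and n: "\<not> eventually (\<lambda>k. f k \<in> T) U"
    from n U have "eventually (\<lambda>x. x \<notin> T) ?F"
      by (auto simp: ultra_def eventually_filtermap)
    moreover have "eventually (\<lambda>x. x \<in> T) (nhds l)"
      using T by (rule eventually_nhds_in_open)
    ultimately have "eventually (\<lambda>x. False) (inf (nhds l) ?F)"
      unfolding eventually_inf by fastforce
    with l show False
      by (simp add: eventually_False)
  qed
  with l that show ?thesis by blast
qed

text \<open>The counterpart for a metric on a carrier set, proved by covers: if no point were a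
  limit, each would have a ball that \<open>f\<close> eventually avoids, and finitely many of these
  balls would cover \<open>M\<close>.\<close>

lemma (in Metric_space) ultra_limit_compact_space:
  assumes U: "ultra U" and S: "compact_space mtopology" and ev: "eventually (\<lambda>k. f k \<in> M) U"
  obtains l where "l \<in> M" "((\<lambda>k. d (f k) l) \<longlongrightarrow> 0) U"
proof -
  have "\<exists>l\<in>M. \<forall>e>0. eventually (\<lambda>k. f k \<in> mball l e) U"
  proof (rule ccontr)
    assume "\<not> ?thesis"
    then obtain e where e: "\<And>l. l \<in> M \<Longrightarrow> e l > 0" "\<And>l. l \<in> M \<Longrightarrow> \<not> eventually (\<lambda>k. f k \<in> mball l (e l)) U"
      by metis
    let ?C = "(\<lambda>l. mball l (e l)) ` M"
    have "\<Union>?C = M"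
      using e by auto
    moreover have "Ball ?C (openin mtopology)"
      by auto
    ultimately have "\<exists>\<F>. finite \<F> \<and> \<F> \<subseteq> ?C \<and> M \<subseteq> \<Union>\<F>"
      using S[unfolded compact_space_alt topspace_mtopology, rule_format, of ?C] by (simp only: order_refl)
    then obtain \<F> where \<F>: "finite \<F>" "\<F> \<subseteq> ?C" "M \<subseteq> \<Union>\<F>"
      by (elim exE conjE)
    from finite_subset_image[OF \<F>(1,2)] obtain K where K: "K \<subseteq> M" "finite K" "\<F> = (\<lambda>l. mball l (e l)) ` K"
      by blast
    have "eventually (\<lambda>k. f k \<notin> mball l (e l)) U" if "l \<in> K" for l
      using K(1) e(2) U that unfolding ultra_def by blast
    then have "eventually (\<lambda>k. \<forall>l\<in>K. f k \<notin> mball l (e l)) U"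
      using K(2) by (intro eventually_ball_finite) blast+
    with ev have "eventually (\<lambda>k. f k \<in> M \<and> (\<forall>l\<in>K. f k \<notin> mball l (e l))) U"
      by (rule eventually_conj)
    then have "eventually (\<lambda>k. False) U"
      by (rule eventually_mono) (use K(3) \<F>(3) in blast)
    with U show False
      by (simp add: eventually_False ultra_def)
  qed
  then obtain l where l: "l \<in> M" "\<And>e. e > 0 \<Longrightarrow> eventually (\<lambda>k. f k \<in> mball l e) U"
    by blast
  have "((\<lambda>k. d (f k) l) \<longlongrightarrow> 0) U"
  proof (rule tendstoI)
    fix e :: real assume "e > 0"
    from l(2)[OF this] show "eventually (\<lambda>k. dist (d (f k) l) 0 < e) U"
      by eventually_elim (auto simp: commute)
  qed
  with l that show ?thesis by blast
qed

section \<open>Closed subgroups of Euclidean spaces\<close>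

definition vector_subgroup :: "'a::real_vector set \<Rightarrow> bool" where
  "vector_subgroup L \<longleftrightarrow> 0 \<in> L \<and> (\<forall>x\<in>L. \<forall>y\<in>L. x - y \<in> L)"

lemma vector_subgroup_0: "vector_subgroup L \<Longrightarrow> 0 \<in> L"
  and vector_subgroup_diff: "vector_subgroup L \<Longrightarrow> x \<in> L \<Longrightarrow> y \<in> L \<Longrightarrow> x - y \<in> L"
  by (auto simp: vector_subgroup_def)

lemma vector_subgroup_neg: "vector_subgroup L \<Longrightarrow> x \<in> L \<Longrightarrow> - x \<in> L"
  using vector_subgroup_diff[of L 0 x] vector_subgroup_0[of L] by simp

lemma vector_subgroup_add: "vector_subgroup L \<Longrightarrow> x \<in> L \<Longrightarrow> y \<in> L \<Longrightarrow> x + y \<in> L"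
  using vector_subgroup_diff[of L x "- y"] vector_subgroup_neg[of L y] by simp

lemma vector_subgroup_of_int:
  assumes "vector_subgroup L" "x \<in> L"
  shows "of_int k *\<^sub>R x \<in> L"
proof (induction k rule: int_induct[where k = 0])
  case base
  then show ?case using vector_subgroup_0[OF assms(1)] by simp
next
  case (step1 i)
  then show ?case using vector_subgroup_add[OF assms(1) _ assms(2)] by (simp add: scaleR_add_left)
next
  case (step2 i)
  then show ?case using vector_subgroup_diff[OF assms(1) _ assms(2)] by (simp add: algebra_simps)
qed

lemma vector_subgroup_sum:
  assumes "vector_subgroup L" "\<And>b. b \<in> B \<Longrightarrow> f b \<in> L"
  shows "(\<Sum>b\<in>B. f b) \<in> L"
  using assms(2)
  by (induction B rule: infinite_finite_induct)
     (auto intro: vector_subgroup_0[OF assms(1)] vector_subgroup_add[OF assms(1)])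

definition int_span :: "'a::real_vector set \<Rightarrow> 'a set" where
  "int_span B = range (\<lambda>k :: 'a \<Rightarrow> int. \<Sum>b\<in>B. of_int (k b) *\<^sub>R b)"

lemma int_span_I: "(\<Sum>b\<in>B. of_int (k b) *\<^sub>R b) \<in> int_span B"
  by (auto simp: int_span_def)

lemma int_span_superset:
  assumes "finite B" "b \<in> B" shows "b \<in> int_span B"
proof -
  have "(\<Sum>c\<in>B. of_int (if c = b then 1 else 0) *\<^sub>R c) = (\<Sum>c\<in>B. if c = b then c else 0)"
    by (rule sum.cong) auto
  also have "\<dots> = b"
    using assms by simp
  finally show ?thesis
    using int_span_I[where k = "\<lambda>c. if c = b then 1 else 0" and B = B] by metis
qed

text \<open>Arbitrarily short nonzero elements would produce a line. Normalised, they accumulate at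
  some direction \<open>w\<close>, and \<open>t *\<^sub>R w\<close> is approximated by integer
  multiples of them with an error of at most their length.\<close>

lemma closed_subgroup_without_lines_gap:
  fixes L :: "'a::euclidean_space set"
  assumes L: "vector_subgroup L" "closed L"
    and no_line: "\<And>w. (\<And>t. t *\<^sub>R w \<in> L) \<Longrightarrow> w = 0"
  obtains e where "e > 0" "\<And>x. x \<in> L \<Longrightarrow> x \<noteq> 0 \<Longrightarrow> e \<le> norm x"
proof (rule ccontr)
  assume "\<not> thesis"
  then have "\<forall>n::nat. \<exists>x. x \<in> L \<and> x \<noteq> 0 \<and> norm x < inverse (real (Suc n))"
    using that by (metis not_le inverse_positive_iff_positive of_nat_0_less_iff zero_less_Suc)
  then obtain x where x: "\<And>n. x n \<in> L" "\<And>n. x n \<noteq> 0" "\<And>n::nat. norm (x n) < inverse (real (Suc n))"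
    by metis
  have x0: "(\<lambda>n. norm (x n)) \<longlonglongrightarrow> 0"
    by (rule tendsto_sandwich[OF _ _ tendsto_const LIMSEQ_inverse_real_of_nat])
       (use x(3) in \<open>auto intro!: always_eventually less_imp_le\<close>)
  define y where "y n = x n /\<^sub>R norm (x n)" for n
  have "y n \<in> sphere 0 1" for n
    using x by (simp add: y_def)
  then obtain w r where w: "w \<in> sphere 0 1" "strict_mono r" "(y \<circ> r) \<longlonglongrightarrow> w"
    using compact_sphere[of "0::'a" 1] unfolding compact_def by blast
  have "t *\<^sub>R w \<in> L" for t
  proof -
    \<comment> \<open>The largest integer multiple of \<open>norm (x (r n))\<close> not exceeding
      \<open>t\<close>.\<close>
    define c where "c n = of_int \<lfloor>t / norm (x (r n))\<rfloor> * norm (x (r n))" for n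
    have "\<bar>c n - t\<bar> \<le> norm (x (r n))" for n
    proof -
      have p: "norm (x (r n)) > 0"
        using x by simp
      have "c n \<le> t"
        using p mult_right_mono[OF of_int_floor_le[of "t / norm (x (r n))"], of "norm (x (r n))"]
        by (simp add: c_def)
      moreover have "t / norm (x (r n)) < of_int \<lfloor>t / norm (x (r n))\<rfloor> + 1"
        by linarith
      then have "t < c n + norm (x (r n))"
        using p by (simp add: c_def divide_less_eq algebra_simps)
      ultimately show ?thesis
        by linarith
    qed
    moreover have "(\<lambda>n. norm (x (r n))) \<longlonglongrightarrow> 0"
      using LIMSEQ_subseq_LIMSEQ[OF x0 w(2)] by (simp add: o_def)
    ultimately have "(\<lambda>n. c n - t) \<longlonglongrightarrow> 0"
      by (intro Lim_null_comparison[of "\<lambda>n. c n - t"]) (auto intro: always_eventually)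
    then have "c \<longlonglongrightarrow> t"
      by (rule LIM_zero_cancel)
    then have lim: "(\<lambda>n. c n *\<^sub>R (y \<circ> r) n) \<longlonglongrightarrow> t *\<^sub>R w"
      using w(3) by (rule tendsto_scaleR)
    have "c n *\<^sub>R (y \<circ> r) n = of_int \<lfloor>t / norm (x (r n))\<rfloor> *\<^sub>R x (r n)" for n
      using x(2) by (simp add: c_def y_def)
    then have "c n *\<^sub>R (y \<circ> r) n \<in> L" for n
      using vector_subgroup_of_int[OF L(1) x(1)] by simp
    from closed_sequentially[OF L(2) this lim] show ?thesis .
  qed
  from no_line[OF this] w(1) show False
    by simp
qed

text \<open>Induction on the dimension of the span: a shortest nonzero vector \<open>b\<close> is
  split off and \<open>L\<close> is projected to the orthogonal complement of \<open>b\<close>. That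
  \<open>b\<close> is shortest keeps the projected group discrete.\<close>

lemma discrete_subgroup_basis:
  fixes L :: "'a::euclidean_space set"
  assumes "vector_subgroup L" and "e > 0" and "\<And>x. x \<in> L \<Longrightarrow> x \<noteq> 0 \<Longrightarrow> e \<le> norm x"
  shows "\<exists>B. finite B \<and> independent B \<and> L = int_span B"
  using assms
proof (induction "dim L" arbitrary: L e rule: less_induct)
  case less
  note L = less.prems(1)
  show ?case
  proof (cases "L = {0}")
    case True
    then show ?thesis
      by (intro exI[of _ "{}"]) (auto simp: int_span_def independent_empty)
  next
    case False
    have "uniform_discrete L"
      unfolding uniform_discrete_def
    proof (intro exI[of _ e] conjI ballI impI)
      fix x y assume "x \<in> L" "y \<in> L" "dist x y < e"
      then show "x = y"
        using less.prems(3)[OF vector_subgroup_diff[OF L, of x y]] by (force simp: dist_norm)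
    qed (use less.prems in auto)
    then have "uniform_discrete (L - {0})"
      by (rule uniform_discrete_subset) auto
    then have "closed (L - {0})"
      by (rule uniform_discrete_imp_closed)
    moreover have "L - {0} \<noteq> {}"
      using False vector_subgroup_0[OF L] by auto
    ultimately obtain b where b': "b \<in> L - {0}" "\<forall>y \<in> L - {0}. dist 0 b \<le> dist 0 y"
      by (meson distance_attains_inf)
    then have b: "b \<in> L" "b \<noteq> 0"
      by auto
    have min: "norm b \<le> norm x" if "x \<in> L" "x \<noteq> 0" for x
      using b'(2) that by simp
    define c where "c x = (x \<bullet> b) / (b \<bullet> b)" for x
    define P where "P x = x - c x *\<^sub>R b" for x
    have linP: "linear P"
      by (rule linearI) (auto simp: P_def c_def algebra_simps add_divide_distrib)
    have Pb: "P b = 0"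
      using b by (simp add: P_def c_def)
    have orth: "P x \<bullet> b = 0" for x
      using b by (simp add: P_def c_def inner_diff_left)
    have shift: "P (x - of_int k *\<^sub>R b) = P x" for x k
      by (simp add: linear_diff[OF linP] linear_scale[OF linP] Pb)
    \<comment> \<open>Rounding the coefficient along \<open>b\<close> leaves a remainder of at most
      one half.\<close>
    have rep: "\<exists>x'\<in>L. P x' = P x \<and> \<bar>c x'\<bar> \<le> 1/2" if "x \<in> L" for x
    proof (intro bexI conjI)
      let ?x = "x - of_int (round (c x)) *\<^sub>R b"
      show "?x \<in> L"
        by (intro vector_subgroup_diff[OF L] vector_subgroup_of_int[OF L] that b)
      show "P ?x = P x"
        by (rule shift)
      have "c ?x = c x - of_int (round (c x))"
        using b by (simp add: c_def inner_diff_left diff_divide_distrib)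
      then show "\<bar>c ?x\<bar> \<le> 1/2"
        using of_int_round_abs_le[of "c x"] by linarith
    qed
    have ker: "\<exists>k::int. x = of_int k *\<^sub>R b" if "x \<in> L" "P x = 0" for x
    proof -
      let ?x = "x - of_int (round (c x)) *\<^sub>R b"
      have xL: "?x \<in> L"
        by (intro vector_subgroup_diff[OF L] vector_subgroup_of_int[OF L] that b)
      have "?x = (c x - of_int (round (c x))) *\<^sub>R b"
        using that(2) by (simp add: P_def scaleR_diff_left)
      then have "norm ?x = \<bar>c x - of_int (round (c x))\<bar> * norm b"
        by (metis norm_scaleR)
      also have "\<dots> \<le> 1/2 * norm b"
        by (intro mult_right_mono) (use of_int_round_abs_le[of "c x"] in \<open>auto simp: abs_minus_commute\<close>)
      also have "\<dots> < norm b"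
        using b by simp
      finally have "?x = 0"
        using min[OF xL] by linarith
      then show ?thesis
        by (intro exI[of _ "round (c x)"]) simp
    qed
    have PL: "vector_subgroup (P ` L)"
      unfolding vector_subgroup_def
    proof (intro conjI ballI)
      show "0 \<in> P ` L"
        using Pb b by force
      fix x y assume "x \<in> P ` L" "y \<in> P ` L"
      then show "x - y \<in> P ` L"
        by (auto simp: linear_diff[OF linP, symmetric] intro!: imageI vector_subgroup_diff[OF L])
    qed
    \<comment> \<open>The reduced representative is at least as long as \<open>b\<close>, and its
      component along \<open>b\<close> accounts for at most half of that length.\<close>
    have gap: "norm b / 2 \<le> norm y" if y: "y \<in> P ` L" "y \<noteq> 0" for y
    proof -
      from y rep obtain x where x: "x \<in> L" "P x = y" "\<bar>c x\<bar> \<le> 1/2"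
        by force
      have "x = P x + c x *\<^sub>R b"
        by (simp add: P_def)
      then have "norm x \<le> norm y + \<bar>c x\<bar> * norm b"
        using x(2) norm_triangle_ineq[of "P x" "c x *\<^sub>R b"] by simp
      also have "\<bar>c x\<bar> * norm b \<le> 1/2 * norm b"
        by (intro mult_right_mono x) auto
      finally have "norm x \<le> norm y + norm b / 2"
        by simp
      moreover have "x \<noteq> 0"
        using x y linear_0[OF linP] by auto
      ultimately show ?thesis
        using min[OF x(1)] by simp
    qed
    have "dim (P ` L) < dim L"
    proof -
      have "span (P ` L) \<subset> span L"
      proof
        have "P x \<in> span L" if "x \<in> L" for x
          unfolding P_def using that b by (intro span_diff span_scale span_base)
        then show "span (P ` L) \<subseteq> span L"
          by (intro span_minimal) auto
        have "span (P ` L) \<subseteq> {x. x \<bullet> b = 0}"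
          by (rule span_minimal) (auto simp: orth subspace_def inner_add_left)
        then have "b \<notin> span (P ` L)"
          using b by auto
        then show "span (P ` L) \<noteq> span L"
          using span_base[OF b(1)] by auto
      qed
      then show ?thesis
        by (metis dim_psubset dim_span span_span)
    qed
    from less.hyps[OF this PL _ gap] b obtain B where B: "finite B" "independent B" "P ` L = int_span B"
      by auto
    have "B \<subseteq> P ` L"
      using B int_span_superset by blast
    \<comment> \<open>\<open>C\<close> lifts the basis of the projected group to \<open>L\<close>;
      together with \<open>b\<close>, which generates the kernel of the projection, it will be a
      basis of \<open>L\<close>.\<close>
    then obtain C where C: "C \<subseteq> L" "inj_on P C" "B = P ` C"
      using subset_image_inj by metis
    have finC: "finite C"
      using B C finite_imageD by blast
    have indC: "independent C"
    proof (rule independent_if_scalars_zero[OF finC])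
      fix f x assume f: "(\<Sum>x\<in>C. f x *\<^sub>R x) = 0" and x: "x \<in> C"
      have "(\<Sum>y\<in>B. f (the_inv_into C P y) *\<^sub>R y) = (\<Sum>x\<in>C. f x *\<^sub>R P x)"
        unfolding C(3) using C(2) by (simp add: sum.reindex the_inv_into_f_f)
      also have "\<dots> = P (\<Sum>x\<in>C. f x *\<^sub>R x)"
        by (simp add: linear_sum[OF linP] linear_scale[OF linP])
      also have "\<dots> = 0"
        by (simp add: f linear_0[OF linP])
      finally have "f (the_inv_into C P (P x)) = 0"
        by (rule independentD[OF B(2,1) order_refl]) (use C(3) x in simp)
      then show "f x = 0"
        using C(2) x by (simp add: the_inv_into_f_f)
    qed
    have injC: "inj_on P (span C)"
      using linear_inj_on_span_iff_independent_image[OF linP, of C] B(2) C by simp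
    have bC: "b \<notin> span C"
      using inj_onD[OF injC, of b 0] Pb linear_0[OF linP] span_0 b by auto
    then have "b \<notin> C"
      using span_base by blast
    show ?thesis
    proof (intro exI[of _ "insert b C"] conjI)
      show "finite (insert b C)"
        using finC by simp
      show "independent (insert b C)"
        using indC bC by (rule independent_insertI[rotated])
      show "L = int_span (insert b C)"
      proof
        show "int_span (insert b C) \<subseteq> L"
          unfolding int_span_def using b C
          by (intro image_subsetI vector_subgroup_sum[OF L] vector_subgroup_of_int[OF L]) auto
        show "L \<subseteq> int_span (insert b C)"
        proof
          fix x assume x: "x \<in> L"
          then have "P x \<in> int_span B"
            using B by blast
          then obtain k :: "'a \<Rightarrow> int" where "P x = (\<Sum>a\<in>B. of_int (k a) *\<^sub>R a)"
            unfolding int_span_def by blast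
          also have "\<dots> = (\<Sum>a\<in>C. of_int (k (P a)) *\<^sub>R P a)"
            unfolding C(3) using C(2) by (simp add: sum.reindex)
          also have "\<dots> = P (\<Sum>a\<in>C. of_int (k (P a)) *\<^sub>R a)"
            by (simp add: linear_sum[OF linP] linear_scale[OF linP])
          finally have "P (x - (\<Sum>a\<in>C. of_int (k (P a)) *\<^sub>R a)) = 0"
            by (simp add: linear_diff[OF linP])
          moreover have "x - (\<Sum>a\<in>C. of_int (k (P a)) *\<^sub>R a) \<in> L"
            using x C by (intro vector_subgroup_diff[OF L] vector_subgroup_sum[OF L] vector_subgroup_of_int[OF L]) auto
          ultimately obtain j :: int where j: "x - (\<Sum>a\<in>C. of_int (k (P a)) *\<^sub>R a) = of_int j *\<^sub>R b"
            using ker by blast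
          define k' where "k' a = (if a = b then j else k (P a))" for a
          have "(\<Sum>a\<in>insert b C. of_int (k' a) *\<^sub>R a) = of_int j *\<^sub>R b + (\<Sum>a\<in>C. of_int (k' a) *\<^sub>R a)"
            using finC \<open>b \<notin> C\<close> by (simp add: k'_def)
          also have "(\<Sum>a\<in>C. of_int (k' a) *\<^sub>R a) = (\<Sum>a\<in>C. of_int (k (P a)) *\<^sub>R a)"
            using \<open>b \<notin> C\<close> by (intro sum.cong) (auto simp: k'_def)
          finally have "(\<Sum>a\<in>insert b C. of_int (k' a) *\<^sub>R a) = x"
            using j by (simp add: algebra_simps)
          then show "x \<in> int_span (insert b C)"
            using int_span_I by metis
        qed
      qed
    qed
  qed
qed

text \<open>\<open>W\<close> is the largest subspace inside \<open>L\<close>. The part of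
  \<open>L\<close> orthogonal to \<open>W\<close> contains no line and is therefore discrete.
  Elements of \<open>L\<close> split because the component in \<open>W\<close> already belongs to
  \<open>L\<close>.\<close>

lemma closed_subgroup_structure:
  fixes L :: "'a::euclidean_space set"
  assumes L: "vector_subgroup L" "closed L"
  obtains W B where "subspace W" "finite B" "independent B" "\<And>w b. w \<in> W \<Longrightarrow> b \<in> B \<Longrightarrow> w \<bullet> b = 0"
    "L = {w + z | w z. w \<in> W \<and> z \<in> int_span B}"
proof -
  define W where "W = {w. \<forall>t. t *\<^sub>R w \<in> L}"
  have W: "subspace W"
    unfolding subspace_def W_def
    by (auto simp: scaleR_add_right vector_subgroup_0[OF L(1)] intro: vector_subgroup_add[OF L(1)])
  have WL: "W \<subseteq> L"
    unfolding W_def using scaleR_one by (metis (mono_tags, lifting) mem_Collect_eq subsetI)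
  define K where "K = {x\<in>L. \<forall>w\<in>W. w \<bullet> x = 0}"
  have K: "vector_subgroup K"
    using L(1) unfolding vector_subgroup_def K_def by (auto simp: inner_diff_right)
  have "K = L \<inter> (\<Inter>w\<in>W. {x. w \<bullet> x = 0})"
    by (auto simp: K_def)
  then have "closed K"
    using L(2) by (auto intro!: closed_INT closed_hyperplane)
  obtain e where e: "e > 0" "\<And>x. x \<in> K \<Longrightarrow> x \<noteq> 0 \<Longrightarrow> e \<le> norm x"
  proof (rule closed_subgroup_without_lines_gap[OF K \<open>closed K\<close>, rotated])
    fix w assume w: "\<And>t. t *\<^sub>R w \<in> K"
    then have "w \<in> W"
      by (auto simp: K_def W_def)
    moreover have "w \<in> K"
      using w[of 1] by simp
    ultimately have "w \<bullet> w = 0"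
      unfolding K_def by blast
    then show "w = 0"
      by simp
  qed (rule that)
  then obtain B where B: "finite B" "independent B" "K = int_span B"
    using discrete_subgroup_basis[OF K] by blast
  have "B \<subseteq> K"
    using B int_span_superset by blast
  show ?thesis
  proof (rule that[OF W B(1,2)])
    show "w \<bullet> b = 0" if "w \<in> W" "b \<in> B" for w b
      using that \<open>B \<subseteq> K\<close> by (auto simp: K_def)
    show "L = {w + z | w z. w \<in> W \<and> z \<in> int_span B}"
    proof safe
      fix x assume x: "x \<in> L"
      obtain y z where yz: "y \<in> span W" "\<And>w. w \<in> span W \<Longrightarrow> orthogonal z w" "x = y + z"
        using orthogonal_subspace_decomp_exists by blast
      have "span W = W"
        using W by simp
      then have "z \<in> K"
        using yz(2) WL yz(1) yz(3) vector_subgroup_diff[OF L(1) x, of y]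
        unfolding K_def \<open>span W = W\<close> by (auto simp: orthogonal_def inner_commute[of z])
      then show "\<exists>w z. x = w + z \<and> w \<in> W \<and> z \<in> int_span B"
        using yz B \<open>span W = W\<close> by auto
    next
      fix w z assume "w \<in> W" "z \<in> int_span B"
      then show "w + z \<in> L"
        using WL B(3) vector_subgroup_add[OF L(1), of w z] unfolding K_def by blast
    qed
  qed
qed

section \<open>Limits of flat tori\<close>

lemma infdist_greatest:
  assumes "A \<noteq> {}" "\<And>a. a \<in> A \<Longrightarrow> c \<le> dist x a"
  shows "c \<le> infdist x A"
  using assms by (simp add: infdist_notempty cINF_greatest)

lemma infdist_lessD:
  assumes "A \<noteq> {}" "infdist x A < e"
  obtains a where "a \<in> A" "dist x a < e"
  using infdist_greatest[OF assms(1), of e x] assms(2) by (meson not_le)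

lemma infdist_subgroup_shift:
  fixes L :: "'a::real_normed_vector set"
  assumes L: "vector_subgroup L" "l \<in> L"
  shows "infdist (x + l) L = infdist x L"
proof -
  have le: "infdist (x + l) L \<le> infdist x L" if "l \<in> L" for x l
  proof (rule infdist_greatest)
    fix a assume "a \<in> L"
    then have "infdist (x + l) L \<le> dist (x + l) (a + l)"
      by (intro infdist_le vector_subgroup_add[OF L(1)] that)
    then show "infdist (x + l) L \<le> dist x a"
      by (simp add: dist_norm)
  qed (use L in auto)
  show ?thesis
    using le[OF L(2), of x] le[OF vector_subgroup_neg[OF L], of "x + l"] by simp
qed

lemma infdist_subgroup_neg:
  fixes L :: "'a::real_normed_vector set"
  assumes L: "vector_subgroup L"
  shows "infdist (- x) L = infdist x L"
proof -
  have le: "infdist (- x) L \<le> infdist x L" for x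
  proof (rule infdist_greatest)
    fix a assume "a \<in> L"
    then have "infdist (- x) L \<le> dist (- x) (- a)"
      by (intro infdist_le vector_subgroup_neg[OF L])
    then show "infdist (- x) L \<le> dist x a"
      by (simp add: dist_norm norm_minus_commute)
  qed (use vector_subgroup_0[OF L] in auto)
  show ?thesis
    using le[of x] le[of "- x"] by simp
qed

lemma infdist_subgroup_diff_le:
  fixes L :: "'a::real_normed_vector set"
  assumes L: "vector_subgroup L"
  shows "infdist (x - y) L \<le> infdist x L + infdist y L"
proof (rule ccontr)
  have ne: "L \<noteq> {}"
    using vector_subgroup_0[OF L] by auto
  assume "\<not> ?thesis"
  then have "infdist y L < infdist (x - y) L - infdist x L"
    by simp
  with ne obtain b where b: "b \<in> L" "dist y b < infdist (x - y) L - infdist x L"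
    by (rule infdist_lessD)
  then have "infdist x L < infdist (x - y) L - dist y b"
    by simp
  with ne obtain a where a: "a \<in> L" "dist x a < infdist (x - y) L - dist y b"
    by (rule infdist_lessD)
  have "infdist (x - y) L \<le> dist (x - y) (a - b)"
    using a b by (intro infdist_le vector_subgroup_diff[OF L])
  also have "\<dots> \<le> dist x a + dist y b"
    using norm_triangle_ineq4[of "x - a" "y - b"] by (simp add: dist_norm algebra_simps)
  finally show False
    using a by simp
qed

text \<open>The distances lie in the compact interval from 0 to \<open>D\<close> and so converge
  pointwise to some \<open>\<nu>\<close>, whose zero set is \<open>M\<close>. The point is that
  \<open>\<nu>\<close> is the distance to \<open>M\<close>: near-minimisers in \<open>L k\<close>
  stay in a ball around \<open>x\<close>, and their limit is a zero of \<open>\<nu>\<close> no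
  farther from \<open>x\<close> than \<open>\<nu> x\<close>.\<close>

lemma ultralimit_of_subgroups:
  fixes L :: "nat \<Rightarrow> 'a::euclidean_space set"
  assumes U: "ultra U" "U \<le> sequentially"
    and L: "\<And>k. vector_subgroup (L k)" and D: "\<And>k x. infdist x (L k) \<le> D"
  obtains M where "closed M" "vector_subgroup M" "\<And>x. infdist x M \<le> D"
    "\<And>x. ((\<lambda>k. infdist x (L k)) \<longlongrightarrow> infdist x M) U"
proof -
  note nb = ultra_neq_bot[OF U(1)]
  have "\<exists>l. ((\<lambda>k. infdist x (L k)) \<longlongrightarrow> l) U" for x
    by (rule ultra_tendsto_compact[OF U(1) compact_Icc, of "\<lambda>k. infdist x (L k)" 0 D])
       (auto simp: infdist_nonneg D)
  then obtain \<nu> where \<nu>: "((\<lambda>k. infdist x (L k)) \<longlongrightarrow> \<nu> x) U" for x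
    by metis
  have ne: "L k \<noteq> {}" for k
    using vector_subgroup_0[OF L] by auto
  have \<nu>0: "\<nu> 0 = 0"
    using \<nu>[of 0] vector_subgroup_0[OF L] nb by (simp add: tendsto_const_iff)
  have \<nu>_nonneg: "0 \<le> \<nu> x" for x
    by (rule tendsto_lowerbound[OF \<nu> _ nb]) (simp add: infdist_nonneg)
  have \<nu>_D: "\<nu> x \<le> D" for x
    by (rule tendsto_upperbound[OF \<nu> _ nb]) (simp add: D)
  have \<nu>_lip: "\<nu> x \<le> \<nu> y + dist x y" for x y
    by (rule tendsto_le[OF nb tendsto_add[OF \<nu> tendsto_const] \<nu>]) (simp add: infdist_triangle)
  have \<nu>_diff: "\<nu> (x - y) \<le> \<nu> x + \<nu> y" for x y
    by (rule tendsto_le[OF nb tendsto_add[OF \<nu> \<nu>] \<nu>]) (simp add: infdist_subgroup_diff_le[OF L])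
  define M where "M = {x. \<nu> x = 0}"
  have M: "vector_subgroup M"
    unfolding vector_subgroup_def M_def using \<nu>0 \<nu>_diff \<nu>_nonneg
    by (auto intro!: antisym) (metis add_0)
  have "continuous_on UNIV \<nu>"
  proof (rule continuous_onI)
    fix x e assume "(e::real) > 0"
    moreover have "dist (\<nu> y) (\<nu> x) \<le> dist y x" for y
      using \<nu>_lip[of x y] \<nu>_lip[of y x] by (simp add: dist_real_def dist_commute abs_le_iff)
    ultimately show "\<exists>d>0. \<forall>y\<in>UNIV. dist y x < d \<longrightarrow> dist (\<nu> y) (\<nu> x) \<le> e"
      by (meson less_imp_le order_trans)
  qed
  then have "closed M"
    unfolding M_def by (intro closed_Collect_eq continuous_intros)
  have eq: "infdist x M = \<nu> x" for x
  proof (rule antisym)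
    show "\<nu> x \<le> infdist x M"
    proof (rule infdist_greatest)
      show "M \<noteq> {}"
        using vector_subgroup_0[OF M] by auto
      fix a assume "a \<in> M"
      then show "\<nu> x \<le> dist x a"
        using \<nu>_lip[of x a] by (simp add: M_def)
    qed
    have "\<exists>a. a \<in> L k \<and> dist x a < infdist x (L k) + inverse (real (Suc k))" for k
      using infdist_lessD[OF ne, of x k "infdist x (L k) + inverse (real (Suc k))"]
      by (metis less_add_same_cancel1 inverse_positive_iff_positive of_nat_0_less_iff zero_less_Suc)
    then obtain a where a: "\<And>k. a k \<in> L k" "\<And>k. dist x (a k) < infdist x (L k) + inverse (real (Suc k))"
      by metis
    have "a k \<in> cball x (D + 1)" for k
    proof -
      have "inverse (real (Suc k)) \<le> 1"
        by (simp add: field_simps)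
      then show ?thesis
        using a(2)[of k] D[of x k] by simp
    qed
    then obtain l where l: "(a \<longlongrightarrow> l) U"
      using ultra_tendsto_compact[OF U(1) compact_cball] by (metis (no_types, lifting) always_eventually)
    have "((\<lambda>k. dist l (a k)) \<longlongrightarrow> dist l l) U"
      by (intro tendsto_intros l)
    then have "\<nu> l \<le> dist l l"
      by (rule tendsto_le[OF nb _ \<nu>]) (simp add: a infdist_le)
    then have "l \<in> M"
      using \<nu>_nonneg[of l] by (simp add: M_def)
    have "((\<lambda>k. inverse (real (Suc k))) \<longlongrightarrow> 0) U"
      by (rule tendsto_mono[OF U(2) LIMSEQ_inverse_real_of_nat])
    then have "((\<lambda>k. infdist x (L k) + inverse (real (Suc k))) \<longlongrightarrow> \<nu> x + 0) U"
      by (intro tendsto_add \<nu>)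
    moreover have "((\<lambda>k. dist x (a k)) \<longlongrightarrow> dist x l) U"
      by (intro tendsto_intros l)
    ultimately have "dist x l \<le> \<nu> x + 0"
      by (rule tendsto_le[OF nb]) (use a(2) in \<open>auto intro!: always_eventually less_imp_le\<close>)
    then show "infdist x M \<le> \<nu> x"
      using infdist_le[OF \<open>l \<in> M\<close>, of x] by simp
  qed
  show ?thesis
    by (rule that[OF \<open>closed M\<close> M]) (simp_all add: eq \<nu> \<nu>_D)
qed

section \<open>Quotients by closed cocompact subgroups as flat tori\<close>

lemma orthonormal_expansion:
  fixes S :: "'a::euclidean_space set"
  assumes "subspace S"
  obtains u :: "nat \<Rightarrow> 'a" where "\<And>j. j < dim S \<Longrightarrow> u j \<in> S"
    "\<And>i j. i < dim S \<Longrightarrow> j < dim S \<Longrightarrow> u i \<bullet> u j = (if i = j then 1 else 0)"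
    "\<And>z. z \<in> S \<Longrightarrow> z = (\<Sum>j<dim S. (z \<bullet> u j) *\<^sub>R u j)"
proof -
  obtain C where C: "C \<subseteq> S" "pairwise orthogonal C" "\<And>x. x \<in> C \<Longrightarrow> norm x = 1" "independent C"
      "card C = dim S" "span C = S"
    using orthonormal_basis_subspace[OF assms] by metis
  have "finite C"
    using C(4) independent_imp_finite by blast
  then obtain u where u: "bij_betw u {..<dim S} C"
    using bij_betw_from_nat_into_finite C(5) by metis
  have uC: "u j \<in> C" if "j < dim S" for j
    using u that by (auto simp: bij_betw_def)
  have on: "u i \<bullet> u j = (if i = j then 1 else 0)" if "i < dim S" "j < dim S" for i j
  proof (cases "i = j")
    case True
    then show ?thesis
      using C(3)[OF uC[OF that(1)]] by (simp add: dot_square_norm)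
  next
    case False
    then have "u i \<noteq> u j"
      using u that by (auto simp: bij_betw_def inj_on_def)
    then show ?thesis
      using C(2) uC that False by (auto simp: pairwise_def orthogonal_def)
  qed
  show ?thesis
  proof (rule that)
    show "u j \<in> S" if "j < dim S" for j
      using C(1) uC[OF that] by blast
    show "u i \<bullet> u j = (if i = j then 1 else 0)" if "i < dim S" "j < dim S" for i j
      using on that by simp
    fix z assume z: "z \<in> S"
    define y where "y = z - (\<Sum>j<dim S. (z \<bullet> u j) *\<^sub>R u j)"
    have "y \<in> S"
      unfolding y_def using z C(1) uC
      by (intro subspace_diff[OF assms] subspace_sum[OF assms] subspace_scale[OF assms]) auto
    have "y \<bullet> u i = 0" if i: "i < dim S" for i
    proof -
      have "(\<Sum>j<dim S. (z \<bullet> u j) * (u j \<bullet> u i)) = (\<Sum>j<dim S. if j = i then z \<bullet> u i else 0)"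
        using on i by (intro sum.cong) auto
      also have "\<dots> = z \<bullet> u i"
        using i by simp
      finally show ?thesis
        by (simp add: y_def inner_diff_left inner_sum_left)
    qed
    then have "C \<subseteq> {x. y \<bullet> x = 0}"
      using u by (auto simp: bij_betw_def)
    then have "span C \<subseteq> {x. y \<bullet> x = 0}"
      by (rule span_minimal) (auto simp: subspace_def inner_add_right)
    then have "y \<bullet> y = 0"
      using \<open>y \<in> S\<close> C(6) by blast
    then show "z = (\<Sum>j<dim S. (z \<bullet> u j) *\<^sub>R u j)"
      by (simp add: y_def)
  qed
qed

text \<open>A nonzero vector orthogonal to \<open>W\<close> and \<open>B\<close> could be rescaled
  to length \<open>D + 1\<close>, and its distance to \<open>L\<close> would then be at least
  \<open>D + 1\<close>.\<close>

lemma cocompact_subgroup_span: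
  fixes W B :: "'a::euclidean_space set"
  assumes W: "subspace W" and orth: "\<And>w b. w \<in> W \<Longrightarrow> b \<in> B \<Longrightarrow> w \<bullet> b = 0"
    and L: "L = {w + z | w z. w \<in> W \<and> z \<in> int_span B}" and D: "\<And>x. infdist x L \<le> D"
  shows "\<exists>w\<in>W. x - w \<in> span B"
proof -
  have BS: "int_span B \<subseteq> span B"
    unfolding int_span_def by (auto intro!: span_sum intro: span_scale span_base)
  obtain y z where yz: "y \<in> span (W \<union> B)" "\<And>w. w \<in> span (W \<union> B) \<Longrightarrow> orthogonal z w" "x = y + z"
    using orthogonal_subspace_decomp_exists by blast
  have "z = 0"
  proof (rule ccontr)
    assume "z \<noteq> 0"
    define v where "v = ((D + 1) / norm z) *\<^sub>R z"
    have D0: "D \<ge> 0"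
      using D[of 0] infdist_nonneg[of 0 L] by linarith
    then have v: "norm v = D + 1"
      using \<open>z \<noteq> 0\<close> by (simp add: v_def)
    have "D + 1 \<le> infdist v L"
    proof (rule infdist_greatest)
      show "L \<noteq> {}"
        using subspace_0[OF W] unfolding L int_span_def by blast
      fix l assume "l \<in> L"
      then have "l \<in> span (W \<union> B)"
        unfolding L using BS span_mono[of B "W \<union> B"] span_mono[of W "W \<union> B"] span_superset[of W]
        by (auto intro!: span_add)
      then have "v \<bullet> l = 0"
        using yz(2) by (simp add: v_def orthogonal_def)
      then have "norm (v - l) ^ 2 = norm v ^ 2 + norm l ^ 2"
        by (simp add: power2_norm_eq_inner inner_diff_left inner_diff_right inner_commute)
      then have "norm v ^ 2 \<le> norm (v - l) ^ 2"
        by simp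
      then show "D + 1 \<le> dist v l"
        using v by (simp add: dist_norm power2_le_iff_abs_le)
    qed
    with D[of v] show False
      by simp
  qed
  then have "x \<in> span (W \<union> B)"
    using yz by simp
  then obtain w s where "w \<in> span W" "s \<in> span B" "x = w + s"
    unfolding span_Un by blast
  then show ?thesis
    using W[THEN span_eq_iff[THEN iffD2]] by (intro bexI[of _ w]) auto
qed

text \<open>\<open>T\<close> is the orthogonal projection onto \<open>span B\<close> in orthonormal
  coordinates. By cocompactness \<open>W\<close> is the whole orthogonal complement, so
  \<open>T\<close> loses nothing but directions along which \<open>L\<close> already contains every
  vector. It carries \<open>L\<close> onto the lattice spanned by the images of
  \<open>B\<close>.\<close>

lemma closed_cocompact_quotient_is_torus:
  fixes L :: "'a::euclidean_space set"
  assumes L: "vector_subgroup L" "closed L" and D: "\<And>x. infdist x L \<le> D"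
  obtains m b and T :: "'a \<Rightarrow> nat \<Rightarrow> real" where
    "m \<le> DIM('a)" "euclidean_basis m b" "range T = topspace (Euclidean_space m)"
    "\<And>x y. flat_torus_dist m ((\<lambda>l j. T x j + l j) ` integer_span m b) ((\<lambda>l j. T y j + l j) ` integer_span m b)
        = infdist (x - y) L"
    "\<And>x y. x - y \<in> L \<Longrightarrow>
       (\<lambda>l j. T x j + l j) ` integer_span m b = (\<lambda>l j. T y j + l j) ` integer_span m b"
proof -
  obtain W B where WB: "subspace W" "finite B" "independent B" "\<And>w b. w \<in> W \<Longrightarrow> b \<in> B \<Longrightarrow> w \<bullet> b = 0"
    and Leq: "L = {w + z | w z. w \<in> W \<and> z \<in> int_span B}"
    by (rule closed_subgroup_structure[OF L], rule that)
  define S where "S = span B"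
  define m where "m = dim S"
  have S: "subspace S"
    by (simp add: S_def)
  obtain u :: "nat \<Rightarrow> 'a" where uS: "\<And>j. j < m \<Longrightarrow> u j \<in> S"
    and on: "\<And>i j. i < m \<Longrightarrow> j < m \<Longrightarrow> u i \<bullet> u j = (if i = j then 1 else 0)"
    and ex: "\<And>z. z \<in> S \<Longrightarrow> z = (\<Sum>j<m. (z \<bullet> u j) *\<^sub>R u j)"
    by (rule orthonormal_expansion[OF S, folded m_def], rule that)
  have WS: "w \<bullet> s = 0" if "w \<in> W" "s \<in> S" for w s
  proof -
    have "S \<subseteq> {x. w \<bullet> x = 0}"
      unfolding S_def using WB(4) that(1)
      by (intro span_minimal) (auto simp: subspace_def inner_add_right)
    then show ?thesis
      using that by auto
  qed
  have dec: "\<exists>w\<in>W. x - w \<in> S" for x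
    unfolding S_def by (rule cocompact_subgroup_span[OF WB(1) WB(4) Leq D])
  define T where "T x j = (if j < m then x \<bullet> u j else 0)" for x j
  define N where "N y = L2_set y {..<m}" for y :: "nat \<Rightarrow> real"
  have T_add: "T (x + y) j = T x j + T y j" and T_diff: "T (x - y) j = T x j - T y j" for x y j
    by (simp_all add: T_def inner_add_left inner_diff_left)
  have T_W: "T w j = 0" if "w \<in> W" for w j
    using WS[OF that uS] by (simp add: T_def)
  have N_S: "N (T s) = norm s" if "s \<in> S" for s
  proof -
    have "norm s ^ 2 = s \<bullet> (\<Sum>j<m. (s \<bullet> u j) *\<^sub>R u j)"
      using ex[OF that] by (simp add: power2_norm_eq_inner)
    also have "\<dots> = (\<Sum>j<m. (T s j)\<^sup>2)"
      by (simp add: inner_sum_right T_def power2_eq_square)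
    finally have "sqrt (norm s ^ 2) = N (T s)"
      by (simp add: N_def L2_set_def)
    then show ?thesis
      by simp
  qed
  have N_le: "N (T x) \<le> norm x" for x
  proof -
    obtain w where w: "w \<in> W" "x - w \<in> S"
      using dec by blast
    have "norm x ^ 2 = norm w ^ 2 + norm (x - w) ^ 2"
      using WS[OF w] by (simp add: power2_norm_eq_inner inner_diff_left inner_diff_right inner_commute)
    then have "norm (x - w) \<le> norm x"
      by (simp add: power2_le_imp_le)
    moreover have "T x = T (x - w)"
      using T_W[OF w(1)] by (auto simp: T_diff)
    ultimately show ?thesis
      using N_S[OF w(2)] by simp
  qed
  have card_B: "card B = m"
    unfolding m_def S_def by (rule dim_span_eq_card_independent[OF WB(3), symmetric])
  then obtain e where e: "bij_betw e {..<m} B"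
    using bij_betw_from_nat_into_finite[OF WB(2)] by metis
  define b where "b i = T (e i)" for i
  have T_sum: "T (\<Sum>i<m. a i *\<^sub>R e i) j = (\<Sum>i<m. a i * b i j)" for a j
    by (simp add: T_def b_def inner_sum_left)
  have T_int: "T (\<Sum>c\<in>B. of_int (k c) *\<^sub>R c) j = (\<Sum>i<m. of_int (k (e i)) * b i j)" for k :: "'a \<Rightarrow> int" and j
    unfolding sum.reindex_bij_betw[OF e, of "\<lambda>c. of_int (k c) *\<^sub>R c", symmetric] by (rule T_sum)
  have TL: "T ` L = integer_span m b"
  proof safe
    fix l assume "l \<in> L"
    then obtain w and k :: "'a \<Rightarrow> int" where l: "w \<in> W" "l = w + (\<Sum>c\<in>B. of_int (k c) *\<^sub>R c)"
      unfolding Leq int_span_def by blast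
    have "T l = (\<lambda>j. \<Sum>i<m. of_int ((k \<circ> e) i) * b i j)"
      using l T_W by (simp add: T_add T_int fun_eq_iff)
    then show "T l \<in> integer_span m b"
      unfolding integer_span_def by blast
  next
    fix y assume "y \<in> integer_span m b"
    then obtain k :: "nat \<Rightarrow> int" where y: "y = (\<lambda>j. \<Sum>i<m. of_int (k i) * b i j)"
      unfolding integer_span_def by blast
    let ?z = "\<Sum>c\<in>B. of_int (k (the_inv_into {..<m} e c)) *\<^sub>R c"
    have "T ?z = y"
      using e by (simp add: T_int y fun_eq_iff bij_betw_def the_inv_into_f_f)
    moreover have "0 + ?z \<in> L"
      unfolding Leq using subspace_0[OF WB(1)] int_span_I[of "\<lambda>c. k (the_inv_into {..<m} e c)" B] by blast
    ultimately show "y \<in> T ` L"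
      by force
  qed
  have WL: "w + l \<in> L" if "w \<in> W" "l \<in> L" for w l
  proof -
    from that(2) obtain w' z where "l = w' + z" "w' \<in> W" "z \<in> int_span B"
      unfolding Leq by blast
    then show ?thesis
      unfolding Leq using subspace_add[OF WB(1) that(1)] by (auto simp flip: add.assoc)
  qed
  show ?thesis
  proof (rule that)
    show "m \<le> DIM('a)"
      unfolding m_def by (rule dim_subset_UNIV)
    show "euclidean_basis m b"
      unfolding euclidean_basis_def
    proof (intro conjI allI impI)
      fix i assume "i < m"
      then show "b i \<in> topspace (Euclidean_space m)"
        by (simp add: topspace_Euclidean_space b_def T_def)
    next
      fix a :: "nat \<Rightarrow> real" and i
      assume a: "\<forall>j<m. (\<Sum>i<m. a i * b i j) = 0" and i: "i < m"
      let ?z = "\<Sum>i<m. a i *\<^sub>R e i"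
      have z: "?z = (\<Sum>c\<in>B. a (the_inv_into {..<m} e c) *\<^sub>R c)"
        using e by (subst sum.reindex_bij_betw[OF e, symmetric]) (auto simp: bij_betw_def the_inv_into_f_f intro!: sum.cong)
      have "?z \<in> S"
        unfolding z S_def by (auto intro!: span_sum intro: span_scale span_base)
      moreover have "?z \<bullet> u j = 0" if "j < m" for j
        using a T_sum[of a j] that by (simp add: T_def)
      ultimately have "?z = 0"
        using ex[of ?z] by simp
      then have "a (the_inv_into {..<m} e (e i)) = 0"
        using e i unfolding z by (intro independentD[OF WB(3,2) order_refl]) (auto simp: bij_betw_def)
      then show "a i = 0"
        using e i by (simp add: bij_betw_def the_inv_into_f_f)
    qed
    show "range T = topspace (Euclidean_space m)"
    proof safe
      fix x show "T x \<in> topspace (Euclidean_space m)"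
        by (simp add: topspace_Euclidean_space T_def)
    next
      fix y assume "y \<in> topspace (Euclidean_space m)"
      then have y: "y j = 0" if "j \<ge> m" for j
        using that by (simp add: topspace_Euclidean_space)
      have "T (\<Sum>i<m. y i *\<^sub>R u i) j = y j" for j
      proof (cases "j < m")
        case True
        have "T (\<Sum>i<m. y i *\<^sub>R u i) j = (\<Sum>i<m. y i * (u i \<bullet> u j))"
          using True by (simp add: T_def inner_sum_left)
        also have "\<dots> = (\<Sum>i<m. if i = j then y j else 0)"
          using on True by (intro sum.cong) auto
        finally show ?thesis
          using True by simp
      qed (use y in \<open>simp add: T_def\<close>)
      then have "T (\<Sum>i<m. y i *\<^sub>R u i) = y" ..
      from this[symmetric] show "y \<in> range T"
        by (rule range_eqI)
    qed
    show "(\<lambda>l j. T x j + l j) ` integer_span m b = (\<lambda>l j. T y j + l j) ` integer_span m b"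
      if "x - y \<in> L" for x y
    proof -
      have sub: "(\<lambda>l j. T x j + l j) ` integer_span m b \<subseteq> (\<lambda>l j. T y j + l j) ` integer_span m b"
        if "x - y \<in> L" for x y
      proof safe
        fix l assume "l \<in> integer_span m b"
        then obtain z where z: "z \<in> L" "l = T z"
          unfolding TL[symmetric] by blast
        have "T ((x - y) + z) \<in> integer_span m b"
          unfolding TL[symmetric] by (intro imageI vector_subgroup_add[OF L(1)] that z)
        moreover have "(\<lambda>j. T x j + l j) = (\<lambda>j. T y j + T ((x - y) + z) j)"
          by (simp add: z T_add T_diff fun_eq_iff)
        ultimately show "(\<lambda>j. T x j + l j) \<in> (\<lambda>l j. T y j + l j) ` integer_span m b"
          by blast
      qed
      have "y - x \<in> L"
        using vector_subgroup_neg[OF L(1) that] by simp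
      then show ?thesis
        using sub[OF that] sub by blast
    qed
    show "flat_torus_dist m ((\<lambda>l j. T x j + l j) ` integer_span m b) ((\<lambda>l j. T y j + l j) ` integer_span m b)
        = infdist (x - y) L" for x y
    proof -
      define A where "A x = (\<lambda>l j. T x j + l j) ` integer_span m b" for x
      have A: "A x = (\<lambda>l. T (x + l)) ` L" for x
        unfolding A_def TL[symmetric] image_image T_add[symmetric] ..
      define q where "q = (\<lambda>(y, z). L2_set (\<lambda>j. y j - z j) {..<m} :: real)"
      have qT: "q (T v, T w) = N (T (v - w))" for v w
      proof -
        have "T (v - w) = (\<lambda>j. T v j - T w j)"
          by (simp add: fun_eq_iff T_diff)
        then show ?thesis
          by (simp add: q_def N_def)
      qed
      have ftd: "flat_torus_dist m (A x) (A y) = (INF p\<in>A x \<times> A y. q p)"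
        by (simp add: flat_torus_dist_def quotient_dist_def q_def case_prod_unfold)
      have L0: "0 \<in> L"
        by (rule vector_subgroup_0[OF L(1)])
      \<comment> \<open>Shifting by the component in \<open>W\<close> stays within the coset and
        does not change \<open>T\<close>; what remains lies in \<open>S\<close>, where
        \<open>T\<close> preserves the norm.\<close>
      have "infdist (x - y) L \<le> (INF p\<in>A x \<times> A y. q p)"
      proof (rule cINF_greatest)
        show "A x \<times> A y \<noteq> {}"
          using L0 by (auto simp: A)
        fix p assume "p \<in> A x \<times> A y"
        then obtain l l' where l: "l \<in> L" "l' \<in> L" "p = (T (x + l), T (y + l'))"
          unfolding A by blast
        let ?v = "x + l - (y + l')"
        obtain w where w: "w \<in> W" "?v - w \<in> S"
          using dec by blast
        have "infdist (x - y) L \<le> dist (x - y) (w + (l' - l))"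
          by (intro infdist_le WL w vector_subgroup_diff[OF L(1)] l)
        also have "x - y - (w + (l' - l)) = ?v - w"
          by simp
        then have "dist (x - y) (w + (l' - l)) = N (T (?v - w))"
          by (simp only: N_S[OF w(2)] dist_norm)
        also have "T (?v - w) = T ?v"
          using T_W[OF w(1)] by (auto simp: T_diff)
        also have "N (T ?v) = q p"
          unfolding l(3) qT ..
        finally show "infdist (x - y) L \<le> q p" .
      qed
      moreover have "(INF p\<in>A x \<times> A y. q p) \<le> infdist (x - y) L"
      proof (rule infdist_greatest)
        show "L \<noteq> {}"
          using L0 by auto
        fix l assume l: "l \<in> L"
        have "(INF p\<in>A x \<times> A y. q p) \<le> q (T (x + 0), T (y + l))"
        proof (rule cINF_lower)
          show "bdd_below (q ` (A x \<times> A y))"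
            by (rule bdd_belowI[of _ 0]) (auto simp: q_def)
          show "(T (x + 0), T (y + l)) \<in> A x \<times> A y"
            unfolding A using l L0 by blast
        qed
        also have "\<dots> = N (T (x - y - l))"
          unfolding qT by (simp add: algebra_simps)
        also have "\<dots> \<le> dist (x - y) l"
          using N_le by (simp add: dist_norm)
        finally show "(INF p\<in>A x \<times> A y. q p) \<le> dist (x - y) l" .
      qed
      ultimately show ?thesis
        unfolding A_def[symmetric] ftd by simp
    qed
  qed
qed

text \<open>\<open>R k\<close> is a correspondence between \<open>X\<close> and the Euclidean space
  that distorts the distance modulo \<open>L k\<close> by at most \<open>\<epsilon> k\<close>.
  Representatives of \<open>x\<close> reduced modulo \<open>L k\<close> into a fixed ball converge
  along \<open>U\<close> to some \<open>F x\<close>, and \<open>F\<close> followed by the passage to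
  the torus is the isometry. Compactness of \<open>X\<close> makes it onto.\<close>

lemma limit_of_flat_tori:
  fixes L :: "nat \<Rightarrow> 'a::euclidean_space set" and R :: "nat \<Rightarrow> 'b \<Rightarrow> 'a \<Rightarrow> bool"
  assumes X: "Metric_space X d" "compact_space (Metric_space.mtopology X d)"
    and L: "\<And>k. vector_subgroup (L k)" and D: "\<And>k x. infdist x (L k) \<le> D"
    and total: "\<forall>\<^sub>F k in sequentially. \<forall>x\<in>X. \<exists>v. R k x v"
    and onto: "\<forall>\<^sub>F k in sequentially. \<forall>v. \<exists>x\<in>X. R k x v"
    and dist: "\<forall>\<^sub>F k in sequentially. \<forall>x\<in>X. \<forall>y\<in>X. \<forall>v w. R k x v \<longrightarrow> R k y w \<longrightarrow>
        \<bar>d x y - infdist (v - w) (L k)\<bar> \<le> \<epsilon> k"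
    and \<epsilon>: "\<epsilon> \<longlonglongrightarrow> 0"
  shows "\<exists>m b. m \<le> DIM('a) \<and> euclidean_basis m b \<and>
           isometric_spaces X d (flat_torus m b) (flat_torus_dist m)"
proof -
  interpret X: Metric_space X d
    by (rule X)
  obtain U :: "nat filter" where U: "ultra U" "U \<le> sequentially"
    using ultra_le_exists[of sequentially] by auto
  note nb = ultra_neq_bot[OF U(1)]
  obtain M where M: "closed M" "vector_subgroup M" "\<And>x. infdist x M \<le> D"
    and lim: "\<And>x. ((\<lambda>k. infdist x (L k)) \<longlongrightarrow> infdist x M) U"
    by (rule ultralimit_of_subgroups[OF U L D], rule that)
  obtain m b and T :: "'a \<Rightarrow> nat \<Rightarrow> real" where T:
    "m \<le> DIM('a)" "euclidean_basis m b" "range T = topspace (Euclidean_space m)"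
    "\<And>x y. flat_torus_dist m ((\<lambda>l j. T x j + l j) ` integer_span m b) ((\<lambda>l j. T y j + l j) ` integer_span m b)
        = infdist (x - y) M"
    "\<And>x y. x - y \<in> M \<Longrightarrow>
       (\<lambda>l j. T x j + l j) ` integer_span m b = (\<lambda>l j. T y j + l j) ` integer_span m b"
    by (rule closed_cocompact_quotient_is_torus[OF M(2,1,3)], rule that)
  have M_iff: "x \<in> M \<longleftrightarrow> infdist x M = 0" for x
    using in_closed_iff_infdist_zero[OF M(1)] vector_subgroup_0[OF M(2)] by blast
  have lim_diff: "((\<lambda>k. infdist (a k - c k) (L k)) \<longlongrightarrow> infdist (a' - c') M) U"
    if "(a \<longlongrightarrow> a') U" "(c \<longlongrightarrow> c') U" for a c a' c'
  proof (rule Lim_transform[OF lim[of "a' - c'"]])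
    have "((\<lambda>k. dist (a k - c k) (a' - c')) \<longlongrightarrow> dist (a' - c') (a' - c')) U"
      by (intro tendsto_intros that)
    then have z: "((\<lambda>k. dist (a k - c k) (a' - c')) \<longlongrightarrow> 0) U"
      by simp
    show "((\<lambda>k. infdist (a k - c k) (L k) - infdist (a' - c') (L k)) \<longlongrightarrow> 0) U"
      by (rule Lim_null_comparison[OF _ z])
         (auto intro!: always_eventually infdist_triangle_abs)
  qed
  have \<epsilon>U: "(\<epsilon> \<longlongrightarrow> 0) U"
    by (rule tendsto_mono[OF U(2) \<epsilon>])
  have ev: "eventually P U" if "eventually P sequentially" for P
    using that U(2) by (rule filter_leD[rotated])
  \<comment> \<open>The clause on representatives is conditional because \<open>R k\<close> relates
    every point of \<open>X\<close> to a vector only for large \<open>k\<close>; where it does not,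
    any vector of the ball may serve as \<open>q k\<close>.\<close>
  define good where "good x q \<longleftrightarrow> (\<forall>k. q k \<in> cball 0 (D + 1)) \<and> (\<forall>k. (\<exists>v. R k x v) \<longrightarrow> (\<exists>l\<in>L k. R k x (q k + l))) \<and> (\<forall>\<^sub>F k in U. \<forall>y\<in>X. \<forall>w. R k y w \<longrightarrow>
          \<bar>d x y - infdist (q k - w) (L k)\<bar> \<le> \<epsilon> k)" for x and q :: "nat \<Rightarrow> 'a"
  have "\<exists>q. good x q" if x: "x \<in> X" for x
  proof -
    have "\<exists>v. v \<in> cball 0 (D + 1) \<and> ((\<exists>v. R k x v) \<longrightarrow> (\<exists>l\<in>L k. R k x (v + l)))" for k
    proof (cases "\<exists>v. R k x v")
      case True
      then obtain v where v: "R k x v" ..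
      have "infdist v (L k) < D + 1"
        using D[of v k] by simp
      then obtain l where l: "l \<in> L k" "dist v l < D + 1"
        using infdist_lessD[of "L k" v "D + 1"] vector_subgroup_0[OF L] by blast
      then show ?thesis
        using v by (intro exI[of _ "v - l"]) (auto simp: dist_norm norm_minus_commute intro!: bexI[of _ l])
    next
      case False
      have "D \<ge> 0"
        using D[of 0 0] infdist_nonneg[of 0 "L 0"] by linarith
      with False show ?thesis
        by (intro exI[of _ 0]) auto
    qed
    then obtain q where q: "\<And>k. q k \<in> cball 0 (D + 1)"
      "\<And>k. (\<exists>v. R k x v) \<Longrightarrow> \<exists>l\<in>L k. R k x (q k + l)"
      by metis
    have "\<forall>\<^sub>F k in U. \<forall>y\<in>X. \<forall>w. R k y w \<longrightarrow> \<bar>d x y - infdist (q k - w) (L k)\<bar> \<le> \<epsilon> k"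
      using ev[OF total] ev[OF dist]
    proof eventually_elim
      case (elim k)
      show ?case
      proof (intro ballI allI impI)
        fix y w assume y: "y \<in> X" "R k y w"
        obtain l where l: "l \<in> L k" "R k x (q k + l)"
          using q(2) elim(1) x by blast
        have "\<bar>d x y - infdist (q k + l - w) (L k)\<bar> \<le> \<epsilon> k"
          using elim(2) x y l by blast
        also have "q k + l - w = (q k - w) + l"
          by simp
        finally show "\<bar>d x y - infdist (q k - w) (L k)\<bar> \<le> \<epsilon> k"
          unfolding infdist_subgroup_shift[OF L l(1)] .
      qed
    qed
    with q have "good x q"
      unfolding good_def by simp
    then show ?thesis
      by blast
  qed
  then obtain q where "\<And>x. x \<in> X \<Longrightarrow> good x (q x)"
    by metis
  then have qb: "\<And>x k. x \<in> X \<Longrightarrow> q x k \<in> cball 0 (D + 1)"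
    and qR: "\<And>x k v. x \<in> X \<Longrightarrow> R k x v \<Longrightarrow> \<exists>l\<in>L k. R k x (q x k + l)"
    and q: "\<And>x. x \<in> X \<Longrightarrow> \<forall>\<^sub>F k in U. \<forall>y\<in>X. \<forall>w. R k y w \<longrightarrow> \<bar>d x y - infdist (q x k - w) (L k)\<bar> \<le> \<epsilon> k"
    unfolding good_def by blast+
  have "\<exists>l. (q x \<longlongrightarrow> l) U" if "x \<in> X" for x
    using ultra_tendsto_compact[OF U(1) compact_cball, of "q x" 0 "D + 1"] qb[OF that]
    by (metis always_eventually)
  then obtain F where F: "\<And>x. x \<in> X \<Longrightarrow> (q x \<longlongrightarrow> F x) U"
    by metis
  have R_lim: "((\<lambda>k. d x (y k)) \<longlongrightarrow> infdist (F x - w') M) U"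
    if x: "x \<in> X" and y: "\<forall>\<^sub>F k in U. y k \<in> X \<and> R k (y k) (w k)" and w: "(w \<longlongrightarrow> w') U" for x y w w'
  proof (rule Lim_transform[OF lim_diff[OF F[OF x] w]])
    have "\<forall>\<^sub>F k in U. norm (d x (y k) - infdist (q x k - w k) (L k)) \<le> \<epsilon> k"
      using q[OF x] y by eventually_elim auto
    then show "((\<lambda>k. d x (y k) - infdist (q x k - w k) (L k)) \<longlongrightarrow> 0) U"
      by (rule Lim_null_comparison[OF _ \<epsilon>U])
  qed
  have F_dist: "infdist (F x - F y) M = d x y" if x: "x \<in> X" and y: "y \<in> X" for x y
  proof -
    have "\<forall>\<^sub>F k in U. norm (infdist (q x k - q y k) (L k) - d x y) \<le> \<epsilon> k"
      using q[OF x] ev[OF total]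
    proof eventually_elim
      case (elim k)
      from elim(2) y obtain v where "R k y v"
        by blast
      from qR[OF y this] obtain l where l: "l \<in> L k" "R k y (q y k + l)"
        by blast
      then have "\<bar>d x y - infdist (q x k - (q y k + l)) (L k)\<bar> \<le> \<epsilon> k"
        using elim(1) y by blast
      also have "q x k - (q y k + l) = (q x k - q y k) + - l"
        by simp
      finally show ?case
        unfolding infdist_subgroup_shift[OF L vector_subgroup_neg[OF L l(1)]] by (simp add: abs_minus_commute)
    qed
    then have "((\<lambda>k. infdist (q x k - q y k) (L k) - d x y) \<longlongrightarrow> 0) U"
      by (rule Lim_null_comparison[OF _ \<epsilon>U])
    then have "((\<lambda>k. infdist (q x k - q y k) (L k)) \<longlongrightarrow> d x y) U"
      by (rule LIM_zero_cancel)
    then show ?thesis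
      by (rule tendsto_unique[OF nb lim_diff[OF F[OF x] F[OF y]]])
  qed
  define G where "G x = (\<lambda>l j. T (F x) j + l j) ` integer_span m b" for x
  have G_dist: "flat_torus_dist m (G x) (G y) = d x y" if "x \<in> X" "y \<in> X" for x y
    unfolding G_def T(4) by (rule F_dist[OF that])
  have "bij_betw G X (flat_torus m b)"
    unfolding bij_betw_def
  proof
    show "inj_on G X"
      using G_dist X.mdist_zero X.zero by (metis inj_onI)
    show "G ` X = flat_torus m b"
    proof
      show "G ` X \<subseteq> flat_torus m b"
        unfolding G_def flat_torus_def T(3)[symmetric] by blast
      show "flat_torus m b \<subseteq> G ` X"
      proof
        fix A assume "A \<in> flat_torus m b"
        then obtain v where v: "A = (\<lambda>l j. T v j + l j) ` integer_span m b"
          unfolding flat_torus_def T(3)[symmetric] by blast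
        \<comment> \<open>Points of \<open>X\<close> that correspond to the fixed vector
          \<open>v\<close>, for those \<open>k\<close> where there is one; their limit along
          \<open>U\<close> will be mapped to the class of \<open>v\<close>.\<close>
        define y where "y k = (SOME x. x \<in> X \<and> R k x v)" for k
        have "y k \<in> X \<and> R k (y k) v" if "\<exists>x\<in>X. R k x v" for k
          unfolding y_def by (rule someI_ex) (use that in blast)
        then have y: "\<forall>\<^sub>F k in U. y k \<in> X \<and> R k (y k) v"
          using ev[OF onto] by (auto elim!: eventually_mono)
        then have "\<forall>\<^sub>F k in U. y k \<in> X"
          by eventually_elim simp
        from X.ultra_limit_compact_space[OF U(1) X(2) this]
        obtain x where x: "x \<in> X" "((\<lambda>k. d (y k) x) \<longlongrightarrow> 0) U" .
        have "((\<lambda>k. d x (y k)) \<longlongrightarrow> infdist (F x - v) M) U"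
          by (rule R_lim[OF x(1) y tendsto_const])
        then have "infdist (F x - v) M = 0"
          using tendsto_unique[OF nb] x(2) by (simp add: X.commute)
        then have "F x - v \<in> M"
          by (simp add: M_iff)
        from T(5)[OF this] have "A = G x"
          unfolding G_def v by (rule sym)
        then show "A \<in> G ` X"
          using x(1) by blast
      qed
    qed
  qed
  then have "isometric_spaces X d (flat_torus m b) (flat_torus_dist m)"
    unfolding isometric_spaces_def isometric_embedding_def using G_dist
    by (intro exI[of _ G]) (auto simp: bij_betw_def)
  with T(1,2) show ?thesis
    by blast
qed

section \<open>Linear maps and Lebesgue measure\<close>

text \<open>The maps \<open>T t\<close> form a one-parameter group, and conjugating
  \<open>T 1\<close> with the stretch \<open>E\<close>, which doubles \<open>a\<close>, gives
  \<open>T 2\<close>. Hence the determinant of \<open>T 1\<close> equals its own square; it is not 0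
  because \<open>T (-1)\<close> is the inverse.\<close>

lemma det_transvection:
  fixes a :: "real^'n" and \<phi> :: "real^'n \<Rightarrow> real"
  assumes \<phi>: "linear \<phi>" "\<phi> a = 0"
  shows "det (matrix (\<lambda>w. w + \<phi> w *\<^sub>R a)) = 1"
proof (cases "a = 0")
  case True
  then show ?thesis
    by (simp add: matrix_id_mat_1[unfolded id_def])
next
  case False
  define T where "T t w = w + (t * \<phi> w) *\<^sub>R a" for t :: real and w
  have lin: "linear (T t)" for t
    unfolding T_def using \<phi>(1)
    by (intro linearI) (auto simp: linear_add linear_scale algebra_simps)
  have T_comp: "T s \<circ> T t = T (s + t)" for s t
    using \<phi> by (auto simp: T_def fun_eq_iff linear_add linear_scale algebra_simps)
  define c where "c w = (w \<bullet> a) / (a \<bullet> a)" for w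
  define E where "E w = w + c w *\<^sub>R a" for w
  define E' where "E' w = w - (c w / 2) *\<^sub>R a" for w
  have E: "linear E" "linear E'"
    unfolding E_def E'_def c_def
    by (auto intro!: linearI simp: algebra_simps add_divide_distrib inner_add_left)
  have ca: "c a = 1"
    using False by (simp add: c_def)
  have c_add: "c (x + y) = c x + c y" "c (x - y) = c x - c y" "c (r *\<^sub>R x) = r * c x" for x y r
    by (simp_all add: c_def inner_add_left inner_diff_left add_divide_distrib diff_divide_distrib)
  have EE': "E \<circ> E' = id"
    by (auto simp: E_def E'_def fun_eq_iff c_add ca algebra_simps)
  have conj: "E \<circ> (T 1 \<circ> E') = T 2"
    using \<phi> by (auto simp: E_def E'_def T_def fun_eq_iff c_add ca linear_diff linear_scale algebra_simps
        simp flip: scaleR_add_left)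
  have d1: "det (matrix E) * det (matrix E') = 1"
    using E by (simp add: EE' flip: det_mul matrix_compose)
  have "det (matrix (T 2)) = det (matrix E) * (det (matrix (T 1)) * det (matrix E'))"
    using E lin by (simp add: conj linear_compose flip: det_mul matrix_compose)
  also have "\<dots> = det (matrix (T 1))"
    using d1 by (simp add: algebra_simps)
  also have "det (matrix (T 2)) = det (matrix (T 1)) * det (matrix (T 1))"
    using lin by (simp add: T_comp flip: det_mul matrix_compose)
  finally have "det (matrix (T 1)) = 0 \<or> det (matrix (T 1)) = 1"
    by simp
  moreover have "T 0 = id"
    by (simp add: T_def fun_eq_iff)
  then have "det (matrix (T 1)) * det (matrix (T (-1))) = 1"
    using lin by (simp add: T_comp flip: det_mul matrix_compose)
  ultimately have "det (matrix (T 1)) = 1"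
    by auto
  moreover have "T 1 = (\<lambda>w. w + \<phi> w *\<^sub>R a)"
    by (simp add: T_def fun_eq_iff)
  ultimately show ?thesis
    by simp
qed

text \<open>
  The library has this for index types of class \<open>wellorder\<close> only, because it evaluates the
  determinant of a shear by triangularity.
\<close>

lemma lmeasure_linear_image:
  fixes f :: "real^'n \<Rightarrow> real^'n"
  assumes "linear f" "det (matrix f) \<noteq> 0" "S \<in> lmeasurable"
  shows "f ` S \<in> lmeasurable \<and> measure lebesgue (f ` S) = \<bar>det (matrix f)\<bar> * measure lebesgue S"
proof -
  define P where "P f \<longleftrightarrow> (det (matrix f) \<noteq> 0 \<longrightarrow> (\<forall>S\<in>lmeasurable. f ` S \<in> lmeasurable \<and>
      measure lebesgue (f ` S) = \<bar>det (matrix f)\<bar> * measure lebesgue S))" for f :: "real^'n \<Rightarrow> real^'n"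
  have "P f"
  proof (rule induct_linear_elementary[OF assms(1)])
    fix f g assume fg: "linear f" "linear g" "P f" "P g"
    have "det (matrix (f \<circ> g)) = det (matrix f) * det (matrix g)"
      using fg by (simp add: matrix_compose det_mul)
    moreover have "(f \<circ> g) ` S = f ` g ` S" for S
      by (rule image_comp[symmetric])
    ultimately show "P (f \<circ> g)"
      using fg(3,4) unfolding P_def by (simp only: abs_mult mult.assoc) simp
  next
    fix f :: "real^'n \<Rightarrow> real^'n" and i assume "linear f" "\<And>x. f x $ i = 0"
    then have "row i (matrix f) = 0"
      by (simp add: row_def matrix_def vec_eq_iff)
    then have "det (matrix f) = 0"
      by (rule det_zero_row)
    then show "P f"
      by (simp add: P_def)
  next
    fix c :: "'n \<Rightarrow> real"
    have "det (matrix (\<lambda>x. \<chi> i. c i * x $ i)) = prod c UNIV"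
      by (subst det_diagonal) (auto simp: matrix_def axis_def)
    then show "P (\<lambda>x. \<chi> i. c i * x $ i)"
      by (simp add: P_def measurable_stretch measure_stretch)
  next
    fix m n :: 'n assume "m \<noteq> n"
    define h where "h x = (\<chi> i. x $ Transposition.transpose m n i)" for x :: "real^'n"
    have lin: "linear h"
      by (rule linearI) (auto simp: h_def vec_eq_iff)
    have hh: "h \<circ> h = id"
      by (auto simp: h_def vec_eq_iff)
    \<comment> \<open>The swap of two coordinates is an involution, which determines the absolute
      value of its determinant.\<close>
    have "det (matrix h) * det (matrix h) = 1"
      using lin by (simp add: hh flip: det_mul matrix_compose)
    then have det: "\<bar>det (matrix h)\<bar> = 1"
      by (metis abs_1 abs_mult abs_mult_self_eq mult_cancel_left1 power2_eq_1_iff power2_eq_square abs_minus_cancel)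
    have "measure lebesgue (h ` cbox a b) = 1 * measure lebesgue (cbox a b)" for a b
    proof -
      have mem: "h x \<in> cbox (h a) (h b) \<longleftrightarrow> x \<in> cbox a b" for x a b
        unfolding mem_box_cart h_def vec_lambda_beta by (metis transpose_involutory)
      have im: "h ` cbox a b = cbox (h a) (h b)"
      proof
        show "cbox (h a) (h b) \<subseteq> h ` cbox a b"
        proof
          fix y assume "y \<in> cbox (h a) (h b)"
          moreover have "y = h (h y)"
            using hh by (metis comp_apply id_apply)
          ultimately show "y \<in> h ` cbox a b"
            using mem by (metis imageI)
        qed
      qed (use mem in auto)
      have "(\<Prod>i\<in>UNIV. b $ Transposition.transpose m n i - a $ Transposition.transpose m n i) = (\<Prod>i\<in>UNIV. b $ i - a $ i)"
        by (rule prod.reindex_bij_betw[of "Transposition.transpose m n" UNIV UNIV "\<lambda>i. b $ i - a $ i"]) simp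
      then have e1: "(\<Prod>i\<in>UNIV. h b $ i - h a $ i) = (\<Prod>i\<in>UNIV. b $ i - a $ i)"
        by (simp only: h_def vec_lambda_beta)
      have e2: "cbox (h a) (h b) = {} \<longleftrightarrow> cbox a b = {}"
        unfolding im[symmetric] by (rule image_is_empty)
      have e3: "measure lebesgue (cbox u v) = (if cbox u v = {} then 0 else \<Prod>i\<in>UNIV. v $ i - u $ i)"
        for u v :: "real^'n"
        by (simp add: content_cbox_if_cart)
      show ?thesis
        by (simp only: im e1 e2 e3 mult_1)
    qed
    then have suff: "h ` S \<in> lmeasurable \<and> 1 * measure lebesgue S = measure lebesgue (h ` S)"
      if "S \<in> lmeasurable" for S
      by (intro measure_linear_sufficient lin that)
    have "P h"
      unfolding P_def
    proof (intro impI ballI)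
      fix S :: "(real^'n) set" assume "S \<in> lmeasurable"
      from suff[OF this] show "h ` S \<in> lmeasurable \<and> measure lebesgue (h ` S) = \<bar>det (matrix h)\<bar> * measure lebesgue S"
        by (simp add: det)
    qed
    moreover have "h = (\<lambda>x. \<chi> i. x $ Transposition.transpose m n i)"
      by (rule ext) (rule h_def)
    ultimately show "P (\<lambda>x. \<chi> i. x $ Transposition.transpose m n i)"
      by (simp only:)
  next
    fix m n :: 'n assume mn: "m \<noteq> n"
    define h where "h x = (\<chi> i. if i = m then x $ m + x $ n else x $ i)" for x :: "real^'n"
    have h: "h = (\<lambda>w. w + (w $ n) *\<^sub>R axis m 1)"
      by (auto simp: h_def fun_eq_iff vec_eq_iff axis_def)
    have lin: "linear h"
      by (rule linearI) (auto simp: h algebra_simps)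
    have det: "det (matrix h) = 1"
      unfolding h using mn by (intro det_transvection) (auto intro!: linearI simp: axis_def)
    have "measure lebesgue (h ` cbox a b) = 1 * measure lebesgue (cbox a b)" for a b
    proof (cases "cbox a b = {}")
      case False
      \<comment> \<open>Translation by \<open>s\<close> moves the lower bound of the
        \<open>n\<close>-th coordinate to 0, as \<open>measure_shear_interval\<close> requires a
        nonnegative one.\<close>
      define s :: "real^'n" where "s = - (a $ n) *\<^sub>R axis n 1"
      have "h ` cbox a b = (+) (- h s) ` h ` (+) s ` cbox a b"
        by (simp add: image_comp o_def linear_add[OF lin])
      then have "measure lebesgue (h ` cbox a b) = measure lebesgue (h ` cbox (s + a) (s + b))"
        by (simp only: measure_translation cbox_translation)
      also have "cbox (s + a) (s + b) \<noteq> {}"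
        unfolding cbox_translation using False by simp
      then have "measure lebesgue (h ` cbox (s + a) (s + b)) = measure lebesgue (cbox (s + a) (s + b))"
        unfolding h_def using mn by (intro measure_shear_interval) (simp_all add: s_def)
      also have "\<dots> = measure lebesgue (cbox a b)"
        by (simp only: cbox_translation measure_translation)
      finally show ?thesis
        by simp
    qed simp
    then have suff: "h ` S \<in> lmeasurable \<and> 1 * measure lebesgue S = measure lebesgue (h ` S)"
      if "S \<in> lmeasurable" for S
      by (intro measure_linear_sufficient lin that)
    have "P h"
      unfolding P_def
    proof (intro impI ballI)
      fix S :: "(real^'n) set" assume "S \<in> lmeasurable"
      from suff[OF this] show "h ` S \<in> lmeasurable \<and> measure lebesgue (h ` S) = \<bar>det (matrix h)\<bar> * measure lebesgue S"
        by (simp add: det)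
    qed
    moreover have "h = (\<lambda>x. \<chi> i. if i = m then x $ m + x $ n else x $ i)"
      by (rule ext) (rule h_def)
    ultimately show "P (\<lambda>x. \<chi> i. if i = m then x $ m + x $ n else x $ i)"
      by (simp only:)
  qed
  with assms show ?thesis
    by (simp add: P_def)
qed

text \<open>The pushforward of Lebesgue measure under \<open>f\<close>, multiplied by the absolute
  determinant, has the right values on boxes and is therefore Lebesgue measure. On boxes the
  preimage under \<open>f\<close> is the image under the inverse \<open>g\<close>.\<close>

lemma emeasure_lborel_linear_vimage:
  fixes f :: "real^'n \<Rightarrow> real^'n"
  assumes f: "linear f" and det: "det (matrix f) \<noteq> 0" and S: "S \<in> sets borel"
  shows "ennreal \<bar>det (matrix f)\<bar> * emeasure lborel (f -` S) = emeasure lborel S"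
proof -
  let ?d = "\<bar>det (matrix f)\<bar>"
  have "invertible (matrix f)"
    using det by (simp add: invertible_det_nz)
  then obtain g where g: "linear g" "f \<circ> g = id" "g \<circ> f = id"
    using f matrix_invertible by metis
  have dg: "?d * \<bar>det (matrix g)\<bar> = 1"
    using f g by (simp flip: abs_mult det_mul matrix_compose)
  then have dg0: "det (matrix g) \<noteq> 0"
    by auto
  have fm: "f \<in> borel_measurable lborel"
    using f by (simp add: linear_continuous_on linear_linear borel_measurable_continuous_onI)
  have vim: "f -` X = g ` X" for X
    using g by (auto simp: fun_eq_iff image_iff) metis
  define M where "M = density (distr lborel borel f) (\<lambda>_. ennreal ?d)"
  have M: "emeasure M X = ennreal ?d * emeasure lborel (f -` X)" if "X \<in> sets borel" for X
    using that fm by (simp add: M_def emeasure_density emeasure_distr nn_integral_cmult)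
  have "lborel = M"
  proof (rule lborel_eqI)
    fix l u :: "real^'n" assume lu: "\<And>b. b \<in> Basis \<Longrightarrow> l \<bullet> b \<le> u \<bullet> b"
    have gb: "g ` box l u \<in> lmeasurable"
      using lmeasure_linear_image[OF g(1) dg0, of "box l u"] by simp
    have "g ` box l u \<in> sets borel"
      using measurable_sets[OF fm, of "box l u"] by (simp add: vim)
    then have "emeasure lborel (g ` box l u) = emeasure lebesgue (g ` box l u)"
      by simp
    also have "\<dots> = ennreal (measure lebesgue (g ` box l u))"
      using gb by (simp add: emeasure_eq_measure2)
    also have "measure lebesgue (g ` box l u) = \<bar>det (matrix g)\<bar> * measure lebesgue (box l u)"
      using lmeasure_linear_image[OF g(1) dg0, of "box l u"] by simp
    also have "measure lebesgue (box l u) = (\<Prod>b\<in>Basis. (u - l) \<bullet> b)"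
      using lu by (simp add: measure_lborel_box_eq)
    finally have "emeasure M (box l u) = ennreal (?d * (\<bar>det (matrix g)\<bar> * (\<Prod>b\<in>Basis. (u - l) \<bullet> b)))"
      by (simp add: M vim ennreal_mult')
    also have "?d * (\<bar>det (matrix g)\<bar> * (\<Prod>b\<in>Basis. (u - l) \<bullet> b)) = (\<Prod>b\<in>Basis. (u - l) \<bullet> b)"
      using dg by (simp flip: mult.assoc)
    finally show "emeasure M (box l u) = (\<Prod>b\<in>Basis. (u - l) \<bullet> b)" .
  qed (simp add: M_def)
  then show ?thesis
    using M[OF S] by simp
qed

section \<open>Quotients by discrete subgroups\<close>

lemma heis_mult_assoc: "heis_mult (heis_mult x y) z = heis_mult x (heis_mult y z)"
  by (simp add: heis_mult_def scaleR_add_right)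

lemma heis_mult_simps [simp]:
  "heis_mult 0 x = x" "heis_mult x 0 = x" "heis_mult x (- x) = 0" "heis_mult (- x) x = 0"
  "heis_mult (- x) (heis_mult x y) = y" "heis_mult x (heis_mult (- x) y) = y"
  by (simp_all add: heis_mult_def scaleR_add_right)

lemma heis_mult_cancel: "heis_mult x z = heis_mult y z \<longleftrightarrow> x = y"
proof
  assume "heis_mult x z = heis_mult y z"
  then have "heis_mult (heis_mult x z) (- z) = heis_mult (heis_mult y z) (- z)"
    by simp
  then show "x = y"
    by (simp add: heis_mult_assoc)
qed simp

definition heis_subgroup :: "'n::finite heis set \<Rightarrow> bool" where
  "heis_subgroup \<Gamma> \<longleftrightarrow> 0 \<in> \<Gamma> \<and> (\<forall>x\<in>\<Gamma>. \<forall>y\<in>\<Gamma>. heis_mult x y \<in> \<Gamma>) \<and> (\<forall>x\<in>\<Gamma>. - x \<in> \<Gamma>)"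

lemma heis_subgroupI:
  fixes \<Gamma> :: "'n::finite heis set"
  assumes "subgroup \<Gamma> heisenberg" shows "heis_subgroup \<Gamma>"
proof -
  interpret group "heisenberg :: 'n::finite heis monoid"
    by (rule group_heisenberg)
  have "inv\<^bsub>heisenberg\<^esub> x = - x" for x :: "'n heis"
    by (rule inv_equality) (auto simp: heisenberg_def)
  then have "- x \<in> \<Gamma>" if "x \<in> \<Gamma>" for x
    using subgroup.m_inv_closed[OF assms that] by metis
  with subgroup.one_closed[OF assms] subgroup.m_closed[OF assms] show ?thesis
    by (auto simp: heis_subgroup_def heisenberg_def)
qed

abbreviation heis_coset :: "'n::finite heis set \<Rightarrow> 'n heis \<Rightarrow> 'n heis set" where
  "heis_coset \<Gamma> p \<equiv> \<Gamma> #>\<^bsub>heisenberg\<^esub> p"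

lemma heis_coset_eq: "heis_coset \<Gamma> p = (\<lambda>x. heis_mult x p) ` \<Gamma>"
  by (auto simp: r_coset_def heisenberg_def)

lemma heis_quotient_eq: "heis_quotient \<Gamma> = range (heis_coset \<Gamma>)"
  by (auto simp: heis_quotient_def RCOSETS_def heisenberg_def)

lemma heis_coset_eq_iff:
  assumes "heis_subgroup \<Gamma>"
  shows "heis_coset \<Gamma> p = heis_coset \<Gamma> q \<longleftrightarrow> (\<exists>x\<in>\<Gamma>. q = heis_mult x p)"
proof
  assume "heis_coset \<Gamma> p = heis_coset \<Gamma> q"
  moreover have "heis_mult 0 q \<in> heis_coset \<Gamma> q"
    unfolding heis_coset_eq using assms unfolding heis_subgroup_def by blast
  ultimately show "\<exists>x\<in>\<Gamma>. q = heis_mult x p"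
    by (auto simp: heis_coset_eq)
next
  have sub: "heis_coset \<Gamma> (heis_mult x p) \<subseteq> heis_coset \<Gamma> p" if "x \<in> \<Gamma>" for x p
    using that assms unfolding heis_coset_eq heis_subgroup_def
    by (auto simp flip: heis_mult_assoc)
  assume "\<exists>x\<in>\<Gamma>. q = heis_mult x p"
  then obtain x where x: "x \<in> \<Gamma>" "q = heis_mult x p"
    by blast
  then have "p = heis_mult (- x) q" "- x \<in> \<Gamma>"
    using assms by (auto simp: heis_subgroup_def)
  then have "heis_coset \<Gamma> p \<subseteq> heis_coset \<Gamma> q"
    using sub[of "- x" q] by simp
  with sub[OF x(1), of p] x(2) show "heis_coset \<Gamma> p = heis_coset \<Gamma> q"
    by simp
qed

text \<open>Each point has an open neighbourhood that contains no other point of \<open>S\<close>;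
  countably many of these neighbourhoods cover \<open>S\<close>.\<close>

lemma discrete_imp_countable:
  fixes S :: "'a::second_countable_topology set"
  assumes "discrete S" shows "countable S"
proof -
  have "\<exists>T. open T \<and> T \<inter> S = {x}" if "x \<in> S" for x
    using discreteD[OF assms that] by (auto simp: isolated_in_def)
  then obtain T where T: "\<And>x. x \<in> S \<Longrightarrow> open (T x)" "\<And>x. x \<in> S \<Longrightarrow> T x \<inter> S = {x}"
    by metis
  obtain F where F: "F \<subseteq> T ` S" "countable F" "\<Union>F = \<Union>(T ` S)"
    using Lindelof[of "T ` S"] T(1) by blast
  then obtain C where C: "C \<subseteq> S" "countable C" "F = T ` C"
    using countable_subset_image by metis
  have "S \<subseteq> C"
  proof
    fix x assume x: "x \<in> S"
    then have "x \<in> \<Union>F"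
      unfolding F(3) using T(2) by blast
    then obtain y where "y \<in> C" "x \<in> T y"
      unfolding C(3) by blast
    then have "T y \<inter> S = {y}"
      using T(2) C(1) by blast
    then have "x = y"
      using x \<open>x \<in> T y\<close> by blast
    then show "x \<in> C"
      using \<open>y \<in> C\<close> by simp
  qed
  then show ?thesis
    using C(2) countable_subset by blast
qed

lemma discrete_gap:
  fixes S :: "'a::real_normed_vector set"
  assumes "discrete S" "0 \<in> S"
  obtains e where "e > 0" "\<And>x. x \<in> S \<Longrightarrow> norm x < e \<Longrightarrow> x = 0"
proof -
  obtain T where T: "open T" "T \<inter> S = {0}"
    using discreteD[OF assms] by (auto simp: isolated_in_def)
  then obtain e where e: "e > 0" "ball 0 e \<subseteq> T"
    using open_contains_ball by blast
  show ?thesis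
  proof (rule that[OF e(1)])
    fix x assume "x \<in> S" "norm x < e"
    then have "x \<in> T \<inter> S"
      using e(2) by (auto simp: subset_iff)
    then show "x = 0"
      using T(2) by simp
  qed
qed

lemma continuous_heis_mult: "continuous_on S (\<lambda>x. heis_mult (f x) (g x))"
  if "continuous_on S f" "continuous_on S g"
proof -
  have "bounded_bilinear (heis_bracket :: 'n::finite heis \<Rightarrow> _)"
    using bilinear_heis_bracket by (simp add: bilinear_conv_bounded_bilinear)
  from bounded_bilinear.continuous_on[OF this that] that show ?thesis
    unfolding heis_mult_def by (intro continuous_intros)
qed

text \<open>If \<open>y = heis_mult z x\<close> with both \<open>x\<close> and \<open>y\<close>
  close to \<open>p\<close>, then \<open>z\<close> is \<open>y\<close> times the inverse of
  \<open>x\<close> and is close to 0 by continuity, hence 0 by discreteness.\<close>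

lemma heis_coset_locally_inj:
  fixes \<Gamma> :: "'n::finite heis set"
  assumes \<Gamma>: "heis_subgroup \<Gamma>" "discrete \<Gamma>"
  obtains N where "open N" "p \<in> N" "inj_on (heis_coset \<Gamma>) N"
proof -
  have "0 \<in> \<Gamma>"
    using \<Gamma>(1) by (simp add: heis_subgroup_def)
  then obtain e where e: "e > 0" "\<And>x. x \<in> \<Gamma> \<Longrightarrow> norm x < e \<Longrightarrow> x = 0"
    using discrete_gap[OF \<Gamma>(2)] by blast
  define h :: "'n heis \<times> 'n heis \<Rightarrow> 'n heis" where "h z = heis_mult (fst z) (- snd z)" for z
  have "continuous_on UNIV h"
    unfolding h_def by (intro continuous_heis_mult continuous_intros)
  then have "open (h -` ball 0 e)"
    by (simp add: open_vimage)
  moreover have "(p, p) \<in> h -` ball 0 e"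
    using e by (simp add: h_def)
  ultimately obtain A B where AB: "open A" "open B" "(p, p) \<in> A \<times> B" "A \<times> B \<subseteq> h -` ball 0 e"
    by (rule open_prod_elim)
  show ?thesis
  proof (rule that[of "A \<inter> B"])
    show "inj_on (heis_coset \<Gamma>) (A \<inter> B)"
    proof (rule inj_onI)
      fix x y assume xy: "x \<in> A \<inter> B" "y \<in> A \<inter> B" "heis_coset \<Gamma> x = heis_coset \<Gamma> y"
      then obtain z where z: "z \<in> \<Gamma>" "y = heis_mult z x"
        using heis_coset_eq_iff[OF \<Gamma>(1)] by blast
      have "h (y, x) = z"
        by (simp add: h_def z heis_mult_assoc)
      moreover have "(y, x) \<in> h -` ball 0 e"
        using xy AB(4) by blast
      ultimately have "z = 0"
        using e(2)[OF z(1)] by simp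
      then show "x = y"
        using z by simp
    qed
  qed (use AB in auto)
qed

text \<open>Countably many open sets \<open>O' i\<close> on which the projection is injective cover
  the group. \<open>F\<close> takes from \<open>O' i\<close> the points whose orbit misses all
  earlier ones, so that each orbit is met exactly once.\<close>

lemma heis_fundamental_domain:
  fixes \<Gamma> :: "'n::finite heis set"
  assumes \<Gamma>: "heis_subgroup \<Gamma>" "discrete \<Gamma>"
  obtains F where "F \<in> sets borel" "inj_on (heis_coset \<Gamma>) F" "heis_coset \<Gamma> ` F = heis_quotient \<Gamma>"
proof -
  have "\<forall>p. \<exists>N. open N \<and> p \<in> N \<and> inj_on (heis_coset \<Gamma>) N"
    using heis_coset_locally_inj[OF \<Gamma>] by metis
  then obtain N where N: "\<And>p. open (N p)" "\<And>p. p \<in> N p" "\<And>p. inj_on (heis_coset \<Gamma>) (N p)"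
    by metis
  obtain \<F> where \<F>: "\<F> \<subseteq> range N" "countable \<F>" "\<Union>\<F> = \<Union>(range N)"
    using Lindelof[of "range N"] N(1) by blast
  have "\<F> \<noteq> {}"
    using \<F>(3) N(2) by blast
  define O' where "O' i = from_nat_into \<F> i" for i
  have O': "range O' = \<F>"
    unfolding O'_def using range_from_nat_into[OF \<open>\<F> \<noteq> {}\<close> \<F>(2)] .
  have opn: "open (O' i)" and inj: "inj_on (heis_coset \<Gamma>) (O' i)" for i
    using N \<F>(1) O' by (metis rangeI rangeE subsetD)+
  have cov: "\<exists>i. p \<in> O' i" for p
    using \<F>(3) N(2) O' by blast
  \<comment> \<open>The saturation of \<open>O' i\<close> under \<open>\<Gamma>\<close>.\<close>
  define G where "G i = {p. \<exists>x\<in>\<Gamma>. heis_mult x p \<in> O' i}" for i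
  have "open (G i)" for i
  proof -
    have "G i = (\<Union>x\<in>\<Gamma>. (\<lambda>p. heis_mult x p) -` O' i)"
      by (auto simp: G_def)
    moreover have "open ((\<lambda>p. heis_mult x p) -` O' i)" for x
      by (intro open_vimage opn continuous_heis_mult continuous_intros)
    ultimately show ?thesis
      by auto
  qed
  then have G_sets: "G i \<in> sets borel" for i
    by simp
  have G_mono: "heis_mult x p \<in> G i \<longleftrightarrow> p \<in> G i" if "x \<in> \<Gamma>" for x p i
  proof
    assume "heis_mult x p \<in> G i"
    then show "p \<in> G i"
      using that \<Gamma>(1) unfolding G_def heis_subgroup_def by (auto simp flip: heis_mult_assoc)
  next
    assume "p \<in> G i"
    then obtain y where y: "y \<in> \<Gamma>" "heis_mult y p \<in> O' i"
      by (auto simp: G_def)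
    have "heis_mult (heis_mult y (- x)) (heis_mult x p) = heis_mult y p"
      by (simp add: heis_mult_assoc)
    moreover have "heis_mult y (- x) \<in> \<Gamma>"
      using y that \<Gamma>(1) by (auto simp: heis_subgroup_def)
    ultimately show "heis_mult x p \<in> G i"
      unfolding G_def using y(2) by force
  qed
  define F where "F = (\<Union>i. O' i - (\<Union>j<i. G j))"
  have OG: "O' i \<subseteq> G i" for i
    using \<Gamma>(1) unfolding G_def heis_subgroup_def by (force intro: bexI[of _ 0])
  show ?thesis
  proof (rule that)
    show "F \<in> sets borel"
      unfolding F_def using opn G_sets by (intro sets.countable_UN sets.Diff sets.finite_UN) auto
    show "inj_on (heis_coset \<Gamma>) F"
    proof (rule inj_onI)
      fix p q assume p: "p \<in> F" and q: "q \<in> F" and eq: "heis_coset \<Gamma> p = heis_coset \<Gamma> q"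
      from p obtain i where i: "p \<in> O' i" "\<And>k. k < i \<Longrightarrow> p \<notin> G k"
        by (auto simp: F_def)
      from q obtain j where j: "q \<in> O' j" "\<And>k. k < j \<Longrightarrow> q \<notin> G k"
        by (auto simp: F_def)
      obtain x where x: "x \<in> \<Gamma>" "q = heis_mult x p"
        using eq heis_coset_eq_iff[OF \<Gamma>(1)] by blast
      then have "p \<in> G k \<longleftrightarrow> q \<in> G k" for k
        using G_mono by simp
      with i j OG have "i = j"
        by (metis linorder_neqE_nat subsetD)
      then show "p = q"
        using inj_onD[OF inj eq] i j by blast
    qed
    show "heis_coset \<Gamma> ` F = heis_quotient \<Gamma>"
    proof
      show "heis_coset \<Gamma> ` F \<subseteq> heis_quotient \<Gamma>"
        by (auto simp: heis_quotient_eq)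
      show "heis_quotient \<Gamma> \<subseteq> heis_coset \<Gamma> ` F"
      proof
        fix A assume "A \<in> heis_quotient \<Gamma>"
        then obtain p where p: "A = heis_coset \<Gamma> p"
          by (auto simp: heis_quotient_eq)
        define i where "i = (LEAST i. p \<in> G i)"
        have "\<exists>i. p \<in> G i"
          using cov OG by blast
        then have "p \<in> G i"
          unfolding i_def by (rule LeastI_ex)
        then obtain x where x: "x \<in> \<Gamma>" "heis_mult x p \<in> O' i"
          by (auto simp: G_def)
        have "p \<notin> G k" if "k < i" for k
          using not_less_Least[of k "\<lambda>i. p \<in> G i"] that by (simp add: i_def)
        then have "heis_mult x p \<in> F"
          unfolding F_def using x G_mono[OF x(1)] by blast
        moreover have "heis_coset \<Gamma> p = heis_coset \<Gamma> (heis_mult x p)"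
          using heis_coset_eq_iff[OF \<Gamma>(1)] x(1) by blast
        ultimately show "A \<in> heis_coset \<Gamma> ` F"
          using p by blast
      qed
    qed
  qed
qed

text \<open>This makes the definite description in \<open>quotient_measure\<close> meaningful. The
  measure is pushed forward from a fundamental domain \<open>F\<close>. It is right on the image of
  \<open>A\<close> because \<open>A\<close> is cut into pieces which elements of
  \<open>\<Gamma>\<close> carry into \<open>F\<close>, and these translations preserve
  \<open>\<mu>\<close>. It is unique because every measurable set of cosets is the injective image
  of a part of \<open>F\<close>.\<close>

lemma heis_quotient_measure_exists:
  fixes \<Gamma> :: "'n::finite heis set"
  assumes \<Gamma>: "heis_subgroup \<Gamma>" "discrete \<Gamma>" and [measurable_cong]: "sets \<mu> = sets borel"
    and inv: "\<And>p S. S \<in> sets borel \<Longrightarrow> emeasure \<mu> (heis_mult p -` S) = emeasure \<mu> S"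
  shows "\<exists>!\<nu>. space \<nu> = heis_quotient \<Gamma> \<and>
          sets \<nu> = {B. B \<subseteq> heis_quotient \<Gamma> \<and> {p. heis_coset \<Gamma> p \<in> B} \<in> sets borel} \<and>
          (\<forall>A \<in> sets borel. inj_on (heis_coset \<Gamma>) A \<longrightarrow>
             emeasure \<nu> (heis_coset \<Gamma> ` A) = emeasure \<mu> A)"
    (is "\<exists>!\<nu>. ?P \<nu>")
proof -
  let ?pr = "heis_coset \<Gamma>" and ?Q = "heis_quotient \<Gamma>"
  obtain F where F: "F \<in> sets borel" "inj_on ?pr F" "?pr ` F = ?Q"
    by (rule heis_fundamental_domain[OF \<Gamma>], rule that)
  have cnt: "countable \<Gamma>"
    by (rule discrete_imp_countable[OF \<Gamma>(2)])
  have pr_Q: "?pr p \<in> ?Q" for p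
    by (auto simp: heis_quotient_eq)
  have trans_meas: "heis_mult x -` S \<in> sets borel" if "S \<in> sets borel" for x and S :: "'n heis set"
  proof -
    have "heis_mult x \<in> borel_measurable borel"
      by (intro borel_measurable_continuous_onI continuous_heis_mult continuous_intros)
    from measurable_sets[OF this that] show ?thesis
      by simp
  qed
  have orbit: "{p. ?pr p \<in> ?pr ` A} = (\<Union>x\<in>\<Gamma>. heis_mult x -` A)" for A
    using heis_coset_eq_iff[OF \<Gamma>(1)] by (auto simp: image_iff)
  have disj: "disjoint_family_on (\<lambda>x. C \<inter> heis_mult (s x) -` B) \<Gamma>"
    if "inj_on ?pr B" "\<And>x. x \<in> \<Gamma> \<Longrightarrow> s x \<in> \<Gamma>" "inj s" for s B C
    unfolding disjoint_family_on_def
  proof (intro ballI impI)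
    fix x y assume xy: "x \<in> \<Gamma>" "y \<in> \<Gamma>" "x \<noteq> y"
    have False if p: "heis_mult (s x) p \<in> B" "heis_mult (s y) p \<in> B" for p
    proof -
      have "?pr (heis_mult (s x) p) = ?pr (heis_mult (s y) p)"
        using heis_coset_eq_iff[OF \<Gamma>(1)] xy \<open>\<And>x. x \<in> \<Gamma> \<Longrightarrow> s x \<in> \<Gamma>\<close> by metis
      then have "heis_mult (s x) p = heis_mult (s y) p"
        using inj_onD[OF \<open>inj_on ?pr B\<close>] p by blast
      with xy \<open>inj s\<close> show False
        by (simp add: heis_mult_cancel inj_eq)
    qed
    then show "C \<inter> heis_mult (s x) -` B \<inter> (C \<inter> heis_mult (s y) -` B) = {}"
      by blast
  qed
  define \<A> where "\<A> = {B. B \<subseteq> ?Q \<and> {p. ?pr p \<in> B} \<in> sets borel}"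
  have image_\<A>: "?pr ` A \<in> \<A>" if "A \<in> sets borel" for A
    unfolding \<A>_def using trans_meas[OF that] cnt pr_Q by (auto simp: orbit)
  have "sigma_algebra ?Q \<A>"
    unfolding sigma_algebra_iff2
  proof (intro conjI ballI allI impI)
    show "\<A> \<subseteq> Pow ?Q" "{} \<in> \<A>"
      by (auto simp: \<A>_def)
    show "?Q - B \<in> \<A>" if "B \<in> \<A>" for B
    proof -
      have "{p. ?pr p \<in> ?Q - B} = - {p. ?pr p \<in> B}"
        using pr_Q by auto
      with that show ?thesis
        by (auto simp: \<A>_def)
    qed
    show "(\<Union>i. B i) \<in> \<A>" if "range B \<subseteq> \<A>" for B :: "nat \<Rightarrow> _"
    proof -
      have "{p. ?pr p \<in> (\<Union>i. B i)} = (\<Union>i. {p. ?pr p \<in> B i})"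
        by auto
      with that show ?thesis
        by (auto simp: \<A>_def)
    qed
  qed
  then interpret sigma_algebra ?Q \<A> .
  define N where "N = measure_of ?Q \<A> (\<lambda>_. 0)"
  have N: "space N = ?Q" "sets N = \<A>"
    unfolding N_def using space_closed by (auto simp: sigma_sets_eq)
  have pr_meas: "?pr \<in> measurable \<mu> N"
    using pr_Q sets_eq_imp_space_eq[OF assms(3)]
    by (intro measurableI) (auto simp: N \<A>_def assms(3) vimage_def)
  define \<nu> where "\<nu> = distr (density \<mu> (indicator F)) N ?pr"
  have \<nu>: "emeasure \<nu> B = emeasure \<mu> (F \<inter> {p. ?pr p \<in> B})" if "B \<in> \<A>" for B
  proof -
    have "?pr -` B \<in> sets borel"
      using that by (simp add: \<A>_def vimage_def)
    moreover have "emeasure \<nu> B = emeasure (density \<mu> (indicator F)) (?pr -` B)"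
      unfolding \<nu>_def using pr_meas that N sets_eq_imp_space_eq[OF assms(3)] by (simp add: emeasure_distr)
    moreover have "(\<integral>\<^sup>+ p. indicator F p * indicator (?pr -` B) p \<partial>\<mu>) = (\<integral>\<^sup>+ p. indicator (F \<inter> ?pr -` B) p \<partial>\<mu>)"
      by (intro nn_integral_cong) (auto simp: indicator_def)
    ultimately show ?thesis
      using F(1) by (simp add: emeasure_density assms(3) vimage_def)
  qed
  have P\<nu>: "?P \<nu>"
  proof (intro conjI ballI impI)
    show "space \<nu> = ?Q" "sets \<nu> = {B. B \<subseteq> ?Q \<and> {p. ?pr p \<in> B} \<in> sets borel}"
      by (simp_all add: \<nu>_def N \<A>_def)
    fix A assume A: "A \<in> sets borel" "inj_on ?pr A"
    have m1: "F \<inter> heis_mult x -` A \<in> sets \<mu>" for x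
      unfolding assms(3) using F(1) trans_meas[OF A(1)] by simp
    have m2: "A \<inter> heis_mult x -` F \<in> sets \<mu>" for x
      unfolding assms(3) using A(1) trans_meas[OF F(1)] by simp
    have "emeasure \<nu> (?pr ` A) = emeasure \<mu> (\<Union>x\<in>\<Gamma>. F \<inter> heis_mult x -` A)"
      by (simp add: \<nu> image_\<A> A orbit)
    also have "\<dots> = (\<integral>\<^sup>+ x. emeasure \<mu> (F \<inter> heis_mult x -` A) \<partial>count_space \<Gamma>)"
      by (intro emeasure_UN_countable[OF m1 cnt disj[OF A(2), of "\<lambda>x. x"]]) auto
    also have "\<dots> = (\<integral>\<^sup>+ x. emeasure \<mu> (A \<inter> heis_mult (- x) -` F) \<partial>count_space \<Gamma>)"
    proof (rule nn_integral_cong)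
      fix x
      have "heis_mult (- x) -` (F \<inter> heis_mult x -` A) = A \<inter> heis_mult (- x) -` F"
        by auto
      then show "emeasure \<mu> (F \<inter> heis_mult x -` A) = emeasure \<mu> (A \<inter> heis_mult (- x) -` F)"
        using inv[of "F \<inter> heis_mult x -` A" "- x"] m1[of x] by (simp add: assms(3))
    qed
    also have "\<dots> = emeasure \<mu> (\<Union>x\<in>\<Gamma>. A \<inter> heis_mult (- x) -` F)"
      using \<Gamma>(1) by (intro emeasure_UN_countable[OF m2 cnt disj[OF F(2), of uminus], symmetric])
        (auto simp: heis_subgroup_def)
    also have "(\<Union>x\<in>\<Gamma>. A \<inter> heis_mult (- x) -` F) = A"
    proof
      show "A \<subseteq> (\<Union>x\<in>\<Gamma>. A \<inter> heis_mult (- x) -` F)"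
      proof
        fix p assume "p \<in> A"
        have "?pr p \<in> ?pr ` F"
          unfolding F(3) by (rule pr_Q)
        then obtain q where q: "q \<in> F" "?pr q = ?pr p"
          by auto
        then obtain x where "x \<in> \<Gamma>" "p = heis_mult x q"
          using heis_coset_eq_iff[OF \<Gamma>(1)] by blast
        then show "p \<in> (\<Union>x\<in>\<Gamma>. A \<inter> heis_mult (- x) -` F)"
          using q(1) \<open>p \<in> A\<close> by (intro UN_I[of x]) auto
      qed
    qed auto
    finally show "emeasure \<nu> (?pr ` A) = emeasure \<mu> A" .
  qed
  have unique: "\<nu>' = \<nu>" if \<nu>': "?P \<nu>'" for \<nu>'
  proof (rule measure_eqI)
    show "sets \<nu>' = sets \<nu>"
      using \<nu>' by (simp add: \<nu>_def N \<A>_def)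
    fix B assume "B \<in> sets \<nu>'"
    then have B: "B \<in> \<A>"
      using \<nu>' by (simp add: \<A>_def)
    let ?A = "F \<inter> {p. ?pr p \<in> B}"
    have "B \<subseteq> ?Q"
      using B by (simp add: \<A>_def)
    then have "?pr ` ?A = B"
      unfolding F(3)[symmetric] by auto
    moreover have "?A \<in> sets borel" "inj_on ?pr ?A"
      using B F by (auto simp: \<A>_def intro: inj_on_subset)
    moreover have "\<forall>A\<in>sets borel. inj_on ?pr A \<longrightarrow> emeasure \<nu>' (?pr ` A) = emeasure \<mu> A"
      using \<nu>' by (elim conjE)
    ultimately have "emeasure \<nu>' B = emeasure \<mu> ?A"
      by (metis (no_types, lifting))
    then show "emeasure \<nu>' B = emeasure \<nu> B"
      by (simp add: \<nu>[OF B])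
  qed
  show ?thesis
    by (rule ex1I[of ?P, OF P\<nu> unique])
qed

text \<open>Through this bound an explicit box of inequivalent points will control the total volume
  from below.\<close>

lemma emeasure_le_quotient_total:
  fixes \<Gamma> :: "'n::finite heis set"
  assumes \<Gamma>: "heis_subgroup \<Gamma>" "discrete \<Gamma>" and sets: "sets \<mu> = sets borel"
    and inv: "\<And>p S. S \<in> sets borel \<Longrightarrow> emeasure \<mu> (heis_mult p -` S) = emeasure \<mu> S"
    and A: "A \<in> sets borel" "inj_on (heis_coset \<Gamma>) A"
  shows "emeasure \<mu> A \<le> quotient_total \<Gamma> \<mu>"
proof -
  let ?\<nu> = "quotient_measure \<Gamma> \<mu>"
  have \<nu>: "space ?\<nu> = heis_quotient \<Gamma>" "emeasure ?\<nu> (heis_coset \<Gamma> ` A) = emeasure \<mu> A"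
    using theI'[OF heis_quotient_measure_exists[OF \<Gamma> sets inv]] A
    unfolding quotient_measure_def by blast+
  have "emeasure ?\<nu> (heis_coset \<Gamma> ` A) \<le> emeasure ?\<nu> (space ?\<nu>)"
    by (rule emeasure_space)
  then show ?thesis
    unfolding \<nu> quotient_total_def .
qed

section \<open>Adapted frames\<close>

lemma inner_product_on_sum:
  assumes g: "inner_product_on V g" "subspace V" and B: "\<And>b. b \<in> B \<Longrightarrow> h b \<in> V" and y: "y \<in> V"
  shows "g (\<Sum>b\<in>B. c b *\<^sub>R h b) y = (\<Sum>b\<in>B. c b * g (h b) y)"
proof -
  have sc: "g (a *\<^sub>R x) y = a * g x y" if "x \<in> V" for a x
    using g(1) that y by (auto simp: inner_product_on_def)
  have ad: "g (x + x') y = g x y + g x' y" if "x \<in> V" "x' \<in> V" for x x'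
    using g(1) that y by (auto simp: inner_product_on_def)
  have g0: "g 0 y = 0"
    using sc[of 0 0] subspace_0[OF g(2)] by simp
  show ?thesis
    using B
  proof (induction B rule: infinite_finite_induct)
    case (insert x F)
    then have "(\<Sum>b\<in>F. c b *\<^sub>R h b) \<in> V"
      by (intro subspace_sum[OF g(2)] subspace_scale[OF g(2)]) auto
    with insert show ?case
      by (simp add: ad sc subspace_scale[OF g(2)])
  qed (simp_all add: g0)
qed

text \<open>Gram-Schmidt for \<open>g\<close>, which is an inner product on \<open>V\<close> only: a
  vector of \<open>V\<close> outside the span of the set found so far loses its components along
  that set and is normalised.\<close>

lemma orthonormal_set_exists:
  fixes V :: "'a::euclidean_space set"
  assumes g: "inner_product_on V g" "subspace V"
  obtains B where "finite B" "B \<subseteq> V" "card B = dim V" "\<And>b b'. b \<in> B \<Longrightarrow> b' \<in> B \<Longrightarrow> g b b' = (if b = b' then 1 else 0)"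
proof -
  have sym: "g x y = g y x" and pos: "x \<noteq> 0 \<Longrightarrow> g x x > 0"
    and sc: "g (a *\<^sub>R x) y = a * g x y" and ad: "g (x + y) z = g x z + g y z"
    if "x \<in> V" "y \<in> V" "z \<in> V" for x y z a
    using g(1) that by (auto simp: inner_product_on_def)
  have "\<exists>B. finite B \<and> B \<subseteq> V \<and> card B = k \<and> (\<forall>b\<in>B. \<forall>b'\<in>B. g b b' = (if b = b' then 1 else 0))"
    if "k \<le> dim V" for k
    using that
  proof (induction k)
    case (Suc k)
    then obtain B where B: "finite B" "B \<subseteq> V" "card B = k"
      and on: "\<And>b b'. b \<in> B \<Longrightarrow> b' \<in> B \<Longrightarrow> g b b' = (if b = b' then 1 else 0)"
      by auto
    have "\<not> V \<subseteq> span B"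
    proof
      assume "V \<subseteq> span B"
      then have "dim V \<le> card B"
        using B(1) by (rule dim_le_card)
      with B(3) Suc.prems show False
        by simp
    qed
    then obtain v where v: "v \<in> V" "v \<notin> span B"
      by blast
    define p where "p = (\<Sum>b\<in>B. (- g v b) *\<^sub>R b)"
    define w where "w = v + p"
    have pV: "p \<in> V"
      unfolding p_def using B by (intro subspace_sum[OF g(2)] subspace_scale[OF g(2)]) auto
    have wV: "w \<in> V"
      unfolding w_def using v pV subspace_add[OF g(2)] by blast
    have "p \<in> span B"
      unfolding p_def by (intro span_sum span_scale span_base)
    then have "w \<noteq> 0"
      using v(2) span_neg[of p B] by (auto simp: w_def add_eq_0_iff2)
    have gw: "g w b = 0" if b: "b \<in> B" for b
    proof -
      have "g p b = (\<Sum>b'\<in>B. - g v b' * g b' b)"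
        unfolding p_def using B b by (intro inner_product_on_sum[OF g, where h = "\<lambda>b. b"]) auto
      also have "\<dots> = (\<Sum>b'\<in>B. if b' = b then - g v b else 0)"
        using on b by (intro sum.cong) auto
      also have "\<dots> = - g v b"
        using B b by simp
      finally show ?thesis
        using ad[OF v(1) pV, of b] b B by (auto simp: w_def)
    qed
    define u where "u = (1 / sqrt (g w w)) *\<^sub>R w"
    have uV: "u \<in> V"
      unfolding u_def by (intro subspace_scale[OF g(2)] wV)
    have gww: "g w w > 0"
      using pos[OF wV wV wV] \<open>w \<noteq> 0\<close> by blast
    have gu: "g u y = g w y / sqrt (g w w)" if "y \<in> V" for y
      using sc[OF wV that that] by (simp add: u_def)
    have "g u w = sqrt (g w w)"
      using gu[OF wV] gww by (simp add: real_div_sqrt)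
    then have "g w u = sqrt (g w w)"
      using sym[OF uV wV wV] by simp
    then have uu: "g u u = 1"
      using gu[OF uV] gww by simp
    have ub: "g u b = 0" "g b u = 0" if "b \<in> B" for b
      using gu[of b] gw[OF that] that B(2) sym[of b u b] uV by auto
    have "u \<notin> B"
      using ub uu by force
    with B uV on ub uu show ?case
      by (intro exI[of _ "insert u B"]) auto
  qed (auto intro!: exI[of _ "{}"])
  from this[OF order_refl] obtain B where "finite B" "B \<subseteq> V" "card B = dim V"
    "\<forall>b\<in>B. \<forall>b'\<in>B. g b b' = (if b = b' then 1 else 0)"
    by (elim exE conjE)
  then show ?thesis
    by (intro that[of B]) simp_all
qed

context
  fixes V :: "'n::finite heis set" and g :: "'n heis \<Rightarrow> 'n heis \<Rightarrow> real"
  assumes sr: "sub_riemannian V g"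
begin

lemma sr_subspace: "subspace V" and sr_dim: "dim V = 2 * CARD('n)"
  and sr_gen: "bracket_generating V" and sr_inner: "inner_product_on V g"
  using sr by (auto simp: sub_riemannian_def)

lemma sr_not_UNIV: "V \<noteq> UNIV"
proof
  assume "V = UNIV"
  then have "dim V = CARD(('n + 'n) option)"
    by simp
  then show False
    using sr_dim by simp
qed

lemma heis_bracket_in_center: "heis_bracket x y = (heis_bracket x y $ None) *\<^sub>R axis None 1"
  by (simp add: heis_bracket_def vec_eq_iff axis_def)

lemma sr_bracket_span: "span {heis_bracket u w | u w. u \<in> V \<and> w \<in> V} \<subseteq> V \<Longrightarrow> False"
proof -
  assume sub: "span {heis_bracket u w | u w. u \<in> V \<and> w \<in> V} \<subseteq> V"
  have "x \<in> V" for x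
  proof -
    have "x \<in> {x + y | x y. x \<in> V \<and> y \<in> span {heis_bracket u w | u w. u \<in> V \<and> w \<in> V}}"
      using sr_gen unfolding bracket_generating_def by simp
    then show "x \<in> V"
      using sub subspace_add[OF sr_subspace] by blast
  qed
  with sr_not_UNIV show False
    by blast
qed

text \<open>With the centre inside \<open>V\<close> all brackets would lie in \<open>V\<close>, and
  \<open>V\<close> could not generate. Hence the projection along the centre is an isomorphism on
  \<open>V\<close>.\<close>

lemma sr_center: "axis None 1 \<notin> V"
proof
  assume Z: "axis None 1 \<in> V"
  have "span {heis_bracket u w | u w. u \<in> V \<and> w \<in> V} \<subseteq> V"
  proof (intro span_minimal sr_subspace subsetI)
    fix x assume "x \<in> {heis_bracket u w | u w. u \<in> V \<and> w \<in> V}"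
    then obtain u w where x: "x = heis_bracket u w"
      by blast
    show "x \<in> V"
      unfolding x by (subst heis_bracket_in_center) (intro subspace_scale[OF sr_subspace] Z)
  qed
  then show False
    by (rule sr_bracket_span)
qed

lemma sr_bracket_nonzero:
  obtains u w where "u \<in> V" "w \<in> V" "heis_bracket u w \<noteq> 0"
proof (rule ccontr)
  assume "\<not> thesis"
  then have "\<And>u w. u \<in> V \<Longrightarrow> w \<in> V \<Longrightarrow> heis_bracket u w = 0"
    using that by blast
  then have "{heis_bracket u w | u w. u \<in> V \<and> w \<in> V} \<subseteq> V"
    using subspace_0[OF sr_subspace] by auto
  then have "span {heis_bracket u w | u w. u \<in> V \<and> w \<in> V} \<subseteq> V"
    by (intro span_minimal sr_subspace)
  then show False
    by (rule sr_bracket_span)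
qed

text \<open>This makes the choice of a frame in \<open>popp_form\<close> meaningful. An orthonormal
  basis of \<open>V\<close> is completed by a central vector.\<close>

lemma adapted_frame_exists: "\<exists>e. adapted_frame V g e"
proof -
  obtain B where B: "finite B" "B \<subseteq> V" "card B = dim V"
    and on: "\<And>b b'. b \<in> B \<Longrightarrow> b' \<in> B \<Longrightarrow> g b b' = (if b = b' then 1 else 0)"
    using orthonormal_set_exists[OF sr_inner sr_subspace] by metis
  have ind: "independent B"
  proof (rule independent_if_scalars_zero[OF B(1)])
    fix f x assume f: "(\<Sum>x\<in>B. f x *\<^sub>R x) = 0" and x: "x \<in> B"
    have xV: "x \<in> V"
      using x B by blast
    have "g (\<Sum>b\<in>B. f b *\<^sub>R b) x = (\<Sum>b\<in>B. f b * g b x)"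
      using B xV by (intro inner_product_on_sum[OF sr_inner sr_subspace, where h = "\<lambda>b. b"]) auto
    also have "\<dots> = (\<Sum>b\<in>B. if b = x then f x else 0)"
      using on x by (intro sum.cong) auto
    also have "\<dots> = f x"
      using B x by simp
    finally have "g 0 x = f x"
      by (simp add: f)
    moreover have "g (0 *\<^sub>R x) x = 0 * g x x"
      using sr_inner xV unfolding inner_product_on_def by blast
    ultimately show "f x = 0"
      by simp
  qed
  have spanB: "span B = V"
  proof
    show "span B \<subseteq> V"
      using B sr_subspace by (intro span_minimal)
    show "V \<subseteq> span B"
      using B ind by (intro card_ge_dim_independent) auto
  qed
  have "card (UNIV :: ('n + 'n) set) = card B"
    using B(3) sr_dim by simp
  then obtain h :: "'n + 'n \<Rightarrow> 'n heis" where h: "bij_betw h UNIV B"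
    using finite_same_card_bij[OF finite B(1)] by blast
  define Z :: "'n heis" where "Z = axis None 1"
  have ZB: "Z \<notin> span B"
    using sr_center by (simp add: Z_def spanB)
  then have "Z \<notin> B"
    using span_base by blast
  define e where "e i = (case i of None \<Rightarrow> Z | Some j \<Rightarrow> h j)" for i
  have "e \<circ> Some = h"
    by (auto simp: e_def)
  moreover have hB: "range h = B" "inj h"
    using h by (auto simp: bij_betw_def)
  have rng: "range e = insert Z B"
    unfolding UNIV_option_conv using hB(1) by (simp add: e_def image_image)
  moreover have "inj e"
    using \<open>Z \<notin> B\<close> hB by (auto simp: inj_def e_def split: option.splits)
  moreover have indZ: "independent (insert Z B)"
    by (rule independent_insertI[OF ZB ind])
  moreover have "span (insert Z B) = UNIV"
  proof -
    have "card (insert Z B) = Suc (2 * CARD('n))"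
      using B \<open>Z \<notin> B\<close> sr_dim by simp
    then have "UNIV \<subseteq> span (insert Z B)"
      using indZ by (intro card_ge_dim_independent) auto
    then show ?thesis
      by blast
  qed
  moreover have "g (e (Some i)) (e (Some j)) = (if i = j then 1 else 0)" for i j
    using on[of "h i" "h j"] hB by (auto simp: e_def inj_def)
  ultimately have "adapted_frame V g e"
    by (simp add: adapted_frame_def spanB hB)
  then show ?thesis
    by blast
qed

end

text \<open>
  Coordinates of a sub-Riemannian structure: \<open>P\<close> is the projection along the centre in terms of an
  orthonormal basis of \<open>V\<close>, and \<open>z\<close> is the coordinate transverse to \<open>V\<close>, normalised so that the
  matrix \<open>\<omega>\<close> of the bracket has norm 1. In these coordinates Popp's volume is Lebesgue measure.
\<close>

locale popp_coordinates =
  fixes V :: "'n::finite heis set" and g :: "'n heis \<Rightarrow> 'n heis \<Rightarrow> real"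
    and P :: "'n heis \<Rightarrow> real ^ ('n + 'n)" and z :: "'n heis \<Rightarrow> real"
    and J :: "real ^ ('n + 'n) \<Rightarrow> 'n heis" and Z :: "'n heis"
    and \<omega> :: "'n + 'n \<Rightarrow> 'n + 'n \<Rightarrow> real"
  assumes linP: "linear P" and linz: "linear z" and linJ: "linear J"
    and PJ [simp]: "P (J x) = x" and zJ [simp]: "z (J x) = 0"
    and PZ [simp]: "P Z = 0" and zZ [simp]: "z Z = 1"
    and decomp: "p = J (P p) + z p *\<^sub>R Z"
    and bracket: "heis_bracket p q = (\<Sum>i\<in>UNIV. \<Sum>j\<in>UNIV. \<omega> i j * P p $ i * P q $ j) *\<^sub>R Z"
    and \<omega>_norm: "(\<Sum>i\<in>UNIV. \<Sum>j\<in>UNIV. (\<omega> i j)\<^sup>2) = 1"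
    and JV: "J x \<in> V" and VJ: "v \<in> V \<Longrightarrow> J (P v) = v"
    and g_norm: "g (J x) (J x) = (norm x)\<^sup>2"
    and nondegenerate: "x \<noteq> 0 \<Longrightarrow> \<exists>y. (\<Sum>i\<in>UNIV. \<Sum>j\<in>UNIV. \<omega> i j * x $ i * y $ j) \<noteq> 0"
    and popp_invariant: "S \<in> sets borel \<Longrightarrow> emeasure (popp_measure V g) (heis_mult p -` S) = emeasure (popp_measure V g) S"
    and popp_box: "0 \<le> r \<Longrightarrow> 0 \<le> t \<Longrightarrow>
      emeasure (popp_measure V g) {p. (\<forall>i. \<bar>P p $ i\<bar> < r) \<and> 0 < z p \<and> z p < t}
        = ennreal ((2 * r) ^ (2 * CARD('n)) * t)"

lemma left_diff_inv: "inv_into UNIV (left_diff p) = left_diff (- p)"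
proof
  fix a
  have "left_diff p (left_diff (- p) a) = a"
    by (simp add: left_diff_eq)
  then show "inv_into UNIV (left_diff p) a = left_diff (- p) a"
    using bij_left_diff[of p] by (metis bij_is_inj inv_into_f_f UNIV_I)
qed

lemma center_bracket: "heis_bracket (axis None c) y = 0" "heis_bracket y (axis None c) = 0"
  by (simp_all add: heis_bracket_def vec_eq_iff axis_def)

lemma left_diff_transvection:
  "left_diff p = (\<lambda>w. w + (heis_bracket p w $ None / 2) *\<^sub>R axis None 1)"
  by (rule ext) (simp add: left_diff_eq, simp add: heis_bracket_def vec_eq_iff axis_def)

lemma linear_bracket_None: "linear (\<lambda>w. heis_bracket p w $ None / 2)"
  by (rule linearI) (simp_all add: add_divide_distrib)

lemma det_left_diff: "det (matrix (left_diff p)) = 1"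
  unfolding left_diff_transvection
  by (rule det_transvection[OF linear_bracket_None]) (simp add: center_bracket)

lemma linear_left_diff: "linear (left_diff p)"
  unfolding left_diff_eq[abs_def] by (rule linearI) (simp_all add: scaleR_add_right)

text \<open>In exponential coordinates a left translation is the transvection
  \<open>left_diff p\<close> followed by an ordinary translation, so it is affine of determinant
  1.\<close>

lemma emeasure_lborel_heis_mult:
  fixes p :: "'n::finite heis"
  assumes "S \<in> sets borel"
  shows "emeasure lborel (heis_mult p -` S) = emeasure lborel S"
proof -
  have "heis_mult p w = p + left_diff p w" for w
    by (simp add: heis_mult_def left_diff_eq)
  then have "heis_mult p -` S = left_diff p -` ((+) p -` S)"
    by (auto simp: vimage_def)
  moreover have pS: "(+) p -` S \<in> sets borel"
    using measurable_sets[of "(+) p" borel borel S] assms by simp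
  ultimately have "emeasure lborel (heis_mult p -` S) = emeasure lborel ((+) p -` S)"
    using emeasure_lborel_linear_vimage[OF linear_left_diff _ pS] by (simp add: det_left_diff)
  also have "\<dots> = emeasure (distr lborel borel ((+) p)) S"
    using assms by (simp add: emeasure_distr)
  also have "\<dots> = emeasure lborel S"
    by (simp add: lborel_distr_plus)
  finally show ?thesis .
qed

text \<open>The frame is the very one chosen in \<open>popp_form\<close>, so that the density can be
  computed. Its vector \<open>e None\<close> is some complement of \<open>V\<close> that need not be
  central; without the correction by \<open>\<beta>\<close>, \<open>P\<close> might fail to vanish
  on the centre and to be a homomorphism.\<close>

lemma popp_coordinates_exist:
  fixes V :: "'n::finite heis set"
  assumes sr: "sub_riemannian V g"
  shows "\<exists>P z J Z \<omega>. popp_coordinates V g P z J Z \<omega>"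
proof -

  \<comment> \<open>The frame and its dual basis\<close>
  define e where "e = (SOME e. adapted_frame V g e)"
  have "adapted_frame V g e"
    unfolding e_def by (rule someI_ex[OF adapted_frame_exists[OF sr]])
  then have e: "span (range (e \<circ> Some)) = V" "inj e" "independent (range e)" "span (range e) = UNIV"
    and on: "\<And>i j. g (e (Some i)) (e (Some j)) = (if i = j then 1 else 0)"
    by (auto simp: adapted_frame_def)
  have eV: "e (Some i) \<in> V" for i
    unfolding e(1)[symmetric] by (rule span_base) auto
  define du where "du = dual_basis e"
  have du_lin: "linear (du l)" for l
    unfolding du_def dual_basis_def using e(3,4)
    by (intro linearI) (simp_all add: representation_add representation_scale)
  have du_e: "du l (e k) = (if k = l then 1 else 0)" for l k
  proof -
    have "du l (e k) = (if e k = e l then 1 else 0)"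
      unfolding du_def dual_basis_def using e(3) by (subst representation_basis) auto
    then show ?thesis
      using e(2) by (simp add: inj_eq)
  qed
  have du_sum: "p = (\<Sum>l\<in>UNIV. du l p *\<^sub>R e l)" for p
  proof -
    have "(\<Sum>b\<in>range e. representation (range e) p b *\<^sub>R b) = p"
      using e(3,4) by (intro sum_representation_eq) auto
    then show ?thesis
      unfolding du_def dual_basis_def using e(2) by (simp add: sum.reindex)
  qed
  have sum_option: "(\<Sum>l\<in>UNIV. F l) = F None + (\<Sum>i\<in>UNIV. F (Some i))" for F :: "('n + 'n) option \<Rightarrow> 'n heis"
    unfolding UNIV_option_conv by (simp add: sum.reindex)

  \<comment> \<open>The centre and the structure constants\<close>
  define C :: "'n heis" where "C = axis None 1"
  define \<kappa> where "\<kappa> = du None C"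
  have \<kappa>: "\<kappa> \<noteq> 0"
  proof
    assume "\<kappa> = 0"
    then have "C = (\<Sum>i\<in>UNIV. du (Some i) C *\<^sub>R e (Some i))"
      using du_sum[of C] by (simp add: sum_option \<kappa>_def)
    also have "\<dots> \<in> V"
      by (intro subspace_sum[OF sr_subspace[OF sr]] subspace_scale[OF sr_subspace[OF sr]] eV)
    finally show False
      using sr_center[OF sr] by (simp add: C_def)
  qed
  have bC: "heis_bracket p C = 0" "heis_bracket C p = 0" for p
    by (simp_all add: C_def center_bracket)
  define c where "c i j = structure_const e (Some i) (Some j) None" for i j
  have c: "c i j = du None (heis_bracket (e (Some i)) (e (Some j)))" for i j
    by (simp add: c_def structure_const_def du_def)
  \<comment> \<open>The reciprocal of the normalising factor in Popp's volume. It is positive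
    because some bracket of elements of \<open>V\<close> is nonzero.\<close>
  define s where "s = sqrt (\<Sum>i\<in>UNIV. \<Sum>j\<in>UNIV. (c i j)\<^sup>2)"
  have bmul: "heis_bracket p q = (du None (heis_bracket p q) / \<kappa>) *\<^sub>R C" for p q
  proof -
    have eq: "heis_bracket p q = (heis_bracket p q $ None) *\<^sub>R C"
      unfolding C_def by (rule heis_bracket_in_center[OF sr])
    have "du None (heis_bracket p q) = (heis_bracket p q $ None) * \<kappa>"
      by (subst eq) (simp add: linear_scale[OF du_lin] \<kappa>_def)
    then show ?thesis
      using \<kappa> eq by simp
  qed
  have Vsum: "v = (\<Sum>i\<in>UNIV. du (Some i) v *\<^sub>R e (Some i))" "du None v = 0" if "v \<in> V" for v
  proof -
    have "V \<subseteq> {v. du None v = 0}"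
      unfolding e(1)[symmetric]
      by (rule span_minimal) (auto simp: du_e subspace_def linear_0[OF du_lin] linear_add[OF du_lin] linear_scale[OF du_lin])
    with that show "du None v = 0"
      by blast
    then show "v = (\<Sum>i\<in>UNIV. du (Some i) v *\<^sub>R e (Some i))"
      using du_sum[of v] by (simp add: sum_option)
  qed
  have blin: "linear (heis_bracket p)" "linear (\<lambda>p. heis_bracket p q)" for p q :: "'n heis"
    using bilinear_heis_bracket by (auto simp: bilinear_def)
  have bsum: "heis_bracket (\<Sum>i\<in>UNIV. x i *\<^sub>R e (Some i)) (\<Sum>j\<in>UNIV. y j *\<^sub>R e (Some j))
      = (\<Sum>i\<in>UNIV. \<Sum>j\<in>UNIV. (x i * y j) *\<^sub>R heis_bracket (e (Some i)) (e (Some j)))" for x y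
    by (simp add: linear_sum[OF blin(1)] linear_sum[OF blin(2)] scaleR_sum_right mult.commute)
       (subst sum.swap, simp)
  have s0: "s > 0"
  proof -
    have "\<exists>i j. c i j \<noteq> 0"
    proof (rule ccontr)
      assume "\<not> ?thesis"
      then have "heis_bracket (e (Some i)) (e (Some j)) = 0" for i j
        using bmul[of "e (Some i)" "e (Some j)"] by (simp add: c)
      then have z: "heis_bracket v w = 0" if "v \<in> V" "w \<in> V" for v w
        by (subst Vsum(1)[OF that(1)], subst Vsum(1)[OF that(2)]) (simp add: bsum)
      show False
        by (rule sr_bracket_nonzero[OF sr]) (use z in blast)
    qed
    then obtain i j where ij: "c i j \<noteq> 0"
      by blast
    have "0 < (c i j)\<^sup>2"
      using ij by simp
    also have "\<dots> \<le> (\<Sum>j\<in>UNIV. (c i j)\<^sup>2)"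
      by (rule member_le_sum) auto
    also have "\<dots> \<le> (\<Sum>i\<in>UNIV. \<Sum>j\<in>UNIV. (c i j)\<^sup>2)"
      by (rule member_le_sum[where f = "\<lambda>i. \<Sum>j\<in>UNIV. (c i j)\<^sup>2"]) (auto intro: sum_nonneg)
    finally show ?thesis
      by (simp add: s_def)
  qed

  \<comment> \<open>The coordinates and the bracket form\<close>
  define z where "z p = du None p / s" for p
  define Z where "Z = (s / \<kappa>) *\<^sub>R C"
  \<comment> \<open>The components of the centre along the orthonormal basis, per unit of
    \<open>du None\<close>; subtracting them makes \<open>P\<close> vanish on the centre.\<close>
  define \<beta> where "\<beta> i = du (Some i) C / \<kappa>" for i
  define P where "P p = (\<chi> i. du (Some i) p - \<beta> i * du None p)" for p
  define J where "J x = (\<Sum>i\<in>UNIV. x $ i *\<^sub>R e (Some i))" for x :: "real^('n + 'n)"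
  define \<omega> where "\<omega> i j = c i j / s" for i j
  have duJ: "du None (J x) = 0" "du (Some i) (J x) = x $ i" for x i
  proof -
    show "du None (J x) = 0"
      by (simp add: J_def linear_sum[OF du_lin] linear_scale[OF du_lin] du_e)
    have "du (Some i) (J x) = (\<Sum>j\<in>UNIV. if j = i then x $ i else 0)"
      unfolding J_def linear_sum[OF du_lin] linear_scale[OF du_lin] du_e by (intro sum.cong) auto
    then show "du (Some i) (J x) = x $ i"
      by simp
  qed
  have linP: "linear P" and linz: "linear z" and linJ: "linear J"
    unfolding P_def z_def J_def
    by (auto intro!: linearI simp: vec_eq_iff linear_add[OF du_lin] linear_scale[OF du_lin]
        algebra_simps add_divide_distrib sum.distrib scaleR_sum_right)
  have PC: "P C = 0"
    using \<kappa> by (simp add: P_def vec_eq_iff \<beta>_def \<kappa>_def)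
  have PZ: "P Z = 0"
    by (simp add: Z_def linear_scale[OF linP] PC)
  have zZ: "z Z = 1"
    using s0 \<kappa> by (simp add: z_def Z_def linear_scale[OF du_lin] \<kappa>_def)
  have PJ: "P (J x) = x" and zJ: "z (J x) = 0" for x
    by (simp_all add: P_def z_def duJ vec_eq_iff)
  have JV: "J x \<in> V" for x
    unfolding J_def by (intro subspace_sum[OF sr_subspace[OF sr]] subspace_scale[OF sr_subspace[OF sr]] eV)
  have VJ: "J (P v) = v" if "v \<in> V" for v
    using Vsum[OF that] by (simp add: J_def P_def)
  have decomp: "p = J (P p) + z p *\<^sub>R Z" for p
  proof -
    define v where "v = p - z p *\<^sub>R Z"
    have "du None v = 0"
      using s0 zZ by (simp add: v_def linear_diff[OF du_lin] linear_scale[OF du_lin] z_def field_simps)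
    then have "v = (\<Sum>i\<in>UNIV. du (Some i) v *\<^sub>R e (Some i))"
      using du_sum[of v] by (simp add: sum_option)
    also have "\<dots> \<in> V"
      by (intro subspace_sum[OF sr_subspace[OF sr]] subspace_scale[OF sr_subspace[OF sr]] eV)
    finally have "J (P v) = v"
      by (rule VJ)
    moreover have "P v = P p"
      by (simp add: v_def linear_diff[OF linP] linear_scale[OF linP] PZ)
    ultimately show ?thesis
      by (simp add: v_def algebra_simps)
  qed
  have bmulZ: "heis_bracket p q = (du None (heis_bracket p q) / s) *\<^sub>R Z" for p q
    using bmul[of p q] s0 by (simp add: Z_def)
  have bracket: "heis_bracket p q = (\<Sum>i\<in>UNIV. \<Sum>j\<in>UNIV. \<omega> i j * P p $ i * P q $ j) *\<^sub>R Z" for p q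
  proof -
    have "heis_bracket p q = heis_bracket (J (P p)) (J (P q))"
      by (subst decomp[of p], subst decomp[of q]) (simp add: Z_def bC)
    also have "\<dots> = (du None (heis_bracket (J (P p)) (J (P q))) / s) *\<^sub>R Z"
      by (rule bmulZ)
    also have "du None (heis_bracket (J (P p)) (J (P q))) = (\<Sum>i\<in>UNIV. \<Sum>j\<in>UNIV. P p $ i * P q $ j * c i j)"
      by (simp add: J_def bsum linear_sum[OF du_lin] linear_scale[OF du_lin] c)
    also have "\<dots> / s = (\<Sum>i\<in>UNIV. \<Sum>j\<in>UNIV. \<omega> i j * P p $ i * P q $ j)"
      by (simp add: sum_divide_distrib \<omega>_def mult.commute mult.left_commute)
    finally show ?thesis .
  qed
  have \<omega>_norm: "(\<Sum>i\<in>UNIV. \<Sum>j\<in>UNIV. (\<omega> i j)\<^sup>2) = 1"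
  proof -
    have "(\<Sum>i\<in>UNIV. \<Sum>j\<in>UNIV. (\<omega> i j)\<^sup>2) = (\<Sum>i\<in>UNIV. \<Sum>j\<in>UNIV. (c i j)\<^sup>2) / s\<^sup>2"
      by (simp add: \<omega>_def power_divide sum_divide_distrib)
    also have "(\<Sum>i\<in>UNIV. \<Sum>j\<in>UNIV. (c i j)\<^sup>2) = s\<^sup>2"
      by (simp add: s_def sum_nonneg)
    finally show ?thesis
      using s0 by simp
  qed
  have g_norm: "g (J x) (J x) = (norm x)\<^sup>2" for x
  proof -
    have gJ: "g (J x) y = (\<Sum>i\<in>UNIV. x $ i * g (e (Some i)) y)" if "y \<in> V" for y
      unfolding J_def using eV that
      by (intro inner_product_on_sum[OF sr_inner[OF sr] sr_subspace[OF sr]])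
    have sym: "g v w = g w v" if "v \<in> V" "w \<in> V" for v w
      using sr_inner[OF sr] that by (auto simp: inner_product_on_def)
    have "g (e (Some i)) (J x) = x $ i" for i
    proof -
      have "g (e (Some i)) (J x) = (\<Sum>j\<in>UNIV. x $ j * g (e (Some j)) (e (Some i)))"
        using sym[OF eV JV] gJ[OF eV] by simp
      also have "\<dots> = (\<Sum>j\<in>UNIV. if j = i then x $ i else 0)"
        by (intro sum.cong) (auto simp: on)
      finally show ?thesis
        by simp
    qed
    then show ?thesis
      using gJ[OF JV, of x] by (simp add: power2_norm_eq_inner inner_vec_def)
  qed
  \<comment> \<open>A vector in the radical would make \<open>J x\<close> commute with the basis
    vectors \<open>X\<close>; then \<open>J x\<close> is central, and \<open>x = P (J x)\<close> is
    0.\<close>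
  have nondeg: "\<exists>y. (\<Sum>i\<in>UNIV. \<Sum>j\<in>UNIV. \<omega> i j * x $ i * y $ j) \<noteq> 0" if "x \<noteq> 0" for x
  proof (rule ccontr)
    assume "\<not> ?thesis"
    then have b0: "heis_bracket (J x) q = 0" for q
      unfolding bracket[of "J x" q] PJ by simp
    have "heis_bracket (J x) (axis (Some (Inr i)) 1) $ None = J x $ Some (Inl i)" for i
      by (simp add: heis_bracket_def axis_def if_distrib[of "\<lambda>r. _ * r"] cong: if_cong)
    then have z1: "J x $ Some (Inl i) = 0" for i
      by (simp add: b0)
    have "heis_bracket (J x) (axis (Some (Inl i)) 1) $ None = - (J x $ Some (Inr i))" for i
      by (simp add: heis_bracket_def axis_def sum_negf if_distrib[of "\<lambda>r. _ * r"] cong: if_cong)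
    then have z2: "J x $ Some (Inr i) = 0" for i
      by (simp add: b0)
    have "J x $ k = ((J x $ None) *\<^sub>R C) $ k" for k
    proof (cases k)
      case None
      then show ?thesis
        by (simp add: C_def)
    next
      case (Some a)
      then have "J x $ k = 0"
        using z1 z2 by (cases a) auto
      then show ?thesis
        using Some by (simp add: C_def axis_def)
    qed
    then have "J x = (J x $ None) *\<^sub>R C"
      unfolding vec_eq_iff by blast
    then have "P (J x) = 0"
      by (metis PC linear_scale[OF linP] scaleR_zero_right)
    with that show False
      by (simp add: PJ)
  qed

  \<comment> \<open>Popp's volume as Lebesgue measure in these coordinates\<close>
  define \<Delta> where "\<Delta> p = (\<chi> l. du l p)" for p
  have lin\<Delta>: "linear \<Delta>"
    unfolding \<Delta>_def by (rule linearI) (simp_all add: vec_eq_iff linear_add[OF du_lin] linear_scale[OF du_lin])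
  define K where "K = \<bar>det (matrix \<Delta>)\<bar> / s"
  have form: "\<bar>popp_form V g p (\<lambda>i. axis i 1)\<bar> = K" for p
  proof -
    have "(\<chi> i j. dual_basis e i (left_diff (- p) (axis j 1))) = matrix (\<Delta> \<circ> left_diff (- p))"
      by (simp add: matrix_def \<Delta>_def du_def)
    moreover have "det (matrix (\<Delta> \<circ> left_diff (- p))) = det (matrix \<Delta>)"
      unfolding matrix_compose[OF linear_left_diff lin\<Delta>] by (simp add: det_mul det_left_diff)
    ultimately have "popp_form V g p (\<lambda>i. axis i 1) = inverse s * det (matrix \<Delta>)"
      unfolding popp_form_def e_def[symmetric] frame_popp_def left_diff_inv s_def c_def by simp
    with s0 show ?thesis
      by (simp only: K_def abs_mult abs_inverse abs_of_pos divide_inverse mult.commute)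
  qed
  have popp: "emeasure (popp_measure V g) S = ennreal K * emeasure lborel S" if "S \<in> sets borel" for S
    unfolding popp_measure_def form using that by (simp add: emeasure_density nn_integral_cmult)
  \<comment> \<open>\<open>\<Phi>\<close> combines \<open>P\<close> and \<open>z\<close>. It arises
    from the dual coordinates \<open>\<Delta>\<close> by a transvection, which is the correction by
    \<open>\<beta>\<close>, and by dividing the last coordinate by \<open>s\<close>; so the absolute
    value of its determinant is the Popp density \<open>K\<close>.\<close>
  define \<Phi> where "\<Phi> p = (\<chi> l. case l of None \<Rightarrow> z p | Some i \<Rightarrow> P p $ i)" for p
  define T :: "'n heis \<Rightarrow> 'n heis" where "T y = y + (y $ None) *\<^sub>R (\<chi> l. case l of None \<Rightarrow> 0 | Some i \<Rightarrow> - \<beta> i)" for y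
  define E :: "'n heis \<Rightarrow> 'n heis" where "E y = (\<chi> l. (if l = None then 1 / s else 1) * y $ l)" for y
  have linT: "linear T"
    unfolding T_def by (rule linearI) (simp_all add: algebra_simps)
  have linE: "linear E"
    unfolding E_def by (rule linearI) (simp_all add: vec_eq_iff algebra_simps)
  have \<Phi>: "\<Phi> = E \<circ> (T \<circ> \<Delta>)"
    by (rule ext) (simp add: \<Phi>_def E_def T_def \<Delta>_def z_def P_def vec_eq_iff split: option.splits)
  have lin\<Phi>: "linear \<Phi>"
    unfolding \<Phi> by (intro linear_compose linE linT lin\<Delta>)
  have detT: "det (matrix T) = 1"
    unfolding T_def by (rule det_transvection) (auto intro: linearI)
  have detE: "det (matrix E) = 1 / s"
  proof -
    have "det (matrix E) = (\<Prod>l\<in>UNIV. if l = (None :: ('n + 'n) option) then 1 / s else 1)"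
      by (subst det_diagonal) (auto simp: matrix_def E_def axis_def intro!: prod.cong)
    also have "\<dots> = 1 / s"
      by simp
    finally show ?thesis .
  qed
  have "det (matrix \<Phi>) = det (matrix E) * (det (matrix T) * det (matrix \<Delta>))"
    unfolding \<Phi> using linE linT lin\<Delta> by (simp add: matrix_compose det_mul linear_compose)
  then have absdet: "\<bar>det (matrix \<Phi>)\<bar> = K"
    using s0 by (simp add: detT detE K_def abs_mult)
  have "inj \<Phi>"
  proof (rule injI)
    fix p q assume eq: "\<Phi> p = \<Phi> q"
    have "P p $ i = P q $ i" for i
      using arg_cong[OF eq, of "\<lambda>v. v $ Some i"] by (simp add: \<Phi>_def)
    then have "P p = P q"
      by (simp add: vec_eq_iff)
    moreover have "z p = z q"
      using arg_cong[OF eq, of "\<lambda>v. v $ None"] by (simp add: \<Phi>_def)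
    ultimately show "p = q"
      using decomp[of p] decomp[of q] by simp
  qed
  then have det\<Phi>: "det (matrix \<Phi>) \<noteq> 0"
    using lin\<Phi> by (simp add: det_nz_iff_inj)
  have "popp_coordinates V g P z J Z \<omega>"
  proof (rule popp_coordinates.intro)
    fix S :: "'n heis set" and p :: "'n heis" assume S: "S \<in> sets borel"
    have "heis_mult p \<in> borel_measurable borel"
      by (intro borel_measurable_continuous_onI continuous_heis_mult continuous_intros)
    from measurable_sets[OF this S] show
      "emeasure (popp_measure V g) (heis_mult p -` S) = emeasure (popp_measure V g) S"
      by (simp add: popp S emeasure_lborel_heis_mult)
  next
    fix r t :: real assume rt: "0 \<le> r" "0 \<le> t"
    define B :: "'n heis set" where
      "B = box (\<chi> l. if l = None then 0 else - r) (\<chi> l. if l = None then t else r)"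
    have abs: "\<bar>a\<bar> < r \<longleftrightarrow> - r < a \<and> a < r" for a
      by auto
    have "p \<in> \<Phi> -` B \<longleftrightarrow> (\<forall>i. \<bar>P p $ i\<bar> < r) \<and> 0 < z p \<and> z p < t" for p
      unfolding vimage_eq B_def mem_box_cart \<Phi>_def vec_lambda_beta split_option_all abs by (simp, blast)
    then have "{p. (\<forall>i. \<bar>P p $ i\<bar> < r) \<and> 0 < z p \<and> z p < t} = \<Phi> -` B"
      by blast
    moreover have "emeasure lborel B = ennreal ((2 * r) ^ (2 * CARD('n)) * t)"
    proof -
      have "emeasure lborel B = (\<Prod>b\<in>Basis. ((\<chi> l. if l = None then t else r) - (\<chi> l. if l = None then 0 else - r)) \<bullet> (b :: 'n heis))"
        unfolding B_def
        by (rule emeasure_lborel_box) (use rt in \<open>auto simp: Basis_vec_def inner_axis\<close>)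
      also have "(\<Prod>b\<in>Basis. ((\<chi> l. if l = None then t else r) - (\<chi> l. if l = None then 0 else - r)) \<bullet> (b :: 'n heis))
          = (\<Prod>l\<in>UNIV. if l = (None :: ('n + 'n) option) then t else 2 * r)"
      proof -
        have basis: "(Basis :: 'n heis set) = range (\<lambda>l. axis l 1)"
          by (auto simp: Basis_vec_def)
        have "inj (\<lambda>l. axis l 1 :: 'n heis)"
          by (auto simp: inj_def axis_eq_axis)
        then have "prod F (Basis :: 'n heis set) = (\<Prod>l\<in>UNIV. F (axis l 1))" for F :: "'n heis \<Rightarrow> real"
          unfolding basis by (subst prod.reindex) (simp_all add: o_def)
        then show ?thesis
          by (auto simp: inner_axis intro!: prod.cong)
      qed
      also have "\<dots> = (2 * r) ^ (2 * CARD('n)) * t"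
        unfolding UNIV_option_conv mult_2[of "CARD('n)"] by (simp add: prod.reindex mult.commute)
      finally show ?thesis .
    qed
    moreover have "\<Phi> -` B \<in> sets borel"
    proof -
      have "\<Phi> \<in> borel_measurable borel"
        using lin\<Phi> by (simp add: linear_continuous_on linear_linear borel_measurable_continuous_onI)
      from measurable_sets[OF this, of B] show ?thesis
        by (simp add: B_def)
    qed
    ultimately show "emeasure (popp_measure V g) {p. (\<forall>i. \<bar>P p $ i\<bar> < r) \<and> 0 < z p \<and> z p < t}
        = ennreal ((2 * r) ^ (2 * CARD('n)) * t)"
      using emeasure_lborel_linear_vimage[OF lin\<Phi> det\<Phi>, of B] by (simp add: popp absdet B_def)
  qed (fact linP linz linJ PJ zJ PZ zZ decomp bracket \<omega>_norm JV VJ g_norm nondeg)+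
  then show ?thesis
    by blast
qed

section \<open>Absolutely continuous paths\<close>

text \<open>The intervals will come from a tagged division, which is a finite set of pairs and not a
  numbered family.\<close>

lemma abs_continuous_on_finite_family:
  fixes h :: "real \<Rightarrow> 'a::metric_space"
  assumes "abs_continuous_on s t h" "e > 0"
  shows "\<exists>\<delta>>0. \<forall>(I :: 'b set) a b. finite I \<and> (\<forall>i\<in>I. s \<le> a i \<and> a i \<le> b i \<and> b i \<le> t) \<and>
    disjoint_family_on (\<lambda>i. {a i<..<b i}) I \<and> (\<Sum>i\<in>I. b i - a i) < \<delta> \<longrightarrow>
    (\<Sum>i\<in>I. dist (h (a i)) (h (b i))) < e"
proof -
  obtain \<delta> where \<delta>: "\<delta> > 0" and ac: "\<And>(N::nat) a b.
        (\<forall>i<N. s \<le> a i \<and> a i \<le> b i \<and> b i \<le> t) \<Longrightarrow>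
        disjoint_family_on (\<lambda>i. {a i<..<b i}) {..<N} \<Longrightarrow>
        (\<Sum>i<N. b i - a i) < \<delta> \<Longrightarrow> (\<Sum>i<N. dist (h (a i)) (h (b i))) < e"
    using assms unfolding abs_continuous_on_def by meson
  show ?thesis
  proof (intro exI[of _ \<delta>] conjI \<delta> allI impI, elim conjE)
    fix I :: "'b set" and a b :: "'b \<Rightarrow> real"
    assume I: "finite I" and le: "\<forall>i\<in>I. s \<le> a i \<and> a i \<le> b i \<and> b i \<le> t"
      and dj: "disjoint_family_on (\<lambda>i. {a i<..<b i}) I" and sum: "(\<Sum>i\<in>I. b i - a i) < \<delta>"
    obtain f where f: "bij_betw f {..<card I} I"
      using ex_bij_betw_nat_finite[OF I] by (auto simp: atLeast0LessThan)
    then have fI: "f i \<in> I" if "i < card I" for i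
      using that by (auto simp: bij_betw_def)
    have finj: "f i \<noteq> f j" if "i < card I" "j < card I" "i \<noteq> j" for i j
      using f that by (auto simp: bij_betw_def inj_on_def)
    have "(\<Sum>i<card I. dist (h (a (f i))) (h (b (f i)))) < e"
    proof (rule ac)
      show "\<forall>i<card I. s \<le> a (f i) \<and> a (f i) \<le> b (f i) \<and> b (f i) \<le> t"
        using le fI by blast
      show "disjoint_family_on (\<lambda>i. {a (f i)<..<b (f i)}) {..<card I}"
        unfolding disjoint_family_on_def
      proof (intro ballI impI)
        fix i j assume "i \<in> {..<card I}" "j \<in> {..<card I}" "i \<noteq> j"
        then show "{a (f i)<..<b (f i)} \<inter> {a (f j)<..<b (f j)} = {}"
          using disjoint_family_onD[OF dj fI fI finj] by simp
      qed
      show "(\<Sum>i<card I. b (f i) - a (f i)) < \<delta>"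
        using sum sum.reindex_bij_betw[OF f, of "\<lambda>i. b i - a i"] by simp
    qed
    then show "(\<Sum>i\<in>I. dist (h (a i)) (h (b i))) < e"
      using sum.reindex_bij_betw[OF f, of "\<lambda>i. dist (h (a i)) (h (b i))"] by simp
  qed
qed

text \<open>Applied to a Lipschitz function of an absolutely continuous path and, with the identity
  for \<open>c\<close>, to Lipschitz paths.\<close>

lemma abs_continuous_on_dominated:
  assumes "abs_continuous_on s t c"
    and K: "\<And>x y. x \<in> {s..t} \<Longrightarrow> y \<in> {s..t} \<Longrightarrow> dist (f x) (f y) \<le> K * dist (c x) (c y)"
  shows "abs_continuous_on s t f"
  unfolding abs_continuous_on_def
proof (intro allI impI)
  fix e :: real assume e: "e > 0"
  define M where "M = \<bar>K\<bar> + 1"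
  have M: "M > 0"
    by (simp add: M_def)
  have KM: "dist (f x) (f y) \<le> M * dist (c x) (c y)" if "x \<in> {s..t}" "y \<in> {s..t}" for x y
  proof -
    have "K * dist (c x) (c y) \<le> M * dist (c x) (c y)"
      by (intro mult_right_mono) (auto simp: M_def)
    with K[OF that] show ?thesis
      by linarith
  qed
  from e M have "e / M > 0"
    by simp
  with assms(1) obtain \<delta> where \<delta>: "\<delta> > 0" and ac: "\<And>(N::nat) a b.
        (\<forall>i<N. s \<le> a i \<and> a i \<le> b i \<and> b i \<le> t) \<and>
        disjoint_family_on (\<lambda>i. {a i<..<b i}) {..<N} \<and>
        (\<Sum>i<N. b i - a i) < \<delta> \<Longrightarrow> (\<Sum>i<N. dist (c (a i)) (c (b i))) < e / M"
    unfolding abs_continuous_on_def by meson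
  show "\<exists>\<delta>>0. \<forall>(N::nat) a b.
        (\<forall>i<N. s \<le> a i \<and> a i \<le> b i \<and> b i \<le> t) \<and>
        disjoint_family_on (\<lambda>i. {a i<..<b i}) {..<N} \<and>
        (\<Sum>i<N. b i - a i) < \<delta> \<longrightarrow> (\<Sum>i<N. dist (f (a i)) (f (b i))) < e"
  proof (intro exI[of _ \<delta>] conjI \<delta> allI impI)
    fix N :: nat and a b
    assume ab: "(\<forall>i<N. s \<le> a i \<and> a i \<le> b i \<and> b i \<le> t) \<and>
        disjoint_family_on (\<lambda>i. {a i<..<b i}) {..<N} \<and> (\<Sum>i<N. b i - a i) < \<delta>"
    from ac[OF ab] have "M * (\<Sum>i<N. dist (c (a i)) (c (b i))) < e"
      using M by (simp add: field_simps)
    moreover have "(\<Sum>i<N. dist (f (a i)) (f (b i))) \<le> (\<Sum>i<N. M * dist (c (a i)) (c (b i)))"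
    proof (rule sum_mono)
      fix i assume "i \<in> {..<N}"
      then have "s \<le> a i \<and> a i \<le> b i \<and> b i \<le> t"
        using ab by simp
      then show "dist (f (a i)) (f (b i)) \<le> M * dist (c (a i)) (c (b i))"
        by (intro KM) auto
    qed
    ultimately show "(\<Sum>i<N. dist (f (a i)) (f (b i))) < e"
      by (simp add: sum_distrib_left)
  qed
qed

lemma abs_continuous_on_id: "abs_continuous_on s t (\<lambda>x. x :: real)"
  unfolding abs_continuous_on_def
proof (intro allI impI)
  fix e :: real assume e: "e > 0"
  show "\<exists>\<delta>>0. \<forall>(N::nat) a b.
        (\<forall>i<N. s \<le> a i \<and> a i \<le> b i \<and> b i \<le> t) \<and>
        disjoint_family_on (\<lambda>i. {a i<..<b i}) {..<N} \<and>
        (\<Sum>i<N. b i - a i) < \<delta> \<longrightarrow> (\<Sum>i<N. dist (a i) (b i)) < e"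
  proof (intro exI[of _ e] conjI e allI impI)
    fix N :: nat and a b :: "nat \<Rightarrow> real"
    assume ab: "(\<forall>i<N. s \<le> a i \<and> a i \<le> b i \<and> b i \<le> t) \<and>
        disjoint_family_on (\<lambda>i. {a i<..<b i}) {..<N} \<and> (\<Sum>i<N. b i - a i) < e"
    then have "(\<Sum>i<N. dist (a i) (b i)) = (\<Sum>i<N. b i - a i)"
      by (intro sum.cong) (auto simp: dist_real_def)
    with ab show "(\<Sum>i<N. dist (a i) (b i)) < e"
      by simp
  qed
qed

text \<open>
  The Henstock-Kurzweil integral makes this direct: around points of \<open>N\<close> the gauge is a small open
  neighbourhood of \<open>N\<close>, where absolute continuity bounds the increments of \<open>h\<close>.
\<close>

lemma abs_continuous_has_integral:
  fixes h :: "real \<Rightarrow> real"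
  assumes ac: "abs_continuous_on 0 1 h" and N: "negligible N"
    and f: "\<And>t. t \<in> {0..1} \<Longrightarrow> t \<notin> N \<Longrightarrow> (h has_vector_derivative f t) (at t)"
    and fN: "\<And>t. t \<in> N \<Longrightarrow> f t = 0"
  shows "(f has_integral (h 1 - h 0)) {0..1}"
  unfolding has_integral_real
proof (intro allI impI)
  fix e :: real assume e: "e > 0"
  then have e2: "e / 2 > 0"
    by simp
  obtain \<delta> where \<delta>: "\<delta> > 0" and small: "\<forall>(I :: (real \<times> real set) set) a b. finite I \<and>
    (\<forall>i\<in>I. 0 \<le> a i \<and> a i \<le> b i \<and> b i \<le> 1) \<and>
    disjoint_family_on (\<lambda>i. {a i<..<b i}) I \<and> (\<Sum>i\<in>I. b i - a i) < \<delta> \<longrightarrow>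
    (\<Sum>i\<in>I. dist (h (a i)) (h (b i))) < e / 2"
    using abs_continuous_on_finite_family[OF ac e2] by (elim exE conjE)
  have Nnull: "N \<in> null_sets lebesgue"
    using N by (simp add: negligible_iff_null_sets)
  then have "N \<in> sets lebesgue"
    by auto
  from sets_lebesgue_outer_open[OF this \<delta>] obtain U where
    U: "open U" "N \<subseteq> U" "(U - N) \<in> lmeasurable" "emeasure lebesgue (U - N) < ennreal \<delta>" .
  have Um: "emeasure lebesgue U < ennreal \<delta>"
    using U(4) emeasure_Diff_null_set[OF Nnull, of U] U(1) by simp
  have "\<exists>d>0. \<forall>y. \<bar>y - x\<bar> < d \<longrightarrow> \<bar>h y - h x - (y - x) * f x\<bar> \<le> e / 4 * \<bar>y - x\<bar>"
    if "x \<in> {0..1}" "x \<notin> N" for x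
  proof -
    have "\<forall>e>0. \<exists>d>0. \<forall>y. norm (y - x) < d \<longrightarrow> norm (h y - h x - (y - x) *\<^sub>R f x) \<le> e * norm (y - x)"
      using f[OF that] unfolding has_vector_derivative_def has_derivative_at_alt by (rule conjunct2)
    from this[rule_format, of "e / 4"] e show ?thesis
      by simp
  qed
  then obtain d where d: "\<And>x. x \<in> {0..1} \<Longrightarrow> x \<notin> N \<Longrightarrow> d x > 0"
    "\<And>x y. x \<in> {0..1} \<Longrightarrow> x \<notin> N \<Longrightarrow> \<bar>y - x\<bar> < d x \<Longrightarrow> \<bar>h y - h x - (y - x) * f x\<bar> \<le> e / 4 * \<bar>y - x\<bar>"
    by metis
  define \<gamma> where "\<gamma> x = (if x \<in> N then U else if x \<in> {0..1} then ball x (d x) else UNIV)" for x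
  have "gauge \<gamma>"
    unfolding gauge_def \<gamma>_def using U d by auto
  moreover have "norm ((\<Sum>(x, k)\<in>D. measure lborel k *\<^sub>R f x) - (h 1 - h 0)) < e"
    if D: "D tagged_division_of {0..1}" and fine: "\<gamma> fine D" for D
  proof -
    note tD = tagged_division_ofD[OF D]
    have iv: "K = {Inf K..Sup K} \<and> Inf K \<le> x \<and> x \<le> Sup K \<and> 0 \<le> Inf K \<and> Sup K \<le> 1" if mem: "(x, K) \<in> D" for x K
    proof -
      obtain a b where "K = cbox a b"
        using tD(4)[OF mem] by blast
      moreover have "x \<in> K" "K \<subseteq> {0..1}"
        using tD(2,3)[OF mem] by auto
      ultimately show ?thesis
        by (auto simp: subset_iff)
    qed
    define A where "A = {q\<in>D. fst q \<in> N}"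
    define F where "F q = measure lborel (snd q) * f (fst q) - (h (Sup (snd q)) - h (Inf (snd q)))" for q
    have fin: "finite D" "finite A"
      using tD(1) by (auto simp: A_def)
    have "(\<Sum>(x, k)\<in>D. measure lborel k *\<^sub>R f x) - (h 1 - h 0) = (\<Sum>q\<in>D. F q)"
      using additive_tagged_division_1[OF _ D, of h]
      by (simp add: F_def sum_subtractf case_prod_unfold)
    also have "\<dots> = (\<Sum>q\<in>D - A. F q) + (\<Sum>q\<in>A. F q)"
      using fin by (intro sum.subset_diff) (auto simp: A_def)
    finally have split: "norm ((\<Sum>(x, k)\<in>D. measure lborel k *\<^sub>R f x) - (h 1 - h 0))
        \<le> norm (\<Sum>q\<in>D - A. F q) + norm (\<Sum>q\<in>A. F q)"
      by (simp add: norm_triangle_ineq)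
    \<comment> \<open>At a tag where \<open>h\<close> is differentiable the increment differs from
      the Riemann term by at most \<open>e / 4\<close> times the length, in total
      \<open>e / 4\<close>. At tags in \<open>N\<close> the Riemann term is 0, and the increments
      sum to less than \<open>e / 2\<close>.\<close>
    have "norm (\<Sum>q\<in>D - A. F q) \<le> (\<Sum>q\<in>D - A. e / 4 * measure lborel (snd q))"
    proof (rule sum_norm_le)
      fix q assume q: "q \<in> D - A"
      obtain x K where xK: "q = (x, K)"
        by (cases q)
      then have xD: "(x, K) \<in> D" "x \<notin> N"
        using q by (auto simp: A_def)
      define u v where "u = Inf K" and "v = Sup K"
      have uv: "K = {u..v}" "u \<le> x" "x \<le> v" "x \<in> {0..1}"
        using iv[OF xD(1)] by (auto simp: u_def v_def)
      have "K \<subseteq> ball x (d x)"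
        using fineD[OF fine xD(1)] xD(2) uv(4) by (simp add: \<gamma>_def)
      moreover have "u \<in> K" "v \<in> K"
        using uv(1,2,3) by auto
      ultimately have "u \<in> ball x (d x)" "v \<in> ball x (d x)"
        by auto
      then have "\<bar>u - x\<bar> < d x" "\<bar>v - x\<bar> < d x"
        by (simp_all add: dist_real_def abs_minus_commute)
      from d(2)[OF uv(4) xD(2) this(1)] d(2)[OF uv(4) xD(2) this(2)]
      have "\<bar>h u - h x - (u - x) * f x\<bar> \<le> e / 4 * (x - u)" "\<bar>h v - h x - (v - x) * f x\<bar> \<le> e / 4 * (v - x)"
        using uv by auto
      moreover have "F q = (h u - h x - (u - x) * f x) - (h v - h x - (v - x) * f x)"
        using uv by (simp add: F_def xK u_def[symmetric] v_def[symmetric]) (simp add: uv(1) algebra_simps)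
      moreover have "measure lborel (snd q) = v - u"
        using uv by (simp add: xK)
      moreover have "e / 4 * (x - u) + e / 4 * (v - x) = e / 4 * (v - u)"
        by (simp only: distrib_left[symmetric]) simp
      ultimately show "norm (F q) \<le> e / 4 * measure lborel (snd q)"
        by (simp only: real_norm_def)
    qed
    also have "\<dots> \<le> (\<Sum>q\<in>D. e / 4 * measure lborel (snd q))"
      using fin e by (intro sum_mono2) auto
    also have "\<dots> = e / 4 * (\<Sum>q\<in>D. measure lborel (snd q))"
      by (rule sum_distrib_left[symmetric])
    also have "(\<Sum>q\<in>D. measure lborel (snd q)) = 1"
      using additive_content_tagged_division[of D 0 1] D by (simp add: case_prod_unfold)
    finally have b1: "norm (\<Sum>q\<in>D - A. F q) \<le> e / 4"
      by simp
    define a b where "a q = Inf (snd q)" and "b q = Sup (snd q)" for q :: "real \<times> real set"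
    have Aiv: "snd q = {a q..b q}" "a q \<le> b q" "0 \<le> a q" "b q \<le> 1" if "q \<in> A" for q
      using iv[of "fst q" "snd q"] that by (auto simp: A_def a_def b_def)
    have dj: "disjoint_family_on (\<lambda>q. {a q<..<b q}) A"
      unfolding disjoint_family_on_def
    proof (intro ballI impI)
      fix q r assume qr: "q \<in> A" "r \<in> A" "q \<noteq> r"
      then have "interior (snd q) \<inter> interior (snd r) = {}"
        using tD(5)[of "fst q" "snd q" "fst r" "snd r"] by (auto simp: A_def)
      then show "{a q<..<b q} \<inter> {a r<..<b r} = {}"
        unfolding Aiv(1)[OF qr(1)] Aiv(1)[OF qr(2)] by simp
    qed
    have "ennreal (\<Sum>q\<in>A. b q - a q) = (\<Sum>q\<in>A. ennreal (b q - a q))"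
      by (rule sum_ennreal[symmetric]) (use Aiv(2) in simp)
    also have "\<dots> = (\<Sum>q\<in>A. emeasure lebesgue {a q<..<b q})"
      by (rule sum.cong) (use Aiv(2) in simp_all)
    also have "\<dots> = emeasure lebesgue (\<Union>q\<in>A. {a q<..<b q})"
      using dj fin by (intro sum_emeasure) auto
    also have "\<dots> \<le> emeasure lebesgue U"
    proof (rule emeasure_mono)
      show "(\<Union>q\<in>A. {a q<..<b q}) \<subseteq> U"
      proof safe
        fix x K t assume q: "(x, K) \<in> A" and t: "t \<in> {a (x, K)<..<b (x, K)}"
        have "K \<subseteq> U"
          using fineD[OF fine, of x K] q by (auto simp: A_def \<gamma>_def)
        then show "t \<in> U"
          using Aiv(1)[OF q] t by auto
      qed
    qed (use U(1) in auto)
    also have "\<dots> < ennreal \<delta>"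
      by (rule Um)
    finally have "(\<Sum>q\<in>A. b q - a q) < \<delta>"
      using \<delta> by (simp add: ennreal_less_iff sum_nonneg Aiv(2))
    then have "(\<Sum>q\<in>A. dist (h (a q)) (h (b q))) < e / 2"
      using Aiv dj fin by (intro small[rule_format] conjI) auto
    moreover have "norm (\<Sum>q\<in>A. F q) \<le> (\<Sum>q\<in>A. dist (h (a q)) (h (b q)))"
      by (rule sum_norm_le) (use fN in \<open>auto simp: A_def F_def a_def b_def dist_real_def\<close>)
    ultimately show ?thesis
      using split b1 e by linarith
  qed
  ultimately show "\<exists>\<gamma>. gauge \<gamma> \<and> (\<forall>D. D tagged_division_of {0..1} \<and> \<gamma> fine D \<longrightarrow>
      norm ((\<Sum>(x, k)\<in>D. measure lborel k *\<^sub>R f x) - (h 1 - h 0)) < e)"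
    by (intro exI[of _ \<gamma>]) simp
qed

text \<open>\<open>w\<close> will be the speed of an arbitrary horizontal path, whose measurability
  is not at hand. The derivative, changed to 0 on a null set, is Henstock-Kurzweil integrable and
  hence measurable; its positive part lies below \<open>w\<close> and carries the estimate.\<close>

lemma abs_continuous_increment_le:
  fixes h :: "real \<Rightarrow> real" and w :: "real \<Rightarrow> ennreal"
  assumes ac: "abs_continuous_on 0 1 h"
    and AE: "AE t in lebesgue_on {0..1}. (h has_vector_derivative f t) (at t) \<and> ennreal (f t) \<le> w t"
  shows "ennreal (h 1 - h 0) \<le> (\<integral>\<^sup>+ t. w t \<partial>lebesgue_on {0..1})"
proof -
  obtain N where N: "N \<in> null_sets (lebesgue_on {0..1})"
    and good: "\<And>t. t \<in> {0..1} \<Longrightarrow> t \<notin> N \<Longrightarrow> (h has_vector_derivative f t) (at t) \<and> ennreal (f t) \<le> w t"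
    using AE unfolding eventually_ae_filter by auto
  have "N \<in> null_sets lebesgue"
    using N by (simp add: null_sets_restrict_space)
  then have neg: "negligible N"
    by (simp add: negligible_iff_null_sets)
  define f0 where "f0 t = (if t \<in> N then 0 else f t)" for t
  have int: "(f0 has_integral (h 1 - h 0)) {0..1}"
    by (rule abs_continuous_has_integral[OF ac neg]) (use good in \<open>auto simp: f0_def\<close>)
  define p where "p t = max 0 (f0 t)" for t
  have "f0 \<in> borel_measurable (lebesgue_on {0..1})"
    using int by (intro integrable_imp_measurable) (auto simp: integrable_on_def)
  then have pm: "p \<in> borel_measurable (lebesgue_on {0..1})"
    unfolding p_def by measurable
  have le: "(\<integral>\<^sup>+ t. ennreal (p t) \<partial>lebesgue_on {0..1}) \<le> (\<integral>\<^sup>+ t. w t \<partial>lebesgue_on {0..1})"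
  proof (rule nn_integral_mono)
    fix t assume "t \<in> space (lebesgue_on {0..1::real})"
    then show "ennreal (p t) \<le> w t"
      using good[of t] by (auto simp: p_def f0_def max_def ennreal_neg)
  qed
  show ?thesis
  proof (cases "(\<integral>\<^sup>+ t. ennreal (p t) \<partial>lebesgue_on {0..1}) < \<infinity>")
    case False
    then show ?thesis
      using le by (simp add: top_unique not_less)
  next
    case True
    then have pint: "integrable (lebesgue_on {0..1}) p"
      using pm by (intro integrableI_nonneg) (auto simp: p_def)
    have "h 1 - h 0 = integral {0..1} f0"
      using int by (simp add: integral_unique)
    also have "\<dots> \<le> integral {0..1} p"
      using int integrable_on_lebesgue_on[OF pint]
      by (intro integral_le) (auto simp: integrable_on_def p_def)
    also have "\<dots> = integral\<^sup>L (lebesgue_on {0..1}) p"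
      using lebesgue_integral_eq_integral[OF pint] by simp
    finally have "ennreal (h 1 - h 0) \<le> ennreal (integral\<^sup>L (lebesgue_on {0..1}) p)"
      by (rule ennreal_leI)
    also have "\<dots> = (\<integral>\<^sup>+ t. ennreal (p t) \<partial>lebesgue_on {0..1})"
      by (rule nn_integral_eq_integral[symmetric, OF pint]) (simp add: p_def)
    finally show ?thesis
      using le by simp
  qed
qed

section \<open>Estimates for the Carnot-Caratheodory distance\<close>

context popp_coordinates
begin

definition \<Omega> :: "real^('n + 'n) \<Rightarrow> real^('n + 'n) \<Rightarrow> real" where
  "\<Omega> x y = (\<Sum>i\<in>UNIV. \<Sum>j\<in>UNIV. \<omega> i j * x $ i * y $ j)"

lemma bracket_\<Omega>: "heis_bracket p q = \<Omega> (P p) (P q) *\<^sub>R Z"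
  by (simp add: bracket \<Omega>_def)

lemma Z_nonzero: "Z \<noteq> 0"
  using zZ linear_0[OF linz] by (metis zero_neq_one)

lemma \<Omega>_anticommute: "\<Omega> y x = - \<Omega> x y"
proof -
  have "\<Omega> y x *\<^sub>R Z = - (\<Omega> x y *\<^sub>R Z)"
    using heis_bracket_anticommute[of "J y" "J x"] by (simp add: bracket_\<Omega>)
  then have "z (\<Omega> y x *\<^sub>R Z) = z ((- \<Omega> x y) *\<^sub>R Z)"
    by simp
  then show ?thesis
    by (simp only: linear_scale[OF linz] zZ) simp
qed

lemma \<Omega>_add: "\<Omega> (x + y) w = \<Omega> x w + \<Omega> y w" "\<Omega> w (x + y) = \<Omega> w x + \<Omega> w y"
  and \<Omega>_scale: "\<Omega> (r *\<^sub>R x) w = r * \<Omega> x w" "\<Omega> w (r *\<^sub>R x) = r * \<Omega> w x"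
  by (simp_all add: \<Omega>_def algebra_simps sum.distrib sum_distrib_left)

lemma \<Omega>_self: "\<Omega> x x = 0"
  using \<Omega>_anticommute[of x x] by simp

lemma \<Omega>_axis: "\<Omega> (axis i 1) (axis j 1) = \<omega> i j"
proof -
  have "\<omega> k l * axis i 1 $ k * axis j 1 $ l = (if l = j then (if k = i then \<omega> i j else 0) else 0)" for k l
    by (simp add: axis_def)
  then show ?thesis
    by (simp add: \<Omega>_def)
qed

lemma P_mult: "P (heis_mult p q) = P p + P q"
  by (simp add: heis_mult_def bracket_\<Omega> linear_add[OF linP] linear_scale[OF linP])

lemma P_left_diff: "P (left_diff p v) = P v"
  by (simp add: left_diff_eq bracket_\<Omega> linear_add[OF linP] linear_scale[OF linP])

lemma metric_at_left_diff:
  assumes "v \<in> V" shows "metric_at g p (left_diff p v) (left_diff p v) = (norm (P v))\<^sup>2"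
proof -
  have "left_diff (- p) (left_diff p v) = v"
    by (simp add: left_diff_eq)
  then show ?thesis
    using g_norm[of "P v"] VJ[OF assms] by (simp add: metric_at_def left_diff_inv)
qed

text \<open>Taking the component in the direction \<open>u\<close> of the total displacement reduces
  the claim to a real function. Its derivative is at most the speed of the path, since on
  \<open>V\<close> the norm of \<open>g\<close> is the Euclidean norm of the projection.\<close>

lemma path_length_ge:
  assumes c: "horizontal_path V c"
  shows "ennreal (norm (P (c 1) - P (c 0))) \<le> path_length g c"
proof (cases "P (c 1) = P (c 0)")
  case False
  define v where "v = P (c 1) - P (c 0)"
  define u where "u = v /\<^sub>R norm v"
  have v: "norm v > 0" and u: "norm u = 1" "u \<bullet> v = norm v"
    using False by (simp_all add: v_def u_def dot_square_norm power2_eq_square)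
  have blP: "bounded_linear P"
    using linP by (simp add: linear_linear)
  have bl: "bounded_linear (\<lambda>p. u \<bullet> P p)"
    using bounded_linear_compose[OF bounded_linear_inner_right blP] .
  have ac: "abs_continuous_on 0 1 (\<lambda>t. u \<bullet> P (c t))"
  proof (rule abs_continuous_on_dominated)
    show "abs_continuous_on 0 1 c"
      using c by (simp add: horizontal_path_def)
    fix s t
    have "dist (u \<bullet> P (c s)) (u \<bullet> P (c t)) = \<bar>u \<bullet> P (c s - c t)\<bar>"
      by (simp add: dist_real_def linear_diff[OF linP] inner_diff_right)
    also have "\<dots> \<le> norm u * norm (P (c s - c t))"
      by (rule Cauchy_Schwarz_ineq2)
    also have "\<dots> \<le> onorm P * norm (c s - c t)"
      using onorm[OF blP, of "c s - c t"] u by simp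
    finally show "dist (u \<bullet> P (c s)) (u \<bullet> P (c t)) \<le> onorm P * dist (c s) (c t)"
      by (simp add: dist_norm)
  qed
  have "AE t in lebesgue_on {0..1}. \<exists>w. (c has_vector_derivative w) (at t) \<and> w \<in> distribution_at V (c t)"
    using c by (simp add: horizontal_path_def)
  then have "AE t in lebesgue_on {0..1}.
      ((\<lambda>t. u \<bullet> P (c t)) has_vector_derivative u \<bullet> P (vector_derivative c (at t))) (at t) \<and>
      ennreal (u \<bullet> P (vector_derivative c (at t)))
        \<le> ennreal (sqrt (metric_at g (c t) (vector_derivative c (at t)) (vector_derivative c (at t))))"
  proof (rule eventually_mono)
    fix t assume "\<exists>w. (c has_vector_derivative w) (at t) \<and> w \<in> distribution_at V (c t)"
    then obtain w y where w: "(c has_vector_derivative w) (at t)" "y \<in> V" "w = left_diff (c t) y"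
      unfolding distribution_at_def by blast
    have vd: "vector_derivative c (at t) = w"
      by (rule vector_derivative_at[OF w(1)])
    have "u \<bullet> P w \<le> norm u * norm (P w)"
      by (rule norm_cauchy_schwarz)
    also have "\<dots> = sqrt (metric_at g (c t) w w)"
      using u w metric_at_left_diff[OF w(2), of "c t"] by (simp add: P_left_diff)
    finally show "((\<lambda>t. u \<bullet> P (c t)) has_vector_derivative u \<bullet> P (vector_derivative c (at t))) (at t) \<and>
        ennreal (u \<bullet> P (vector_derivative c (at t)))
        \<le> ennreal (sqrt (metric_at g (c t) (vector_derivative c (at t)) (vector_derivative c (at t))))"
      unfolding vd using bounded_linear.has_vector_derivative[OF bl w(1)] by (simp add: ennreal_leI)
  qed
  from abs_continuous_increment_le[OF ac this]
  have "ennreal (u \<bullet> P (c 1) - u \<bullet> P (c 0)) \<le> path_length g c"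
    by (simp add: path_length_def)
  moreover have "u \<bullet> P (c 1) - u \<bullet> P (c 0) = norm (P (c 1) - P (c 0))"
    using u by (simp add: v_def inner_diff_right)
  ultimately show ?thesis
    by simp
qed simp

text \<open>
  The horizontal lift of \<open>t x\<close> plus a closed curve in a coordinate plane: the latter has mean 0, so that
  it does not interact with \<open>t x\<close>, and encloses the area \<open>- a b / 70\<close>.
\<close>

lemma horizontal_path_exists:
  assumes ij: "\<omega> i j \<noteq> 0"
  shows "\<exists>c. horizontal_path V c \<and> c 0 = p \<and> c 1 = heis_mult p (J x + w *\<^sub>R Z) \<and>
    path_length g c \<le> ennreal (norm x + 126 * sqrt (70 * \<bar>w\<bar> / \<bar>\<omega> i j\<bar>))"
proof -
  \<comment> \<open>The height \<open>- a b / 70\<close> times \<open>\<omega> i j\<close> must be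
    \<open>w\<close>; the sign goes into \<open>b\<close>, and equal sizes of \<open>a\<close> and
    \<open>b\<close> keep the length of order \<open>sqrt \<bar>w\<bar>\<close>.\<close>
  define s where "s = sqrt (70 * \<bar>w\<bar> / \<bar>\<omega> i j\<bar>)"
  define a where "a = s"
  define b where "b = - (sgn (w * \<omega> i j) * s)"
  have s: "s \<ge> 0" "s * s = 70 * \<bar>w\<bar> / \<bar>\<omega> i j\<bar>"
    by (simp_all add: s_def)
  have ab: "- (a * b * \<omega> i j / 70) = w"
  proof -
    have "- (a * b * \<omega> i j / 70) = sgn w * (sgn (\<omega> i j) * \<omega> i j) * (s * s) / 70"
      by (simp add: a_def b_def sgn_mult)
    also have "sgn (\<omega> i j) * \<omega> i j = \<bar>\<omega> i j\<bar>"
      by (simp add: sgn_if)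
    also have "sgn w * \<bar>\<omega> i j\<bar> * (s * s) / 70 = sgn w * \<bar>w\<bar>"
      unfolding s(2) using ij by simp
    also have "\<dots> = w"
      by (simp add: sgn_if)
    finally show ?thesis .
  qed
  have b_le: "\<bar>a\<bar> \<le> s" "\<bar>b\<bar> \<le> s"
    using s by (auto simp: a_def b_def abs_mult sgn_if)
  \<comment> \<open>Both polynomials vanish at 0 and 1 and have mean 0. Primes mark derivatives,
    \<open>I\<alpha>\<close> and \<open>I\<beta>\<close> are primitives that vanish at 0 and 1, and
    \<open>K\<close> is the primitive of \<open>\<alpha> \<beta>' - \<beta> \<alpha>'\<close>. The
    value of \<open>K\<close> at 1 is \<open>- 1 / 35\<close>, twice the signed area.\<close>
  define \<alpha> \<beta> where "\<alpha> t = t - 3 * t^2 + 2 * t^3" and "\<beta> t = t - 6 * t^2 + 10 * t^3 - 5 * t^4" for t :: real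
  define \<alpha>' \<beta>' where "\<alpha>' t = 1 - 6 * t + 6 * t^2" and "\<beta>' t = 1 - 12 * t + 30 * t^2 - 20 * t^3" for t :: real
  define I\<alpha> I\<beta> K where "I\<alpha> t = t^2 / 2 - t^3 + t^4 / 2" and "I\<beta> t = t^2 / 2 - 2 * t^3 + 5/2 * t^4 - t^5"
    and "K t = 4 * t^4 - t^3 - 33/5 * t^5 + 5 * t^6 - 10/7 * t^7" for t :: real
  define X where "X t = t *\<^sub>R x + (a * \<alpha> t) *\<^sub>R axis i 1 + (b * \<beta> t) *\<^sub>R axis j 1" for t
  define X' where "X' t = x + (a * \<alpha>' t) *\<^sub>R axis i 1 + (b * \<beta>' t) *\<^sub>R axis j 1" for t
  define p1 p2 where "p1 = \<Omega> x (axis i 1)" and "p2 = \<Omega> x (axis j 1)"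
  \<comment> \<open>The central coordinate, with derivative half of
    \<open>\<Omega> (X t) (X' t)\<close>, which is exactly the condition for the lift to be
    horizontal. The terms in \<open>x\<close> come from integrating
    \<open>t \<alpha>' - \<alpha>\<close> by parts to \<open>t \<alpha> - 2 I\<alpha>\<close>, and
    vanish at 1.\<close>
  define \<zeta> where "\<zeta> t = (a * (t * \<alpha> t - 2 * I\<alpha> t) * p1 + b * (t * \<beta> t - 2 * I\<beta> t) * p2 + a * b * K t * \<omega> i j) / 2" for t
  define \<zeta>' where "\<zeta>' t = (a * (t * \<alpha>' t - \<alpha> t) * p1 + b * (t * \<beta>' t - \<beta> t) * p2
      + a * b * (\<alpha> t * \<beta>' t - \<beta> t * \<alpha>' t) * \<omega> i j) / 2" for t
  have \<omega>ji: "\<omega> j i = - \<omega> i j"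
    using \<Omega>_anticommute[of "axis j 1" "axis i 1"] by (simp add: \<Omega>_axis)
  have \<Omega>X: "\<Omega> (X t) (X' t) = 2 * \<zeta>' t" for t
    unfolding X_def X'_def \<zeta>'_def
    by (simp add: \<Omega>_add \<Omega>_scale \<Omega>_self \<Omega>_axis \<Omega>_anticommute[of "axis _ 1" x] \<omega>ji
        p1_def[symmetric] p2_def[symmetric] algebra_simps)
  have d\<alpha>: "(\<alpha> has_real_derivative \<alpha>' t) (at t)" and d\<beta>: "(\<beta> has_real_derivative \<beta>' t) (at t)"
    and dA: "(I\<alpha> has_real_derivative \<alpha> t) (at t)" and dB: "(I\<beta> has_real_derivative \<beta> t) (at t)" for t
    unfolding \<alpha>_def[abs_def] \<beta>_def[abs_def] \<alpha>'_def \<beta>'_def I\<alpha>_def[abs_def] I\<beta>_def[abs_def]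
    by (auto intro!: derivative_eq_intros simp: field_simps power2_eq_square power3_eq_cube power4_eq_xxxx)
  have dC: "(K has_real_derivative (\<alpha> t * \<beta>' t - \<beta> t * \<alpha>' t)) (at t)" for t
    unfolding \<alpha>_def \<beta>_def \<alpha>'_def \<beta>'_def K_def[abs_def]
    by (rule derivative_eq_intros refl | simp)+ (simp add: algebra_simps power_numeral_reduce)
  have dX: "(X has_vector_derivative X' t) (at t)" for t
    unfolding X_def[abs_def] X'_def
    by (auto intro!: derivative_eq_intros d\<alpha> d\<beta> simp: mult.commute has_real_derivative_iff_has_vector_derivative[symmetric])
  have d\<zeta>: "(\<zeta> has_real_derivative \<zeta>' t) (at t)" for t
    unfolding \<zeta>_def[abs_def] \<zeta>'_def
    by (auto intro!: derivative_eq_intros d\<alpha> d\<beta> dA dB dC simp: field_simps)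
  define c where "c t = heis_mult p (J (X t) + \<zeta> t *\<^sub>R Z)" for t
  define c' where "c' t = left_diff p (J (X' t) + \<zeta>' t *\<^sub>R Z)" for t
  have bl: "bounded_linear J" "bounded_linear (left_diff p)"
    using linJ linear_left_diff by (simp_all add: linear_linear)
  have dc: "(c has_vector_derivative c' t) (at t)" for t
  proof -
    have "((\<lambda>t. J (X t) + \<zeta> t *\<^sub>R Z) has_vector_derivative J (X' t) + \<zeta>' t *\<^sub>R Z) (at t)"
      by (intro has_vector_derivative_add bounded_linear.has_vector_derivative[OF bl(1)] dX)
         (use d\<zeta> in \<open>auto intro!: derivative_eq_intros simp: has_real_derivative_iff_has_vector_derivative[symmetric]\<close>)
    from bounded_linear.has_vector_derivative[OF bl(2) this]
    have "((\<lambda>t. p + left_diff p (J (X t) + \<zeta> t *\<^sub>R Z)) has_vector_derivative 0 + c' t) (at t)"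
      unfolding c'_def by (intro has_vector_derivative_add has_vector_derivative_const)
    then show ?thesis
      unfolding c_def[abs_def] by (simp add: heis_mult_def left_diff_eq add.assoc)
  qed
  have c': "c' t = left_diff (c t) (J (X' t))" for t
  proof -
    have "heis_bracket (c t) (J (X' t)) = heis_bracket p (J (X' t)) + (2 * \<zeta>' t) *\<^sub>R Z"
      unfolding bracket_\<Omega> c_def P_mult by (simp add: linear_add[OF linP] linear_scale[OF linP] \<Omega>_add \<Omega>X scaleR_add_left)
    then show ?thesis
      unfolding c'_def left_diff_eq
      by (simp add: bracket_\<Omega> linear_add[OF linP] linear_scale[OF linP] scaleR_add_right)
  qed
  have speed: "sqrt (metric_at g (c t) (vector_derivative c (at t)) (vector_derivative c (at t))) = norm (X' t)" for t
    unfolding vector_derivative_at[OF dc] c' by (simp add: metric_at_left_diff[OF JV])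
  \<comment> \<open>63 is the sum of the absolute values of the coefficients of
    \<open>\<beta>'\<close>, which also exceeds that for \<open>\<alpha>'\<close>; the two
    coordinates together give 126.\<close>
  have X'_le: "norm (X' t) \<le> norm x + 126 * s" if t: "t \<in> {0..1}" for t
  proof -
    have pw: "0 \<le> t^2" "t^2 \<le> 1" "0 \<le> t^3" "t^3 \<le> 1" "0 \<le> t" "t \<le> 1"
      using t by (auto intro: power_le_one)
    have "\<bar>\<alpha>' t\<bar> \<le> 63" "\<bar>\<beta>' t\<bar> \<le> 63"
      unfolding \<alpha>'_def \<beta>'_def using pw by linarith+
    then have "\<bar>a * \<alpha>' t\<bar> \<le> s * 63" "\<bar>b * \<beta>' t\<bar> \<le> s * 63"
      unfolding abs_mult using b_le s(1) by (intro mult_mono; simp)+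
    moreover have "norm (X' t) \<le> norm x + \<bar>a * \<alpha>' t\<bar> + \<bar>b * \<beta>' t\<bar>"
      unfolding X'_def
      using norm_triangle_ineq[of "x + (a * \<alpha>' t) *\<^sub>R axis i 1" "(b * \<beta>' t) *\<^sub>R axis j 1"]
        norm_triangle_ineq[of x "(a * \<alpha>' t) *\<^sub>R axis i 1"]
      by (simp add: norm_axis_1)
    ultimately show ?thesis
      by linarith
  qed
  have "continuous_on UNIV c'"
  proof -
    have "continuous_on UNIV (\<lambda>t. J (X' t) + \<zeta>' t *\<^sub>R Z)"
      unfolding X'_def \<zeta>'_def \<alpha>_def \<beta>_def \<alpha>'_def \<beta>'_def
      by (intro continuous_intros bounded_linear.continuous_on[OF bl(1)]) auto
    then show ?thesis
      unfolding c'_def[abs_def] by (rule bounded_linear.continuous_on[OF bl(2)])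
  qed
  then have "bounded (c' ` {0..1})"
    by (intro compact_imp_bounded compact_continuous_image) (auto intro: continuous_on_subset)
  then obtain M where M: "\<And>t. t \<in> {0..1} \<Longrightarrow> norm (c' t) \<le> M"
    unfolding bounded_iff by blast
  have "abs_continuous_on 0 1 c"
  proof (rule abs_continuous_on_dominated[OF abs_continuous_on_id])
    fix t u :: real assume tu: "t \<in> {0..1}" "u \<in> {0..1}"
    have "norm (c t - c u) \<le> M * norm (t - u)"
    proof (rule differentiable_bound[OF _ _ _ tu, where f' = "\<lambda>t h. h *\<^sub>R c' t"])
      show "(c has_derivative (\<lambda>h. h *\<^sub>R c' t)) (at t within {0..1})" for t
        using dc[of t] by (auto simp: has_vector_derivative_def intro: has_derivative_at_withinI)
      show "onorm (\<lambda>h. h *\<^sub>R c' t) \<le> M" if "t \<in> {0..1}" for t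
        using M[OF that] by (intro onorm_le) (auto simp: mult.commute[of M] intro: mult_left_mono)
    qed simp
    then show "dist (c t) (c u) \<le> M * dist t u"
      by (simp add: dist_norm)
  qed
  moreover have "AE t in lebesgue_on {0..1}. \<exists>w. (c has_vector_derivative w) (at t) \<and> w \<in> distribution_at V (c t)"
  proof (rule AE_I2)
    fix t
    have "c' t \<in> distribution_at V (c t)"
      unfolding c' distribution_at_def using JV by (rule imageI)
    with dc[of t] show "\<exists>w. (c has_vector_derivative w) (at t) \<and> w \<in> distribution_at V (c t)"
      by blast
  qed
  ultimately have "horizontal_path V c"
    by (simp add: horizontal_path_def)
  moreover have "c 0 = p"
    by (simp add: c_def X_def \<zeta>_def \<alpha>_def \<beta>_def I\<alpha>_def I\<beta>_def K_def linear_0[OF linJ])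
  moreover have "c 1 = heis_mult p (J x + w *\<^sub>R Z)"
  proof -
    have "X 1 = x"
      by (simp add: X_def \<alpha>_def \<beta>_def)
    moreover have "\<zeta> 1 = - (a * b * \<omega> i j / 70)"
      by (simp add: \<zeta>_def \<alpha>_def \<beta>_def I\<alpha>_def I\<beta>_def K_def)
    ultimately show ?thesis
      by (simp add: c_def ab)
  qed
  moreover have "path_length g c \<le> ennreal (norm x + 126 * s)"
  proof -
    have "path_length g c \<le> (\<integral>\<^sup>+ t. ennreal (norm x + 126 * s) \<partial>lebesgue_on {0..1::real})"
      unfolding path_length_def speed by (rule nn_integral_mono) (use X'_le in \<open>auto intro: ennreal_leI\<close>)
    also have "\<dots> = ennreal (norm x + 126 * s)"
      by (simp add: emeasure_restrict_space)
    finally show ?thesis .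
  qed
  ultimately show ?thesis
    unfolding s_def by blast
qed

text \<open>There are \<open>(2n)\<^sup>2\<close> entries, and their squares sum to 1. This is what
  makes the cost of moving along the centre depend on \<open>n\<close> alone.\<close>

lemma \<omega>_large:
  obtains i j where "1 / (2 * CARD('n)) \<le> \<bar>\<omega> i j\<bar>"
proof (rule ccontr)
  define N where "N = real (2 * CARD('n))"
  have N: "N > 0"
    by (simp add: N_def)
  assume "\<not> thesis"
  then have lt: "\<bar>\<omega> i j\<bar> < 1 / N" for i j
    using that unfolding N_def by (meson not_le)
  have "(\<omega> i j)\<^sup>2 < (1 / N)\<^sup>2" for i j
    using power_strict_mono[OF lt, where n = 2] by simp
  then have "(\<Sum>i\<in>UNIV. \<Sum>j\<in>UNIV. (\<omega> i j)\<^sup>2) < (\<Sum>i\<in>(UNIV :: ('n + 'n) set). \<Sum>j\<in>(UNIV :: ('n + 'n) set). (1 / N)\<^sup>2)"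
    by (intro sum_strict_mono) auto
  also have "\<dots> = N * (N * (1 / N)\<^sup>2)"
    by (simp add: N_def)
  also have "\<dots> = 1"
    using N by (simp add: power2_eq_square)
  finally show False
    using \<omega>_norm by simp
qed

text \<open>The lower bound is \<open>path_length_ge\<close>. The upper bound uses the path in the
  coordinate plane of a large entry of \<open>\<omega>\<close>, whence the constant
  \<open>140 n = 70 * 2n\<close>.\<close>

lemma cc_dist_bounds:
  fixes w :: real
  shows "norm (P q - P p) \<le> cc_dist V g p q"
    and "cc_dist V g p (heis_mult p (J x + w *\<^sub>R Z)) \<le> norm x + 126 * sqrt (140 * CARD('n) * \<bar>w\<bar>)"
proof -
  obtain i j where ij: "1 / (2 * CARD('n)) \<le> \<bar>\<omega> i j\<bar>"
    by (rule \<omega>_large)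
  have ij0: "\<bar>\<omega> i j\<bar> > 0"
    by (rule less_le_trans[OF _ ij]) simp
  then have ij1: "\<omega> i j \<noteq> 0"
    by simp
  let ?C = "\<lambda>q. {c. horizontal_path V c \<and> c 0 = p \<and> c 1 = q}"
  have bound: "70 * \<bar>w\<bar> / \<bar>\<omega> i j\<bar> \<le> 140 * CARD('n) * \<bar>w\<bar>" for w :: real
  proof -
    have "1 \<le> 2 * CARD('n) * \<bar>\<omega> i j\<bar>"
      using ij by (simp add: field_simps)
    then have "70 * \<bar>w\<bar> * 1 \<le> 70 * \<bar>w\<bar> * (2 * CARD('n) * \<bar>\<omega> i j\<bar>)"
      by (intro mult_left_mono) auto
    then show ?thesis
      using ij0 by (simp add: divide_le_eq mult.assoc mult.left_commute mult.commute)
  qed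
  have upper: "(INF c \<in> ?C (heis_mult p (J x + w *\<^sub>R Z)). path_length g c)
      \<le> ennreal (norm x + 126 * sqrt (140 * CARD('n) * \<bar>w\<bar>))" for x and w :: real
  proof -
    obtain c where "horizontal_path V c" "c 0 = p" "c 1 = heis_mult p (J x + w *\<^sub>R Z)"
      and c2: "path_length g c \<le> ennreal (norm x + 126 * sqrt (70 * \<bar>w\<bar> / \<bar>\<omega> i j\<bar>))"
      using horizontal_path_exists[OF ij1, of p x w] by (elim exE conjE)
    then have c: "c \<in> ?C (heis_mult p (J x + w *\<^sub>R Z))"
      by simp
    have "(INF c \<in> ?C (heis_mult p (J x + w *\<^sub>R Z)). path_length g c) \<le> path_length g c"
      by (rule INF_lower[OF c])
    also note c2
    also have "ennreal (norm x + 126 * sqrt (70 * \<bar>w\<bar> / \<bar>\<omega> i j\<bar>)) \<le> ennreal (norm x + 126 * sqrt (140 * CARD('n) * \<bar>w\<bar>))"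
      by (intro ennreal_leI add_left_mono mult_left_mono real_sqrt_le_mono bound) simp
    finally show ?thesis .
  qed
  then show "cc_dist V g p (heis_mult p (J x + w *\<^sub>R Z)) \<le> norm x + 126 * sqrt (140 * CARD('n) * \<bar>w\<bar>)"
    unfolding cc_dist_def by (intro enn2real_leI) auto
  \<comment> \<open>The upper bound applied to the displacement from \<open>p\<close> to
    \<open>q\<close> shows that the infimum is finite; therefore \<open>enn2real\<close> preserves
    the lower bound.\<close>
  define r where "r = heis_mult (- p) q"
  have "heis_mult p (J (P r) + z r *\<^sub>R Z) = q"
    unfolding decomp[of r, symmetric] by (simp add: r_def)
  from upper[of "P r" "z r", unfolded this]
  have fin: "(INF c \<in> ?C q. path_length g c) < (\<infinity>::ennreal)"
    unfolding infinity_ennreal_def by (rule le_less_trans[OF _ ennreal_less_top])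
  have "ennreal (norm (P q - P p)) \<le> (INF c \<in> ?C q. path_length g c)"
    by (rule INF_greatest) (use path_length_ge in auto)
  from enn2real_mono[OF this fin[unfolded infinity_ennreal_def]] show "norm (P q - P p) \<le> cc_dist V g p q"
    by (simp add: cc_dist_def)
qed

end

section \<open>Compact quotients with bounded diameter\<close>

lemma quotient_dist_le:
  assumes "\<And>a b. 0 \<le> d a b" "a \<in> A" "b \<in> B"
  shows "quotient_dist d A B \<le> d a b"
  unfolding quotient_dist_def
proof (rule order_trans)
  show "(INF (a, b) \<in> A \<times> B. d a b) \<le> (case (a, b) of (a, b) \<Rightarrow> d a b)"
    using assms by (intro cINF_lower bdd_belowI[of _ 0]) auto
qed simp

lemma quotient_dist_ge:
  assumes "A \<noteq> {}" "B \<noteq> {}" "\<And>a b. a \<in> A \<Longrightarrow> b \<in> B \<Longrightarrow> r \<le> d a b"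
  shows "r \<le> quotient_dist d A B"
  unfolding quotient_dist_def using assms by (intro cINF_greatest) auto

locale popp_quotient = popp_coordinates V g P z J Z \<omega>
  for V :: "'n::finite heis set" and g P z J Z \<omega> +
  fixes \<Gamma> :: "'n heis set" and D :: real
  assumes \<Gamma>: "heis_subgroup \<Gamma>" "discrete \<Gamma>" and D: "D > 0"
    and diam: "quotient_dist (cc_dist V g) (heis_coset \<Gamma> p) (heis_coset \<Gamma> q) \<le> D"
begin

lemma zero_\<Gamma>: "0 \<in> \<Gamma>" and mult_\<Gamma>: "x \<in> \<Gamma> \<Longrightarrow> y \<in> \<Gamma> \<Longrightarrow> heis_mult x y \<in> \<Gamma>"
  and neg_\<Gamma>: "x \<in> \<Gamma> \<Longrightarrow> - x \<in> \<Gamma>"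
  using \<Gamma>(1) by (auto simp: heis_subgroup_def)

lemma subgroup_\<Lambda>: "vector_subgroup (P ` \<Gamma>)"
  unfolding vector_subgroup_def
proof (intro conjI ballI)
  show "0 \<in> P ` \<Gamma>"
    using zero_\<Gamma> linear_0[OF linP] by (metis imageI)
  fix x y assume "x \<in> P ` \<Gamma>" "y \<in> P ` \<Gamma>"
  then obtain a b where ab: "a \<in> \<Gamma>" "b \<in> \<Gamma>" "x = P a" "y = P b"
    by blast
  then have "P (heis_mult a (- b)) = x - y"
    by (simp add: P_mult linear_neg[OF linP])
  then show "x - y \<in> P ` \<Gamma>"
    using mult_\<Gamma>[OF ab(1) neg_\<Gamma>[OF ab(2)]] by (metis imageI)
qed

text \<open>\<open>P\<close> is a homomorphism that does not increase distances, so a change of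
  representatives moves \<open>P q - P p\<close> by an element of the projected lattice.\<close>

lemma infdist_le_quotient_dist:
  "infdist (P q - P p) (P ` \<Gamma>) \<le> quotient_dist (cc_dist V g) (heis_coset \<Gamma> p) (heis_coset \<Gamma> q)"
proof (rule quotient_dist_ge)
  show "heis_coset \<Gamma> p \<noteq> {}" "heis_coset \<Gamma> q \<noteq> {}"
    using zero_\<Gamma> by (auto simp: heis_coset_eq)
  fix a b assume "a \<in> heis_coset \<Gamma> p" "b \<in> heis_coset \<Gamma> q"
  then obtain x y where xy: "x \<in> \<Gamma>" "y \<in> \<Gamma>" "a = heis_mult x p" "b = heis_mult y q"
    by (auto simp: heis_coset_eq)
  have "infdist (P q - P p) (P ` \<Gamma>) \<le> dist (P q - P p) (P x - P y)"
    by (intro infdist_le vector_subgroup_diff[OF subgroup_\<Lambda>] imageI xy)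
  also have "\<dots> = norm (P b - P a)"
    by (simp add: xy P_mult dist_norm algebra_simps)
  also have "\<dots> \<le> cc_dist V g a b"
    by (rule cc_dist_bounds)
  finally show "infdist (P q - P p) (P ` \<Gamma>) \<le> cc_dist V g a b" .
qed

lemma infdist_\<Lambda>_le: "infdist x (P ` \<Gamma>) \<le> D"
  using infdist_le_quotient_dist[of "J x" 0] diam[of 0 "J x"] by (simp add: linear_0[OF linP])

text \<open>Passing from \<open>D\<close> to \<open>2 * D\<close> gives a strict inequality without
  the infimum having to be attained.\<close>

lemma \<Lambda>_near: obtains l where "l \<in> P ` \<Gamma>" "dist x l < 2 * D"
proof -
  have "P ` \<Gamma> \<noteq> {}"
    using zero_\<Gamma> by blast
  moreover have "infdist x (P ` \<Gamma>) < 2 * D"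
    using infdist_\<Lambda>_le[of x] D by simp
  ultimately show ?thesis
    by (rule infdist_lessD) (rule that)
qed

text \<open>The vector that represents the linear form \<open>\<Omega> x\<close>.\<close>

definition \<omega>_vec :: "real^('n + 'n) \<Rightarrow> real^('n + 'n)" where
  "\<omega>_vec x = (\<chi> j. \<Sum>i\<in>UNIV. \<omega> i j * x $ i)"

lemma \<Omega>_inner: "\<Omega> x y = \<omega>_vec x \<bullet> y"
proof -
  have "\<Omega> x y = (\<Sum>j\<in>UNIV. \<Sum>i\<in>UNIV. \<omega> i j * x $ i * y $ j)"
    unfolding \<Omega>_def by (rule sum.swap)
  then show ?thesis
    by (simp add: \<omega>_vec_def inner_vec_def sum_distrib_right)
qed

text \<open>The operator norm is at most the Hilbert-Schmidt norm, here 1: Cauchy-Schwarz for each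
  column of \<open>\<omega>\<close>.\<close>

lemma norm_\<omega>_vec: "norm (\<omega>_vec x) \<le> norm x"
proof (rule power2_le_imp_le)
  have "(norm (\<omega>_vec x))\<^sup>2 = (\<Sum>j\<in>UNIV. (\<Sum>i\<in>UNIV. \<omega> i j * x $ i)\<^sup>2)"
    unfolding power2_norm_eq_inner inner_vec_def by (simp add: \<omega>_vec_def power2_eq_square)
  also have "\<dots> \<le> (\<Sum>j\<in>UNIV. (\<Sum>i\<in>UNIV. (\<omega> i j)\<^sup>2) * (norm x)\<^sup>2)"
  proof (rule sum_mono)
    fix j
    have "(\<Sum>i\<in>UNIV. \<omega> i j * x $ i)\<^sup>2 = ((\<chi> i. \<omega> i j) \<bullet> x)\<^sup>2"
      by (simp add: inner_vec_def)
    also have "\<dots> \<le> ((\<chi> i. \<omega> i j) \<bullet> (\<chi> i. \<omega> i j)) * (x \<bullet> x)"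
      by (rule Cauchy_Schwarz_ineq)
    finally show "(\<Sum>i\<in>UNIV. \<omega> i j * x $ i)\<^sup>2 \<le> (\<Sum>i\<in>UNIV. (\<omega> i j)\<^sup>2) * (norm x)\<^sup>2"
      unfolding power2_norm_eq_inner[of x] by (simp add: inner_vec_def power2_eq_square)
  qed
  also have "\<dots> = (\<Sum>j\<in>UNIV. \<Sum>i\<in>UNIV. (\<omega> i j)\<^sup>2) * (norm x)\<^sup>2"
    by (simp add: sum_distrib_right)
  also have "(\<Sum>j\<in>UNIV. \<Sum>i\<in>UNIV. (\<omega> i j)\<^sup>2) = 1"
    using \<omega>_norm by (subst sum.swap)
  finally show "(norm (\<omega>_vec x))\<^sup>2 \<le> (norm x)\<^sup>2"
    by simp
qed simp

lemma \<Omega>_le: "\<bar>\<Omega> x y\<bar> \<le> norm x * norm y"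
  unfolding \<Omega>_inner
  by (rule order_trans[OF Cauchy_Schwarz_ineq2]) (intro mult_right_mono norm_\<omega>_vec norm_ge_zero)

text \<open>Let \<open>v\<close> have length \<open>2 * D\<close> in the direction of
  \<open>\<omega>_vec x\<close>, and let \<open>y\<close> lie in the projected lattice at distance
  less than \<open>2 * D\<close> from \<open>v\<close>. Then \<open>y\<close> is on the positive
  side of the hyperplane orthogonal to \<open>\<omega>_vec x\<close>, however short that vector is,
  and has length at most \<open>4 * D\<close>.\<close>

lemma \<Lambda>_noncommuting:
  assumes "x \<noteq> 0"
  obtains y where "y \<in> P ` \<Gamma>" "\<Omega> x y \<noteq> 0" "\<bar>\<Omega> x y\<bar> \<le> 4 * D * norm x"
proof -
  define w where "w = \<omega>_vec x"
  have "w \<noteq> 0"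
    using nondegenerate[OF assms] unfolding \<Omega>_def[symmetric] \<Omega>_inner w_def by auto
  then have nw: "norm w > 0"
    by simp
  define v where "v = (2 * D / norm w) *\<^sub>R w"
  have nv: "norm v = 2 * D"
    using nw D by (simp add: v_def)
  obtain y where y: "y \<in> P ` \<Gamma>" "dist v y < 2 * D"
    by (rule \<Lambda>_near)
  have "w \<bullet> v = 2 * D * norm w"
    using nw by (simp add: v_def dot_square_norm power2_eq_square)
  moreover have "w \<bullet> (v - y) \<le> norm w * norm (v - y)"
    by (rule norm_cauchy_schwarz)
  moreover have "norm w * norm (v - y) < norm w * (2 * D)"
    using y(2) nw by (intro mult_strict_left_mono) (simp_all add: dist_norm)
  then have "norm w * norm (v - y) < 2 * D * norm w"
    by (simp add: mult.commute)
  ultimately have "w \<bullet> y > 0"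
    by (simp add: inner_diff_right)
  moreover have "norm y \<le> 4 * D"
    using norm_triangle_ineq4[of v "v - y"] y(2) nv by (simp add: dist_norm)
  then have "\<bar>\<Omega> x y\<bar> \<le> norm x * (4 * D)"
    by (intro order_trans[OF \<Omega>_le] mult_left_mono) auto
  ultimately show ?thesis
    by (intro that[OF y(1)]) (simp_all add: \<Omega>_inner w_def mult.commute)
qed

lemma commutator_\<Gamma>:
  assumes "x \<in> P ` \<Gamma>" "y \<in> P ` \<Gamma>"
  shows "\<Omega> x y *\<^sub>R Z \<in> \<Gamma>"
proof -
  obtain a b where ab: "a \<in> \<Gamma>" "b \<in> \<Gamma>" "x = P a" "y = P b"
    using assms by blast
  have "heis_mult (heis_mult a b) (heis_mult (- a) (- b)) \<in> \<Gamma>"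
    by (intro mult_\<Gamma> neg_\<Gamma> ab)
  then show ?thesis
    by (simp add: heis_commutator bracket_\<Omega> ab)
qed

lemma center_\<Gamma>_diff: "s *\<^sub>R Z \<in> \<Gamma> \<Longrightarrow> t *\<^sub>R Z \<in> \<Gamma> \<Longrightarrow> (s - t) *\<^sub>R Z \<in> \<Gamma>"
  using mult_\<Gamma>[OF _ neg_\<Gamma>, of "s *\<^sub>R Z" "t *\<^sub>R Z"] heis_one_parameter[of s Z "- t"] by simp

lemma center_\<Gamma>_abs: "t *\<^sub>R Z \<in> \<Gamma> \<Longrightarrow> \<bar>t\<bar> *\<^sub>R Z \<in> \<Gamma>"
  using neg_\<Gamma>[of "t *\<^sub>R Z"] by (auto simp: abs_if)

lemma center_\<Gamma>_of_int:
  assumes "t *\<^sub>R Z \<in> \<Gamma>" shows "(of_int k * t) *\<^sub>R Z \<in> \<Gamma>"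
proof -
  have "vector_subgroup {s. s *\<^sub>R Z \<in> \<Gamma>}"
    unfolding vector_subgroup_def using zero_\<Gamma> center_\<Gamma>_diff by simp
  from vector_subgroup_of_int[OF this, of t k] assms show ?thesis
    by simp
qed

text \<open>Discreteness keeps the positive \<open>t\<close> with \<open>t *\<^sub>R Z\<close> in
  \<open>\<Gamma>\<close> away from 0. An \<open>l\<close> below twice their infimum is already the
  least of them: a smaller \<open>t\<close> would bring \<open>l - t\<close> along, and both would
  be at least the infimum. The last bound holds because a nontrivial commutator has height at least
  \<open>l\<close>.\<close>

lemma fibre_length_exists:
  obtains l where "l > 0" "l *\<^sub>R Z \<in> \<Gamma>" "\<And>t. t *\<^sub>R Z \<in> \<Gamma> \<Longrightarrow> \<bar>t\<bar> < l \<Longrightarrow> t = 0"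
    "\<And>x. x \<in> P ` \<Gamma> \<Longrightarrow> x \<noteq> 0 \<Longrightarrow> l \<le> 4 * D * norm x"
proof -
  define S where "S = {t. t > 0 \<and> t *\<^sub>R Z \<in> \<Gamma>}"
  obtain e where e: "e > 0" "\<And>x. x \<in> \<Gamma> \<Longrightarrow> norm x < e \<Longrightarrow> x = 0"
    using discrete_gap[OF \<Gamma>(2) zero_\<Gamma>] by metis
  have nZ: "norm Z > 0"
    using Z_nonzero by simp
  have S_ge: "e / norm Z \<le> t" if "t \<in> S" for t
  proof (rule ccontr)
    have t: "t > 0" "t *\<^sub>R Z \<in> \<Gamma>"
      using that by (auto simp: S_def)
    assume "\<not> ?thesis"
    then have "t * norm Z < e"
      using nZ by (simp add: pos_le_divide_eq not_le pos_less_divide_eq)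
    then have "t *\<^sub>R Z = 0"
      using t(1) by (intro e(2)[OF t(2)]) simp
    then show False
      using t(1) nZ by auto
  qed
  \<comment> \<open>A point at distance less than \<open>2 * D\<close> from a vector of length
    \<open>2 * D\<close> is nonzero, so it has a partner with a nontrivial commutator.\<close>
  have "S \<noteq> {}"
  proof -
    obtain x where x: "x \<in> P ` \<Gamma>" "dist ((2 * D) *\<^sub>R axis undefined 1) x < 2 * D"
      by (rule \<Lambda>_near)
    then have "x \<noteq> 0"
      using D by auto
    then obtain y where y: "y \<in> P ` \<Gamma>" "\<Omega> x y \<noteq> 0"
      by (rule \<Lambda>_noncommuting)
    have "\<bar>\<Omega> x y\<bar> \<in> S"
      using center_\<Gamma>_abs[OF commutator_\<Gamma>[OF x(1) y(1)]] y(2) by (simp add: S_def)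
    then show ?thesis
      by blast
  qed
  define m where "m = Inf S"
  have bdd: "bdd_below S"
    using S_ge by (rule bdd_belowI)
  have "e / norm Z \<le> m"
    unfolding m_def using \<open>S \<noteq> {}\<close> S_ge by (rule cInf_greatest)
  moreover have "e / norm Z > 0"
    using e(1) nZ by simp
  ultimately have "m < 2 * m"
    by linarith
  then obtain l where l: "l \<in> S" "l < 2 * m"
    using cInf_lessD[OF \<open>S \<noteq> {}\<close>] unfolding m_def by blast
  have gap: "t = 0" if t: "t *\<^sub>R Z \<in> \<Gamma>" "\<bar>t\<bar> < l" for t
  proof (rule ccontr)
    assume "t \<noteq> 0"
    then have "\<bar>t\<bar> \<in> S" "l - \<bar>t\<bar> \<in> S"
      using t l(1) center_\<Gamma>_abs[OF t(1)] center_\<Gamma>_diff[of l "\<bar>t\<bar>"] by (auto simp: S_def)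
    then have "m \<le> \<bar>t\<bar>" "m \<le> l - \<bar>t\<bar>"
      unfolding m_def using bdd by (auto intro: cInf_lower)
    with l(2) show False
      by linarith
  qed
  show ?thesis
  proof (rule that)
    show "l > 0" "l *\<^sub>R Z \<in> \<Gamma>"
      using l(1) by (auto simp: S_def)
    show "\<And>t. t *\<^sub>R Z \<in> \<Gamma> \<Longrightarrow> \<bar>t\<bar> < l \<Longrightarrow> t = 0"
      by (rule gap)
    fix x assume x: "x \<in> P ` \<Gamma>" "x \<noteq> 0"
    from x(2) obtain y where y: "y \<in> P ` \<Gamma>" "\<Omega> x y \<noteq> 0" "\<bar>\<Omega> x y\<bar> \<le> 4 * D * norm x"
      by (rule \<Lambda>_noncommuting)
    have "\<not> \<bar>\<Omega> x y\<bar> < l"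
      using gap[OF commutator_\<Gamma>[OF x(1) y(1)]] y(2) by blast
    with y(3) show "l \<le> 4 * D * norm x"
      by linarith
  qed
qed

text \<open>For each \<open>a\<close> in \<open>\<Gamma>\<close>, the point \<open>- a\<close> times
  \<open>q\<close> is displaced from \<open>p\<close> horizontally by
  \<open>P q - P p - P a\<close>. A further central factor, a multiple of
  \<open>l *\<^sub>R Z\<close>, brings the height difference down to at most \<open>l\<close> within
  the same coset, at a cost of order \<open>sqrt l\<close>.\<close>

lemma quotient_dist_le_infdist:
  fixes l :: real
  assumes l: "l > 0" "l *\<^sub>R Z \<in> \<Gamma>"
  shows "quotient_dist (cc_dist V g) (heis_coset \<Gamma> p) (heis_coset \<Gamma> q)
      \<le> infdist (P q - P p) (P ` \<Gamma>) + 126 * sqrt (140 * CARD('n) * l)"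
proof -
  let ?K = "126 * sqrt (140 * CARD('n) * l)" and ?d = "quotient_dist (cc_dist V g) (heis_coset \<Gamma> p) (heis_coset \<Gamma> q)"
  have "?d - ?K \<le> infdist (P q - P p) (P ` \<Gamma>)"
  proof (rule infdist_greatest)
    show "P ` \<Gamma> \<noteq> {}"
      using zero_\<Gamma> by blast
    fix y assume "y \<in> P ` \<Gamma>"
    then obtain a where a: "a \<in> \<Gamma>" "y = P a"
      by blast
    define x where "x = P q - P p - y"
    define r where "r = heis_mult (- p) (heis_mult (- a) q)"
    define k where "k = \<lfloor>z r / l\<rfloor>"
    define w where "w = z r - of_int k * l"
    have "P r = x"
      by (simp add: r_def x_def P_mult linear_neg[OF linP] a)
    then have r: "r = J x + z r *\<^sub>R Z"
      using decomp[of r] by simp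
    have k1: "of_int k * l \<le> z r"
      using l(1) mult_right_mono[OF of_int_floor_le[of "z r / l"], of l] by (simp add: k_def)
    have "z r / l < of_int k + 1"
      unfolding k_def by linarith
    then have "z r < of_int k * l + l"
      using l(1) by (simp add: divide_less_eq algebra_simps)
    with k1 have w: "\<bar>w\<bar> \<le> l"
      by (simp add: w_def)
    define b where "b = heis_mult (- ((of_int k * l) *\<^sub>R Z)) (heis_mult (- a) q)"
    have "b = heis_mult (heis_mult (- ((of_int k * l) *\<^sub>R Z)) (- a)) q"
      by (simp add: b_def heis_mult_assoc)
    then have b_in: "b \<in> heis_coset \<Gamma> q"
      unfolding heis_coset_eq by (simp add: mult_\<Gamma> neg_\<Gamma> a center_\<Gamma>_of_int[OF l(2)])
    have central: "heis_mult (s *\<^sub>R Z) v = v + s *\<^sub>R Z" "heis_mult u (v + s *\<^sub>R Z) = heis_mult u v + s *\<^sub>R Z" for u v s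
      by (simp_all add: heis_mult_def bracket_\<Omega> linear_add[OF linP] linear_scale[OF linP] \<Omega>_inner inner_add_right \<omega>_vec_def
          zero_vec_def[symmetric])
    have "heis_mult (- a) q = heis_mult p r"
      by (simp add: r_def)
    then have "b = heis_mult p r - (of_int k * l) *\<^sub>R Z"
      using central(1)[of "- (of_int k * l)" "heis_mult (- a) q"] by (simp add: b_def)
    also have "\<dots> = heis_mult p (r + (- (of_int k * l)) *\<^sub>R Z)"
      unfolding central(2) by simp
    also have "r + (- (of_int k * l)) *\<^sub>R Z = J x + w *\<^sub>R Z"
      by (subst r) (simp add: w_def scaleR_diff_left)
    finally have b: "b = heis_mult p (J x + w *\<^sub>R Z)" .
    have "heis_mult 0 p \<in> heis_coset \<Gamma> p"
      unfolding heis_coset_eq using zero_\<Gamma> by (rule imageI)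
    then have "?d \<le> cc_dist V g p b"
      using b_in by (intro quotient_dist_le) (simp_all add: cc_dist_def)
    also have "\<dots> \<le> norm x + 126 * sqrt (140 * CARD('n) * \<bar>w\<bar>)"
      unfolding b by (rule cc_dist_bounds)
    also have "\<dots> \<le> norm x + ?K"
      using w by (intro add_left_mono mult_left_mono real_sqrt_le_mono) auto
    finally show "?d - ?K \<le> dist (P q - P p) y"
      by (simp add: x_def dist_norm)
  qed
  then show ?thesis
    by simp
qed

text \<open>
  The points of the box with \<open>P p\<close> in a cube smaller than the shortest vector of \<open>P ` \<Gamma>\<close> are
  inequivalent modulo \<open>\<Gamma>\<close>.
\<close>

lemma quotient_total_ge:
  assumes l: "l > 0" and gap: "\<And>t. t *\<^sub>R Z \<in> \<Gamma> \<Longrightarrow> \<bar>t\<bar> < l \<Longrightarrow> t = 0"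
    and short: "\<And>x. x \<in> P ` \<Gamma> \<Longrightarrow> x \<noteq> 0 \<Longrightarrow> l \<le> 4 * D * norm x"
  shows "ennreal ((1 / (8 * D * CARD('n))) ^ (2 * CARD('n)) * l ^ (2 * CARD('n) + 1))
    \<le> quotient_total \<Gamma> (popp_measure V g)"
proof -
  define N where "N = real CARD('n)"
  have N: "N > 0"
    by (simp add: N_def)
  \<comment> \<open>Coordinates of \<open>P p\<close> and \<open>P q\<close> differ by less than
    \<open>2 * r\<close>; over \<open>2 * N\<close> coordinates this gives a norm below
    \<open>4 * N * r = l / (4 * D)\<close>, the lower bound for nonzero projected lattice
    vectors.\<close>
  define r where "r = l / (16 * D * N)"
  have r: "r > 0"
    using l D N by (simp add: r_def)
  define A where "A = {p. (\<forall>i. \<bar>P p $ i\<bar> < r) \<and> 0 < z p \<and> z p < l}"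
  have "A \<in> sets borel"
  proof -
    have cont: "continuous_on UNIV P" "continuous_on UNIV z"
      using linP linz by (simp_all add: linear_continuous_on linear_linear)
    have "A = (\<Inter>i. {p. \<bar>P p $ i\<bar> < r}) \<inter> {p. 0 < z p} \<inter> {p. z p < l}"
      by (auto simp: A_def)
    also have "open \<dots>"
      by (intro open_Int open_INT ballI open_Collect_less continuous_intros cont) auto
    finally show ?thesis
      by simp
  qed
  moreover have "inj_on (heis_coset \<Gamma>) A"
  proof (rule inj_onI)
    fix p q assume p: "p \<in> A" and q: "q \<in> A" and "heis_coset \<Gamma> p = heis_coset \<Gamma> q"
    then obtain x where x: "x \<in> \<Gamma>" "q = heis_mult x p"
      using heis_coset_eq_iff[OF \<Gamma>(1)] by blast
    have "P x = P q - P p"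
      by (simp add: x P_mult)
    then have "\<bar>P x $ i\<bar> < 2 * r" for i
      using p q by (auto simp: A_def abs_less_iff dest!: spec[of _ i])
    then have "(\<Sum>i\<in>UNIV. \<bar>P x $ i\<bar>) < (\<Sum>i\<in>(UNIV :: ('n + 'n) set). 2 * r)"
      by (intro sum_strict_mono) auto
    then have "norm (P x) < 2 * N * (2 * r)"
      using norm_le_l1_cart[of "P x"] by (simp add: N_def)
    also have "\<dots> = l / (4 * D)"
      using N by (simp add: r_def)
    finally have "4 * D * norm (P x) < l"
      using D by (simp add: field_simps)
    then have Px: "P x = 0"
      using short[of "P x"] x(1) by force
    then have xZ: "x = z x *\<^sub>R Z"
      using decomp[of x] by (simp add: linear_0[OF linJ])
    have "q = x + p"
      unfolding x(2) heis_mult_def bracket_\<Omega> Px by (simp add: \<Omega>_def)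
    then have "z q = z x + z p"
      by (simp add: linear_add[OF linz])
    then have "\<bar>z x\<bar> < l"
      using p q by (auto simp: A_def)
    then have "z x = 0"
      using gap x(1) xZ by metis
    with xZ \<open>q = x + p\<close> show "p = q"
      by simp
  qed
  ultimately have "emeasure (popp_measure V g) A \<le> quotient_total \<Gamma> (popp_measure V g)"
    using \<Gamma> popp_invariant by (intro emeasure_le_quotient_total) (simp_all add: popp_measure_def)
  moreover have "emeasure (popp_measure V g) A = ennreal ((2 * r) ^ (2 * CARD('n)) * l)"
    unfolding A_def using r l by (intro popp_box) auto
  moreover have "(2 * r) ^ (2 * CARD('n)) * l = (1 / (8 * D * CARD('n))) ^ (2 * CARD('n)) * l ^ (2 * CARD('n) + 1)"
  proof -
    have "2 * r = (1 / (8 * D * CARD('n))) * l"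
      by (simp add: r_def N_def)
    then show ?thesis
      by (simp only: power_mult_distrib power_add power_one_right mult.assoc)
  qed
  ultimately show ?thesis
    by (simp only:)
qed

end

text \<open>What the limit argument retains of one quotient: the coordinates and the metric are
  forgotten, so that choosing \<open>P\<close>, \<open>L\<close> and \<open>l\<close> for every
  \<open>k\<close> suffices.\<close>

definition near_torus :: "'n::finite heis set \<Rightarrow> ('n heis set \<Rightarrow> 'n heis set \<Rightarrow> real) \<Rightarrow> real \<Rightarrow>
    ('n heis \<Rightarrow> real^('n + 'n)) \<Rightarrow> (real^('n + 'n)) set \<Rightarrow> real \<Rightarrow> bool" where
  "near_torus \<Gamma> d D P L l \<longleftrightarrow> l > 0 \<and> surj P \<and> vector_subgroup L \<and> (\<forall>x. infdist x L \<le> D) \<and>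
    (\<forall>p q. \<bar>d (heis_coset \<Gamma> p) (heis_coset \<Gamma> q) - infdist (P q - P p) L\<bar> \<le> 126 * sqrt (real (140 * CARD('n)) * l))"

lemma popp_quotient_summary:
  fixes \<Gamma> V :: "'n::finite heis set" and D :: real
  assumes lat: "heis_lattice \<Gamma>" and sr: "sub_riemannian V g" and D: "D > 0"
    and diam: "metric_diameter (heis_quotient \<Gamma>) (quotient_dist (cc_dist V g)) \<le> ereal D"
  shows "\<exists>P L l. near_torus \<Gamma> (quotient_dist (cc_dist V g)) D P L l \<and>
    ennreal ((1 / (8 * D * CARD('n))) ^ (2 * CARD('n)) * l ^ (2 * CARD('n) + 1))
      \<le> quotient_total \<Gamma> (popp_measure V g)"
proof -
  obtain P z J Z \<omega> where "popp_coordinates V g P z J Z \<omega>"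
    using popp_coordinates_exist[OF sr] by (elim exE)
  then interpret popp_coordinates V g P z J Z \<omega> .
  interpret popp_quotient V g P z J Z \<omega> \<Gamma> D
  proof
    show "heis_subgroup \<Gamma>" "discrete \<Gamma>"
      using lat by (auto simp: heis_lattice_def intro: heis_subgroupI)
    fix p q
    have "ereal (quotient_dist (cc_dist V g) (heis_coset \<Gamma> p) (heis_coset \<Gamma> q))
        \<le> metric_diameter (heis_quotient \<Gamma>) (quotient_dist (cc_dist V g))"
      unfolding metric_diameter_def
      by (rule SUP_upper2[of "(heis_coset \<Gamma> p, heis_coset \<Gamma> q)"]) (auto simp: heis_quotient_eq)
    also note diam
    finally show "quotient_dist (cc_dist V g) (heis_coset \<Gamma> p) (heis_coset \<Gamma> q) \<le> D"
      by simp
  qed (rule D)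
  obtain l where l: "l > 0" "l *\<^sub>R Z \<in> \<Gamma>" and gap: "\<And>t. t *\<^sub>R Z \<in> \<Gamma> \<Longrightarrow> \<bar>t\<bar> < l \<Longrightarrow> t = 0"
    and short: "\<And>x. x \<in> P ` \<Gamma> \<Longrightarrow> x \<noteq> 0 \<Longrightarrow> l \<le> 4 * D * norm x"
    using fibre_length_exists by metis
  show ?thesis
    unfolding near_torus_def
  proof (intro exI[of _ P] exI[of _ "P ` \<Gamma>"] exI[of _ l] conjI allI)
    show "surj P"
      using PJ by (rule surjI)
    show "\<bar>quotient_dist (cc_dist V g) (heis_coset \<Gamma> p) (heis_coset \<Gamma> q) - infdist (P q - P p) (P ` \<Gamma>)\<bar>
        \<le> 126 * sqrt (real (140 * CARD('n)) * l)" for p q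
      using infdist_le_quotient_dist[of q p] quotient_dist_le_infdist[OF l, of p q] by linarith
    show "ennreal ((1 / (8 * D * CARD('n))) ^ (2 * CARD('n)) * l ^ (2 * CARD('n) + 1))
      \<le> quotient_total \<Gamma> (popp_measure V g)"
      by (rule quotient_total_ge[OF l(1) gap short])
  qed (fact l subgroup_\<Lambda> infdist_\<Lambda>_le)+
qed

text \<open>Points are matched if their images in a common metric space are at distance at most
  \<open>s\<close>, for some \<open>s\<close> below \<open>r\<close>; two triangle inequalities
  bound the distortion by \<open>2 * s\<close>.\<close>

lemma gh_dist_correspondence:
  fixes M :: "'a set" and X :: "'b set"
  assumes lt: "gh_dist M dM X d < ennreal r"
  shows "\<exists>S. (\<forall>A\<in>M. \<exists>x\<in>X. S A x) \<and> (\<forall>x\<in>X. \<exists>A\<in>M. S A x) \<and>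
    (\<forall>A\<in>M. \<forall>B\<in>M. \<forall>x\<in>X. \<forall>y\<in>X. S A x \<longrightarrow> S B y \<longrightarrow> \<bar>d x y - dM A B\<bar> \<le> 2 * r)"
proof -
  obtain Z \<delta> f h where Z: "Metric_space (Z :: ('a + 'b) set) \<delta>"
    and f: "isometric_embedding M dM Z \<delta> f" and h: "isometric_embedding X d Z \<delta> h"
    and hd: "hausdorff_dist \<delta> (f ` M) (h ` X) < ennreal r"
    using lt unfolding gh_dist_def Inf_less_iff by blast
  obtain s where s: "0 \<le> s" "\<forall>a\<in>f ` M. \<exists>b\<in>h ` X. \<delta> a b \<le> s" "\<forall>b\<in>h ` X. \<exists>a\<in>f ` M. \<delta> a b \<le> s"
    and sr: "ennreal s < ennreal r"
    using hd unfolding hausdorff_dist_def INF_less_iff by blast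
  interpret Metric_space Z \<delta>
    by (rule Z)
  have "s < r"
    using sr s(1) by (simp add: ennreal_less_iff)
  have fZ: "f A \<in> Z" if "A \<in> M" for A
    using f that by (auto simp: isometric_embedding_def)
  have hZ: "h x \<in> Z" if "x \<in> X" for x
    using h that by (auto simp: isometric_embedding_def)
  show ?thesis
  proof (intro exI[of _ "\<lambda>A x. \<delta> (f A) (h x) \<le> s"] conjI ballI impI)
    show "\<exists>x\<in>X. \<delta> (f A) (h x) \<le> s" if "A \<in> M" for A
      using s(2) that by blast
    show "\<exists>A\<in>M. \<delta> (f A) (h x) \<le> s" if "x \<in> X" for x
      using s(3) that by blast
    fix A B x y
    assume *: "A \<in> M" "B \<in> M" "x \<in> X" "y \<in> X" and Ax: "\<delta> (f A) (h x) \<le> s" and By: "\<delta> (f B) (h y) \<le> s"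
    have dM: "dM A B = \<delta> (f A) (f B)" and d: "d x y = \<delta> (h x) (h y)"
      using f h * by (simp_all add: isometric_embedding_def)
    have "\<delta> (f A) (f B) \<le> \<delta> (f A) (h x) + \<delta> (h x) (h y) + \<delta> (f B) (h y)"
      using triangle[of "f A" "h x" "f B"] triangle[of "h x" "h y" "f B"] fZ hZ * commute[of "h y" "f B"] by fastforce
    moreover have "\<delta> (h x) (h y) \<le> \<delta> (f A) (h x) + \<delta> (f A) (f B) + \<delta> (f B) (h y)"
      using triangle[of "h x" "f A" "h y"] triangle[of "f A" "f B" "h y"] fZ hZ * commute[of "h x" "f A"] by fastforce
    ultimately show "\<bar>d x y - dM A B\<bar> \<le> 2 * r"
      unfolding dM d using Ax By \<open>s < r\<close> by linarith
  qed
qed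

theorem corollary1p1:
  fixes \<Gamma> :: "nat \<Rightarrow> 'n::finite heis set"
    and V :: "nat \<Rightarrow> 'n heis set"
    and g :: "nat \<Rightarrow> 'n heis \<Rightarrow> 'n heis \<Rightarrow> real"
    and X :: "'a set" and d :: "'a \<Rightarrow> 'a \<Rightarrow> real"
    and D :: real
  assumes lattice: "\<And>k. heis_lattice (\<Gamma> k)"
    and metric: "\<And>k. sub_riemannian (V k) (g k)"
    and limit_space: "Metric_space X d" "compact_space (Metric_space.mtopology X d)"
    and converges:
      "(\<lambda>k. gh_dist (heis_quotient (\<Gamma> k)) (quotient_dist (cc_dist (V k) (g k))) X d) \<longlonglongrightarrow> 0"
    and diameter: "D > 0"
      "\<And>k. metric_diameter (heis_quotient (\<Gamma> k)) (quotient_dist (cc_dist (V k) (g k))) \<le> ereal D"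
    and collapse: "(\<lambda>k. quotient_total (\<Gamma> k) (popp_measure (V k) (g k))) \<longlonglongrightarrow> 0"
  shows "\<exists>m b. m < 2 * CARD('n) + 1 \<and> euclidean_basis m b \<and>
           isometric_spaces X d (flat_torus m b) (flat_torus_dist m)"
proof -
  define M where "M k = heis_quotient (\<Gamma> k)" for k
  define q where "q k = quotient_dist (cc_dist (V k) (g k))" for k
  define C where "C = (1 / (8 * D * CARD('n))) ^ (2 * CARD('n))"
  define N where "N = 2 * CARD('n) + 1"
  have "\<exists>P L l. near_torus (\<Gamma> k) (q k) D P L l \<and>
      ennreal (C * l ^ N) \<le> quotient_total (\<Gamma> k) (popp_measure (V k) (g k))" for k
    unfolding q_def C_def N_def by (rule popp_quotient_summary[OF lattice metric diameter])
  then obtain P L l where near: "\<And>k. near_torus (\<Gamma> k) (q k) D (P k) (L k) (l k)"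
    and total: "\<And>k. ennreal (C * l k ^ N) \<le> quotient_total (\<Gamma> k) (popp_measure (V k) (g k))"
    by metis
  have l: "l k > 0" and P: "surj (P k)" and L: "vector_subgroup (L k)" and LD: "infdist x (L k) \<le> D"
    and qP: "\<bar>q k (heis_coset (\<Gamma> k) u) (heis_coset (\<Gamma> k) v) - infdist (P k v - P k u) (L k)\<bar>
        \<le> 126 * sqrt (real (140 * CARD('n)) * l k)" for k x u v
    using near[of k] unfolding near_torus_def by blast+
  have C: "C > 0"
    using diameter(1) by (simp add: C_def)
  have "l \<longlonglongrightarrow> 0"
  proof -
    have "(\<lambda>k. ennreal (C * l k ^ N)) \<longlonglongrightarrow> 0"
      by (rule tendsto_sandwich[OF _ _ tendsto_const collapse]) (auto simp: total)
    then have "(\<lambda>k. C * l k ^ N) \<longlonglongrightarrow> 0"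
      using C l by (subst (asm) ennreal_tendsto_0_iff) (auto intro!: mult_nonneg_nonneg less_imp_le)
    then have "(\<lambda>k. inverse C * (C * l k ^ N)) \<longlonglongrightarrow> inverse C * 0"
      by (intro tendsto_intros)
    then have "(\<lambda>k. l k ^ N) \<longlonglongrightarrow> 0"
      using C by (simp flip: mult.assoc)
    then have "(\<lambda>k. root N (l k ^ N)) \<longlonglongrightarrow> root N 0"
      by (rule tendsto_real_root)
    moreover have "root N (l k ^ N) = l k" for k
      using l[of k] by (intro real_root_power_cancel) (auto simp: N_def)
    ultimately show ?thesis
      by simp
  qed
  \<comment> \<open>The added null sequence makes the comparison with the Gromov-Hausdorff distance
    strict. The passage to reals is faithful once that distance is finite, hence for all large
    \<open>k\<close>.\<close>
  define \<rho> where "\<rho> k = enn2real (gh_dist (M k) (q k) X d) + inverse (real (Suc k))" for k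
  have "\<rho> \<longlonglongrightarrow> 0"
  proof -
    have "(\<lambda>k. enn2real (gh_dist (M k) (q k) X d)) \<longlonglongrightarrow> 0"
      unfolding M_def q_def using converges by (intro tendsto_enn2real) simp_all
    then have "\<rho> \<longlonglongrightarrow> 0 + 0"
      unfolding \<rho>_def by (intro tendsto_add LIMSEQ_inverse_real_of_nat)
    then show ?thesis
      by simp
  qed
  define corr where "corr k S \<longleftrightarrow> (\<forall>A\<in>M k. \<exists>x\<in>X. S A x) \<and> (\<forall>x\<in>X. \<exists>A\<in>M k. S A x) \<and>
    (\<forall>A\<in>M k. \<forall>B\<in>M k. \<forall>x\<in>X. \<forall>y\<in>X. S A x \<longrightarrow> S B y \<longrightarrow> \<bar>d x y - q k A B\<bar> \<le> 2 * \<rho> k)" for k S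
  \<comment> \<open>Arbitrary for those \<open>k\<close> where no correspondence is found; the
    statements about \<open>S k\<close> are eventual.\<close>
  define S where "S k = (SOME S. corr k S)" for k
  have corr: "\<forall>\<^sub>F k in sequentially. corr k (S k)"
  proof -
    have "\<forall>\<^sub>F k in sequentially. gh_dist (M k) (q k) X d < 1"
      using order_tendstoD(2)[OF converges, of 1] by (simp add: M_def q_def)
    then show ?thesis
    proof eventually_elim
      case (elim k)
      then have "gh_dist (M k) (q k) X d = ennreal (enn2real (gh_dist (M k) (q k) X d))"
        using less_trans[OF elim ennreal_one_less_top] by simp
      also have "\<dots> < ennreal (\<rho> k)"
        unfolding \<rho>_def by (intro ennreal_lessI) (auto intro: add_nonneg_pos)
      finally have "\<exists>S. corr k S"
        unfolding corr_def by (rule gh_dist_correspondence)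
      then show "corr k (S k)"
        unfolding S_def by (rule someI_ex)
    qed
  qed
  \<comment> \<open>A vector corresponds to \<open>x\<close> if some lift of it to the group has a
    coset matched with \<open>x\<close>. Different lifts differ along the centre, and their cosets
    are within the error of \<open>near_torus\<close>.\<close>
  define R where "R k x v \<longleftrightarrow> (\<exists>p. P k p = v \<and> S k (heis_coset (\<Gamma> k) p) x)" for k x v
  have M: "heis_coset (\<Gamma> k) p \<in> M k" for k p
    by (auto simp: M_def heis_quotient_eq)
  have "\<exists>m b. m \<le> DIM(real^('n + 'n)) \<and> euclidean_basis m b \<and>
      isometric_spaces X d (flat_torus m b) (flat_torus_dist m)"
  proof (rule limit_of_flat_tori[OF limit_space L LD])
    show "\<forall>\<^sub>F k in sequentially. \<forall>x\<in>X. \<exists>v. R k x v"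
      using corr
    proof eventually_elim
      case (elim k)
      then show ?case
        unfolding corr_def R_def M_def heis_quotient_eq by blast
    qed
    show "\<forall>\<^sub>F k in sequentially. \<forall>v. \<exists>x\<in>X. R k x v"
      using corr
    proof eventually_elim
      case (elim k)
      show ?case
      proof
        fix v
        obtain p where "P k p = v"
          using P[of k] by (metis surjD)
        moreover obtain x where "x \<in> X" "S k (heis_coset (\<Gamma> k) p) x"
          using elim M unfolding corr_def by blast
        ultimately show "\<exists>x\<in>X. R k x v"
          unfolding R_def by blast
      qed
    qed
    show "\<forall>\<^sub>F k in sequentially. \<forall>x\<in>X. \<forall>y\<in>X. \<forall>v w. R k x v \<longrightarrow> R k y w \<longrightarrow>
        \<bar>d x y - infdist (v - w) (L k)\<bar> \<le> 2 * \<rho> k + 126 * sqrt (real (140 * CARD('n)) * l k)"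
      using corr
    proof eventually_elim
      case (elim k)
      show ?case
      proof (intro ballI allI impI)
        fix x y v w assume xy: "x \<in> X" "y \<in> X" and "R k x v" "R k y w"
        then obtain p p' where p: "P k p = v" "S k (heis_coset (\<Gamma> k) p) x"
          and p': "P k p' = w" "S k (heis_coset (\<Gamma> k) p') y"
          unfolding R_def by blast
        have "\<bar>d x y - q k (heis_coset (\<Gamma> k) p) (heis_coset (\<Gamma> k) p')\<bar> \<le> 2 * \<rho> k"
          using elim xy p p' M unfolding corr_def by blast
        moreover have "infdist (v - w) (L k) = infdist (P k p' - P k p) (L k)"
          using infdist_subgroup_neg[OF L, of "v - w" k] by (simp add: p p')
        ultimately show "\<bar>d x y - infdist (v - w) (L k)\<bar> \<le> 2 * \<rho> k + 126 * sqrt (real (140 * CARD('n)) * l k)"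
          using qP[of k p p'] by linarith
      qed
    qed
    have "(\<lambda>k. 2 * \<rho> k + 126 * sqrt (real (140 * CARD('n)) * l k)) \<longlonglongrightarrow> 2 * 0 + 126 * sqrt (real (140 * CARD('n)) * 0)"
      by (intro tendsto_intros \<open>\<rho> \<longlonglongrightarrow> 0\<close> \<open>l \<longlonglongrightarrow> 0\<close>)
    then show "(\<lambda>k. 2 * \<rho> k + 126 * sqrt (real (140 * CARD('n)) * l k)) \<longlonglongrightarrow> 0"
      by simp
  qed
  then obtain m b where "m \<le> DIM(real^('n + 'n))" "euclidean_basis m b"
    "isometric_spaces X d (flat_torus m b) (flat_torus_dist m)"
    by (elim exE conjE)
  then show ?thesis
    by (intro exI[of _ m] exI[of _ b]) simp
qed

end
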